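(* Assume that $\mathbb{P}(\lim_{|t|\to\infty}|\boldsymbol Y_t|=0)=1$. Then $$\vartheta\,\mathbb{E}\left[\left(\sum_{j\in\mathbb{Z}}|\boldsymbol Q_j|\right)^\alpha\right]=\mathbb{E}\left[\left(\sum_{j\in\mathbb{Z}}|\boldsymbol\Theta_j|\right)^{\alpha-1}\right].$$ These quantities are always finite if $\alpha\le1$ and are simultaneously finite or infinite if $\alpha>1$. Moreover, the following conditions are equivalent: $$\mathbb{E}\left[\left(\sum_{j\in\mathbb{Z}}|\boldsymbol Q_j|\right)^\alpha\right]<\infty\qquad\text{and}\qquad \mathbb{E}\left[\left(\sum_{j=0}^\infty|\boldsymbol\Theta_j|\right)^{\alpha-1}\right]<\infty .$$
   Context: Let $|\cdot|$ be an arbitrary norm on $\mathbb{R}^d$. Let $\{\boldsymbol X_j,j\in\mathbb{Z}\}$ be a stationary $\mathbb{R}^d$-valued time series which is regularly varying: for all integers $s\le t$ there is a non-zero Radon measure $\nu_{s,t}$ on $(\mathbb{R}^d)^{[s,t]}\setminus\{\boldsymbol 0\}$ such that $\mathbb{P}(u^{-1}(\boldsymbol X_s,\dots,\boldsymbol X_t)\in\cdot)/\mathbb{P}(|\boldsymbol X_0|>u)\to\nu_{s,t}$ vaguely as $u\to\infty$. Let $\alpha>0$ be its tail index. The tail process is the random sequence $\boldsymbol Y=\{\boldsymbol Y_j,j\in\mathbb{Z}\}$ with $\mathbb{P}(|\boldsymbol Y_0|>y)=y^{-\alpha}$ for $y\ge1$ and such that, for all $s\le t$, the law of $u^{-1}(\boldsymbol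 X_s,\dots,\boldsymbol X_t)$ conditionally on $|\boldsymbol X_0|>u$ converges weakly to that of $(\boldsymbol Y_s,\dots,\boldsymbol Y_t)$ as $u\to\infty$. The spectral tail process is $\boldsymbol\Theta_j=\boldsymbol Y_j/|\boldsymbol Y_0|$, $j\in\mathbb{Z}$; it is independent of $|\boldsymbol Y_0|$. The tail measure $\nu$ is the unique Borel measure on $(\mathbb{R}^d)^{\mathbb{Z}}$ (product topology) with $\nu(\{\boldsymbol 0\})=0$ and $\nu\circ p_{s,t}^{-1}=\nu_{s,t}$ on $(\mathbb{R}^d)^{[s,t]}\setminus\{\boldsymbol 0\}$ for all $s\le t$, where $p_{s,t}$ is the canonical projection. It is known that $\nu$ is $\sigma$-finite, shift invariant, satisfies $\nu(c\,\cdot)=c^{-\alpha}\nu$ for all $c>0$, and $\mathbb{E}[H(\boldsymbol Y)]=\int H(\boldsymbol y)\mathbf{1}\{|\boldsymbol y_0|>1\}\,\nu(\mathrm{d}\boldsymbol y)$ for every non negative measurable $H$. Notation: for $-\infty\le s\le t\le\infty$, $\boldsymbol y^*_{s,t}=\max_{s\le i\le t}|\boldsymbol y_i|$ and $\boldsymbol y^*=\max_{i\in\mathbb{Z}}|\boldsymbol y_i|$ (understood as suprema in $[0,\infty]$). The candidate extremal index is $\vartheta=\mathbb{P}(\sup_{j\ge1}|\boldsymbol Y_j|\le1)$, which also equals $\mathbb{P}(\sup_{j\le-1}|\boldsymbol Y_j|\le1)$; when $\mathbb{P}(\lim_{|k|\to\infty}|\boldsymbol Y_k|=0)=1$, one has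 $\vartheta>0$. In that case $\boldsymbol Q=\{\boldsymbol Q_j,j\in\mathbb{Z}\}$ denotes a random sequence whose distribution is that of $(\boldsymbol Y^* )^{-1}\boldsymbol Y$ conditionally on $\boldsymbol Y^*_{-\infty,-1}\le1$. *)

theory Defs
  imports "HOL-Probability.Probability"
begin

text \<open>Processes are curried as \<open>X j \<omega>\<close> with time index \<open>j :: int\<close>. The Euclidean type class norm plays
  no role beyond fixing the topology: all sizes are measured by an arbitrary norm \<open>nrm\<close>.\<close>

definition is_norm :: "('v::real_vector \<Rightarrow> real) \<Rightarrow> bool" where
  "is_norm nrm \<longleftrightarrow>
     (\<forall>x. 0 \<le> nrm x) \<and> (\<forall>x. nrm x = 0 \<longleftrightarrow> x = 0) \<and>
     (\<forall>c x. nrm (c *\<^sub>R x) = \<bar>c\<bar> * nrm x) \<and>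
     (\<forall>x y. nrm (x + y) \<le> nrm x + nrm y)"

definition process :: "'w measure \<Rightarrow> (int \<Rightarrow> 'w \<Rightarrow> real ^ 'd) \<Rightarrow> bool" where
  "process M X \<longleftrightarrow> prob_space M \<and> (\<forall>j. X j \<in> borel_measurable M)"

definition path_law :: "'w measure \<Rightarrow> (int \<Rightarrow> 'w \<Rightarrow> real ^ 'd) \<Rightarrow> (int \<Rightarrow> real ^ 'd) measure" where
  "path_law M X = distr M (Pi\<^sub>M UNIV (\<lambda>_. borel)) (\<lambda>\<omega> j. X j \<omega>)"

definition stationary_process :: "'w measure \<Rightarrow> (int \<Rightarrow> 'w \<Rightarrow> real ^ 'd) \<Rightarrow> bool" where
  "stationary_process M X \<longleftrightarrow>
     process M X \<and> (\<forall>h. path_law M (\<lambda>j. X (j + h)) = path_law M X)"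


subsection \<open>Windows\<close>

text \<open>\<open>(\<real>\<^sup>d)\<^bsup>[s,t]\<^esup>\<close> is the set of extensional functions on \<open>{s..t}\<close>.\<close>

definition window_top :: "int \<Rightarrow> int \<Rightarrow> (int \<Rightarrow> real ^ 'd) topology" where
  "window_top s t = product_topology (\<lambda>_. euclidean) {s..t}"

definition window_zero :: "int \<Rightarrow> int \<Rightarrow> int \<Rightarrow> real ^ 'd" where
  "window_zero s t = (\<lambda>i\<in>{s..t}. 0)"

definition punctured_top :: "int \<Rightarrow> int \<Rightarrow> (int \<Rightarrow> real ^ 'd) topology" where
  "punctured_top s t = subtopology (window_top s t) (- {window_zero s t})"

definition punctured_space :: "int \<Rightarrow> int \<Rightarrow> (int \<Rightarrow> real ^ 'd) measure" where
  "punctured_space s t = restrict_space (Pi\<^sub>M {s..t} (\<lambda>_. borel)) (- {window_zero s t})"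

text \<open>The law of \<open>u\<^sup>-\<^sup>1 (X\<^sub>s, \<dots>, X\<^sub>t)\<close>.\<close>

definition scaled_window_law ::
    "'w measure \<Rightarrow> (int \<Rightarrow> 'w \<Rightarrow> real ^ 'd) \<Rightarrow> int \<Rightarrow> int \<Rightarrow> real \<Rightarrow> (int \<Rightarrow> real ^ 'd) measure" where
  "scaled_window_law M X s t u =
     distr M (Pi\<^sub>M {s..t} (\<lambda>_. borel)) (\<lambda>\<omega>. \<lambda>i\<in>{s..t}. X i \<omega> /\<^sub>R u)"


subsection \<open>Regular variation\<close>

text \<open>The punctured space is locally compact and second countable, so a Borel measure on it is
  Radon iff it is finite on compact sets.\<close>

definition radon_punctured :: "int \<Rightarrow> int \<Rightarrow> (int \<Rightarrow> real ^ 'd) measure \<Rightarrow> bool" where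
  "radon_punctured s t \<nu> \<longleftrightarrow>
     sets \<nu> = sets (punctured_space s t) \<and>
     (\<forall>K. compactin (punctured_top s t) K \<longrightarrow> emeasure \<nu> K < \<infinity>)"

text \<open>Continuous functions with compact support in the punctured space, extended by 0 to the
  whole window space.\<close>

definition vague_test :: "int \<Rightarrow> int \<Rightarrow> ((int \<Rightarrow> real ^ 'd) \<Rightarrow> real) \<Rightarrow> bool" where
  "vague_test s t f \<longleftrightarrow>
     continuous_map (window_top s t) euclideanreal f \<and>
     (\<exists>K. compactin (punctured_top s t) K \<and> (\<forall>x \<in> topspace (window_top s t) - K. f x = 0))"

text \<open>Regular variation with tail index \<open>\<alpha>\<close>, the index being minus the degree of homogeneity of the
  limit measures. If \<open>P(nrm X\<^sub>0 > u)\<close> vanished for large \<open>u\<close>, the quotients below would be 0 and the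
  limit measures could not be nonzero.\<close>

definition regularly_varying ::
    "(real ^ 'd \<Rightarrow> real) \<Rightarrow> 'w measure \<Rightarrow> (int \<Rightarrow> 'w \<Rightarrow> real ^ 'd) \<Rightarrow> real \<Rightarrow> bool" where
  "regularly_varying nrm M X \<alpha> \<longleftrightarrow>
     \<alpha> > 0 \<and>
     (\<exists>\<nu>. \<forall>s t. s \<le> t \<longrightarrow>
        radon_punctured s t (\<nu> s t) \<and>
        emeasure (\<nu> s t) (space (\<nu> s t)) \<noteq> 0 \<and>
        (\<forall>f. vague_test s t f \<longrightarrow>
           ((\<lambda>u. (\<integral>x. f x \<partial>scaled_window_law M X s t u)
                  / measure M {\<omega> \<in> space M. nrm (X 0 \<omega>) > u})
             \<longlongrightarrow> (\<integral>x. f x \<partial>\<nu> s t)) at_top) \<and>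
        (\<forall>c A. c > 0 \<longrightarrow> A \<in> sets (\<nu> s t) \<longrightarrow>
           emeasure (\<nu> s t) ((\<lambda>x. \<lambda>i\<in>{s..t}. c *\<^sub>R x i) ` A)
             = ennreal (c powr (- \<alpha>)) * emeasure (\<nu> s t) A))"


subsection \<open>Tail process, spectral tail process and the sequence \<open>Q\<close>\<close>

text \<open>\<open>Y\<close> may live on a probability space of its own.\<close>

definition tail_process ::
    "(real ^ 'd \<Rightarrow> real) \<Rightarrow> 'w measure \<Rightarrow> (int \<Rightarrow> 'w \<Rightarrow> real ^ 'd) \<Rightarrow> real
      \<Rightarrow> 'y measure \<Rightarrow> (int \<Rightarrow> 'y \<Rightarrow> real ^ 'd) \<Rightarrow> bool" where
  "tail_process nrm M X \<alpha> MY Y \<longleftrightarrow>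
     process MY Y \<and>
     (\<forall>y\<ge>1. measure MY {\<omega> \<in> space MY. nrm (Y 0 \<omega>) > y} = y powr (- \<alpha>)) \<and>
     (\<forall>s t f. s \<le> t \<longrightarrow>
        continuous_map (window_top s t) euclideanreal f \<longrightarrow>
        bounded (f ` topspace (window_top s t)) \<longrightarrow>
        ((\<lambda>u. \<integral>x. f x \<partial>scaled_window_law
                 (uniform_measure M {\<omega> \<in> space M. nrm (X 0 \<omega>) > u}) X s t u)
          \<longlongrightarrow> (\<integral>x. f x \<partial>scaled_window_law MY Y s t 1)) at_top)"

definition spectral_tail_process ::
    "(real ^ 'd \<Rightarrow> real) \<Rightarrow> (int \<Rightarrow> 'y \<Rightarrow> real ^ 'd) \<Rightarrow> int \<Rightarrow> 'y \<Rightarrow> real ^ 'd" where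
  "spectral_tail_process nrm Y j \<omega> = Y j \<omega> /\<^sub>R nrm (Y 0 \<omega>)"

definition sup_norm :: "(real ^ 'd \<Rightarrow> real) \<Rightarrow> (int \<Rightarrow> 'y \<Rightarrow> real ^ 'd) \<Rightarrow> int set \<Rightarrow> 'y \<Rightarrow> ennreal" where
  "sup_norm nrm Y J \<omega> = (SUP j\<in>J. ennreal (nrm (Y j \<omega>)))"

definition sum_norm :: "(real ^ 'd \<Rightarrow> real) \<Rightarrow> (int \<Rightarrow> 'y \<Rightarrow> real ^ 'd) \<Rightarrow> int set \<Rightarrow> 'y \<Rightarrow> ennreal" where
  "sum_norm nrm Y J \<omega> = (\<Sum>\<^sub>\<infinity>j\<in>J. ennreal (nrm (Y j \<omega>)))"

definition candidate_extremal_index ::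
    "(real ^ 'd \<Rightarrow> real) \<Rightarrow> 'y measure \<Rightarrow> (int \<Rightarrow> 'y \<Rightarrow> real ^ 'd) \<Rightarrow> real" where
  "candidate_extremal_index nrm MY Y = measure MY {\<omega> \<in> space MY. sup_norm nrm Y {1..} \<omega> \<le> 1}"

text \<open>\<open>Q\<close> is any sequence with the prescribed law. On the event that the supremum of the path is
  infinite (a null event if \<open>Y\<close> vanishes at infinity), the normalised path is 0.\<close>

definition Q_sequence ::
    "(real ^ 'd \<Rightarrow> real) \<Rightarrow> 'y measure \<Rightarrow> (int \<Rightarrow> 'y \<Rightarrow> real ^ 'd)
      \<Rightarrow> 'q measure \<Rightarrow> (int \<Rightarrow> 'q \<Rightarrow> real ^ 'd) \<Rightarrow> bool" where
  "Q_sequence nrm MY Y MQ Q \<longleftrightarrow>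
     process MQ Q \<and>
     path_law MQ Q =
       path_law (uniform_measure MY {\<omega> \<in> space MY. sup_norm nrm Y {..-1} \<omega> \<le> 1})
         (\<lambda>j \<omega>. Y j \<omega> /\<^sub>R enn2real (sup_norm nrm Y UNIV \<omega>))"


text \<open>Real powers on \<open>[0,\<infinity>]\<close>, continuous in the base: for \<open>a > 0\<close> we have \<open>0\<^sup>a = 0\<close> and
  \<open>\<infinity>\<^sup>a = \<infinity>\<close>, for \<open>a < 0\<close> these values are exchanged, and \<open>x\<^sup>0 = 1\<close> throughout.\<close>

definition ennreal_powr :: "ennreal \<Rightarrow> real \<Rightarrow> ennreal" where
  "ennreal_powr x a =
     (if a = 0 then 1
      else if x = 0 then (if a > 0 then 0 else \<infinity>)
      else if x = \<infinity> then (if a > 0 then \<infinity> else 0)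
      else ennreal (enn2real x powr a))"

end

theory Submission
  imports Defs
begin

text \<open>
  Write \<open>a\<^sub>i = |y\<^sub>i|\<^sup>\<alpha>\<close> for a path \<open>y\<close>. The tail measure enters the proof only through two identities for
  the law of \<open>Y\<close>, both read off from the conditional limits that define the tail process. Stationarity
  of \<open>X\<close> gives \<open>E[H(Y); |Y\<^sub>i| > 1] = E[H(B\<^sup>iY); |Y\<^sub>-\<^sub>i| > 1]\<close>, where \<open>B\<close> is the backshift; conditioning at the
  level \<open>ru\<close> instead of \<open>u\<close> gives \<open>E[H(rY)] = r\<^sup>\<alpha> E[H(Y); |Y\<^sub>0| > r]\<close> for \<open>r \<ge> 1\<close>. They are
  \<open>tail_law_shift\<close> and \<open>tail_law_scale\<close>: for products of continuous functions of finitely many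
  coordinates both sides come from the same limits, and such products determine a finite measure on paths.

  The second identity is the polar decomposition of \<open>Y\<close>, and together with the first one it yields the
  time change \<open>E[K(Y) a\<^sub>i/a\<^sub>0] = E[K(B\<^sup>iY); Y\<^sub>-\<^sub>i \<noteq> 0]\<close> for functionals \<open>K\<close> of degree 0
  (\<open>spectral_shift\<close>). Summing over \<open>i\<close> turns it into a mass transport principle: if \<open>m(i,j,y)\<close> is the
  mass sent from \<open>i\<close> to \<open>j\<close>, depends on the path in a shift equivariant way, has degree \<open>\<alpha>\<close> and vanishes
  when \<open>y\<^sub>i = 0\<close> or \<open>y\<^sub>j = 0\<close>, then the expected mass sent out by 0 and received by 0, both divided by \<open>a\<^sub>0\<close>, agree (\<open>mass_transport\<close>).

  All claims follow by transporting mass from one family of weights. Let \<open>u\<^sub>i\<close> be the positive part of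
  \<open>a\<^sub>i - sup\<^sub>k\<^sub><\<^sub>i a\<^sub>k\<close>. Because \<open>Y\<close> vanishes at infinity, the records telescope to \<open>\<Sum>\<^sub>i u\<^sub>i = sup\<^sub>k a\<^sub>k = a\<^sup>*\<close>, and by
  the polar decomposition \<open>u\<^sub>0/a\<^sub>0\<close> is the conditional probability, given \<open>\<Theta>\<close>, that \<open>Y\<close> does not exceed 1
  before time 0 (\<open>no_exceedance\<close>). Sending the mass \<open>u\<^sub>i v\<^sub>j/a\<^sup>*\<close> from \<open>i\<close> to \<open>j\<close> gives,
  for every shift equivariant \<open>v\<close> of degree \<open>\<alpha>\<close> with \<open>v\<^sub>j = 0\<close> when \<open>y\<^sub>j = 0\<close>,
  \<open>E[u\<^sub>0/a\<^sub>0 \<Sum>\<^sub>j v\<^sub>j/a\<^sup>*] = E[v\<^sub>0/a\<^sub>0]\<close> (\<open>anchored_transport\<close>). With \<open>S = \<Sum>\<^sub>j |y\<^sub>j|\<close> the choices of \<open>v\<close> are: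

  \<^item> \<open>v\<^sub>j = |y\<^sub>j| S\<^sup>\<alpha>\<^sup>-\<^sup>1\<close>, whose sum is \<open>S\<^sup>\<alpha>\<close>. The left side is \<open>\<theta> E[(\<Sum>|Q\<^sub>j|)\<^sup>\<alpha>]\<close> and the right side is
    \<open>E[(\<Sum>|\<Theta>\<^sub>j|)\<^sup>\<alpha>\<^sup>-\<^sup>1]\<close>.
  \<^item> the records of the reversed path, whose sum is again \<open>a\<^sup>*\<close>. This says that no exceedance before time 0
    has the same probability \<open>\<theta>\<close> as no exceedance after time 0.
  \<^item> \<open>v\<^sub>j = a\<^sub>j\<close>, which shows \<open>\<theta> > 0\<close> and \<open>\<Sum>\<^sub>j a\<^sub>j < \<infinity>\<close> almost surely. For \<open>\<alpha> \<le> 1\<close> the latter makes \<open>S\<close> finite,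
    so that \<open>S S\<^sup>\<alpha>\<^sup>-\<^sup>1 = S\<^sup>\<alpha>\<close> in the first item.
  \<^item> \<open>v\<^sub>j = |y\<^sub>j| (\<Sum>\<^sub>i\<^sub>\<ge>\<^sub>j |y\<^sub>i|)\<^sup>\<alpha>\<^sup>-\<^sup>1\<close> for \<open>\<alpha> > 1\<close>. Here \<open>S\<^sup>\<alpha> \<le> 2\<^sup>\<alpha> \<Sum>\<^sub>j v\<^sub>j\<close>, because some \<open>j\<close> has half of \<open>S\<close> on either
    side, and therefore \<open>\<theta> E[(\<Sum>|Q\<^sub>j|)\<^sup>\<alpha>] \<le> 2\<^sup>\<alpha> E[(\<Sum>\<^sub>j\<^sub>\<ge>\<^sub>0 |\<Theta>\<^sub>j|)\<^sup>\<alpha>\<^sup>-\<^sup>1]\<close>.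

  Since \<open>|\<Theta>\<^sub>0| = 1\<close>, the moments of \<open>\<Theta>\<close> are at most 1 when \<open>\<alpha> \<le> 1\<close>.
\<close>

section \<open>Path space\<close>

abbreviation path_space :: "(int \<Rightarrow> real ^ 'd) measure" where
  "path_space \<equiv> Pi\<^sub>M UNIV (\<lambda>_. borel)"

definition backshift :: "int \<Rightarrow> (int \<Rightarrow> 'a) \<Rightarrow> int \<Rightarrow> 'a" where
  "backshift i y = (\<lambda>j. y (j - i))"

lemma space_path_space [simp]: "space path_space = UNIV"
  by (simp add: space_PiM)

lemma sets_path_Collect:
  assumes "Measurable.pred path_space P"
  shows "{y. P y} \<in> sets path_space"
  using assms by (simp add: pred_def)

lemma measurable_backshift [measurable]:
  "backshift i \<in> measurable path_space path_space"
  unfolding backshift_def by (rule measurable_abs_UNIV) simp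

lemma measurable_scale_path [measurable]:
  "(\<lambda>y j. c *\<^sub>R y j) \<in> measurable path_space path_space"
  by (rule measurable_abs_UNIV) simp

lemma is_norm_continuous:
  fixes nrm :: "real ^ 'd \<Rightarrow> real"
  assumes "is_norm nrm"
  shows "continuous_on UNIV nrm"
proof (rule convex_on_continuous[OF open_UNIV])
  show "convex_on UNIV nrm"
  proof (rule convex_onI)
    fix t :: real and x y :: "real ^ 'd"
    assume "0 < t" "t < 1"
    have "nrm ((1 - t) *\<^sub>R x + t *\<^sub>R y) \<le> nrm ((1 - t) *\<^sub>R x) + nrm (t *\<^sub>R y)"
      using assms unfolding is_norm_def by blast
    also have "\<dots> = (1 - t) * nrm x + t * nrm y"
      using assms \<open>0 < t\<close> \<open>t < 1\<close> by (simp add: is_norm_def)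
    finally show "nrm ((1 - t) *\<^sub>R x + t *\<^sub>R y) \<le> (1 - t) * nrm x + t * nrm y" .
  qed simp
qed

lemma is_norm_measurable:
  fixes nrm :: "real ^ 'd \<Rightarrow> real"
  assumes "is_norm nrm"
  shows "nrm \<in> borel_measurable borel"
  using is_norm_continuous[OF assms] by (rule borel_measurable_continuous_onI)

lemma process_path_measurable:
  assumes "process M X"
  shows "(\<lambda>\<omega> j. X j \<omega>) \<in> measurable M path_space"
  using assms by (intro measurable_abs_UNIV) (simp add: process_def)

section \<open>Regular variation tested on finite windows\<close>

lemma integral_uniform_measure_nonneg:
  fixes g :: "'a \<Rightarrow> real"
  assumes [measurable]: "g \<in> borel_measurable M" "A \<in> sets M"
    and "\<And>x. 0 \<le> g x"
  shows "(\<integral>x. g x \<partial>uniform_measure M A) = (\<integral>x. g x * indicator A x \<partial>M) / measure M A"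
proof -
  have "(\<integral>x. g x \<partial>uniform_measure M A) = enn2real (\<integral>\<^sup>+x. g x \<partial>uniform_measure M A)"
    using assms by (intro integral_eq_nn_integral) auto
  also have "\<dots> = enn2real ((\<integral>\<^sup>+x. g x * indicator A x \<partial>M) / emeasure M A)"
    by (simp add: nn_integral_uniform_measure ennreal_mult' ennreal_indicator assms(3))
  also have "\<dots> = enn2real (\<integral>\<^sup>+x. g x * indicator A x \<partial>M) / measure M A"
  proof (cases "emeasure M A" rule: ennreal_cases)
    case (real r)
    then show ?thesis
      by (cases "r = 0")
         (auto simp: divide_ennreal_def enn2real_mult measure_def inverse_ennreal field_simps
           emeasure_eq_0_AE )
  qed (simp add: divide_ennreal_def measure_def)
  also have "enn2real (\<integral>\<^sup>+x. g x * indicator A x \<partial>M) = (\<integral>x. g x * indicator A x \<partial>M)"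
    using assms by (intro integral_eq_nn_integral[symmetric]) auto
  finally show ?thesis .
qed

text \<open>A test function that vanishes when the coordinate 0 has norm at most 1 only sees paths with
  \<open>|X\<^sub>0| > u\<close>, so conditioning on that event reduces to dividing by its probability. The unconditional
  form is what stationarity of \<open>X\<close> can be applied to.\<close>

lemma window_limit:
  fixes X :: "int \<Rightarrow> 'w \<Rightarrow> real ^ 'd" and Y :: "int \<Rightarrow> 'y \<Rightarrow> real ^ 'd"
  assumes nrm: "is_norm nrm" and X: "process M X" and Y: "tail_process nrm M X \<alpha> MY Y"
    and f: "\<And>j. continuous_on UNIV (f j)" "\<And>j x. 0 \<le> f j x" "\<And>j x. f j x \<le> (1::real)"
    and f0: "\<And>x. nrm x \<le> 1 \<Longrightarrow> f 0 x = 0"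
    and st: "s \<le> 0" "0 \<le> t"
  shows "((\<lambda>u. (\<integral>\<omega>. (\<Prod>j\<in>{s..t}. f j (X j \<omega> /\<^sub>R u)) \<partial>M)
              / measure M {\<omega> \<in> space M. nrm (X 0 \<omega>) > u})
          \<longlongrightarrow> (\<integral>\<omega>. (\<Prod>j\<in>{s..t}. f j (Y j \<omega>)) \<partial>MY)) at_top"
proof -
  define F where "F x = (\<Prod>j\<in>{s..t}. f j (x j))" for x :: "int \<Rightarrow> real ^ 'd"
  have [measurable]: "f j \<in> borel_measurable borel" for j
    using f(1) by (rule borel_measurable_continuous_onI)
  have [measurable]: "nrm \<in> borel_measurable borel" by (rule is_norm_measurable[OF nrm])
  have [measurable]: "X j \<in> borel_measurable M" "Y j \<in> borel_measurable MY" for j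
    using X Y by (auto simp: process_def tail_process_def)
  have Fm [measurable]: "F \<in> borel_measurable (Pi\<^sub>M {s..t} (\<lambda>_. borel))"
    unfolding F_def by measurable
  have Fc: "continuous_map (window_top s t) euclideanreal F"
    unfolding F_def
  proof (rule continuous_map_prod)
    fix j assume j: "j \<in> {s..t}"
    have "continuous_map (window_top s t) euclidean (\<lambda>x. x j)"
      unfolding window_top_def using j by (rule continuous_map_product_coordinates)
    moreover have "continuous_map euclidean euclideanreal (f j)" using f(1) by simp
    ultimately have "continuous_map (window_top s t) euclideanreal (f j \<circ> (\<lambda>x. x j))"
      by (rule continuous_map_compose)
    then show "continuous_map (window_top s t) euclideanreal (\<lambda>x. f j (x j))"
      by (simp only: o_def)
  qed simp
  have Fb: "0 \<le> F x" "F x \<le> 1" for x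
    unfolding F_def using f by (auto intro!: prod_nonneg prod_le_1)
  have bdd: "bounded (F ` topspace (window_top s t))"
    by (rule boundedI[of _ 1]) (use Fb in auto)
  let ?A = "\<lambda>u. {\<omega> \<in> space M. nrm (X 0 \<omega>) > u}"
  have lim: "((\<lambda>u. \<integral>x. F x \<partial>scaled_window_law (uniform_measure M (?A u)) X s t u)
          \<longlongrightarrow> (\<integral>x. F x \<partial>scaled_window_law MY Y s t 1)) at_top"
    using Y Fc bdd st by (auto simp: tail_process_def)
  have R: "(\<integral>x. F x \<partial>scaled_window_law MY Y s t 1) = (\<integral>\<omega>. (\<Prod>j\<in>{s..t}. f j (Y j \<omega>)) \<partial>MY)"
    unfolding scaled_window_law_def
    by (subst integral_distr) (auto simp: F_def intro!: Bochner_Integration.integral_cong prod.cong)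
  have L: "(\<integral>x. F x \<partial>scaled_window_law (uniform_measure M (?A u)) X s t u)
      = (\<integral>\<omega>. (\<Prod>j\<in>{s..t}. f j (X j \<omega> /\<^sub>R u)) \<partial>M) / measure M (?A u)" if u: "u > 0" for u
  proof -
    have "(\<integral>x. F x \<partial>scaled_window_law (uniform_measure M (?A u)) X s t u)
        = (\<integral>\<omega>. F (\<lambda>i\<in>{s..t}. X i \<omega> /\<^sub>R u) \<partial>uniform_measure M (?A u))"
      unfolding scaled_window_law_def by (subst integral_distr) auto
    also have "\<dots> = (\<integral>\<omega>. F (\<lambda>i\<in>{s..t}. X i \<omega> /\<^sub>R u) * indicator (?A u) \<omega> \<partial>M) / measure M (?A u)"
      by (rule integral_uniform_measure_nonneg) (auto simp: Fb)
    also have "(\<integral>\<omega>. F (\<lambda>i\<in>{s..t}. X i \<omega> /\<^sub>R u) * indicator (?A u) \<omega> \<partial>M)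
        = (\<integral>\<omega>. (\<Prod>j\<in>{s..t}. f j (X j \<omega> /\<^sub>R u)) \<partial>M)"
    proof (rule Bochner_Integration.integral_cong[OF refl])
      fix \<omega> assume \<omega>: "\<omega> \<in> space M"
      have eq: "F (\<lambda>i\<in>{s..t}. X i \<omega> /\<^sub>R u) = (\<Prod>j\<in>{s..t}. f j (X j \<omega> /\<^sub>R u))"
        unfolding F_def by (auto intro!: prod.cong)
      show "F (\<lambda>i\<in>{s..t}. X i \<omega> /\<^sub>R u) * indicator (?A u) \<omega> = (\<Prod>j\<in>{s..t}. f j (X j \<omega> /\<^sub>R u))"
      proof (cases "nrm (X 0 \<omega>) > u")
        case True
        then show ?thesis using \<omega> eq by simp
      next
        case False
        then have "nrm (X 0 \<omega> /\<^sub>R u) \<le> 1"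
          using nrm u by (simp add: is_norm_def field_simps)
        then have "f 0 (X 0 \<omega> /\<^sub>R u) = 0" by (rule f0)
        then have "(\<Prod>j\<in>{s..t}. f j (X j \<omega> /\<^sub>R u)) = 0"
          using st by (intro prod_zero) auto
        then show ?thesis using eq by simp
      qed
    qed
    finally show ?thesis .
  qed
  show ?thesis
    using lim unfolding R
    by (rule Lim_transform_eventually) (auto intro!: eventually_mono[OF eventually_gt_at_top[of 0]] simp: L)
qed

lemma stationary_integral:
  fixes X :: "int \<Rightarrow> 'w \<Rightarrow> real ^ 'd" and G :: "(int \<Rightarrow> real ^ 'd) \<Rightarrow> real"
  assumes X: "stationary_process M X" and [measurable]: "G \<in> borel_measurable path_space"
  shows "(\<integral>\<omega>. G (\<lambda>j. X (j + h) \<omega>) \<partial>M) = (\<integral>\<omega>. G (\<lambda>j. X j \<omega>) \<partial>M)"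
proof -
  have P: "process M X" and eq: "path_law M (\<lambda>j. X (j + h)) = path_law M X"
    using X by (auto simp: stationary_process_def)
  have "process M (\<lambda>j. X (j + h))" using P by (simp add: process_def)
  then have "(\<integral>\<omega>. G (\<lambda>j. X (j + h) \<omega>) \<partial>M) = (\<integral>y. G y \<partial>path_law M (\<lambda>j. X (j + h)))"
    unfolding path_law_def
    by (subst integral_distr[OF process_path_measurable]) auto
  also have "\<dots> = (\<integral>\<omega>. G (\<lambda>j. X j \<omega>) \<partial>M)"
    unfolding eq unfolding path_law_def
    by (subst integral_distr[OF process_path_measurable[OF P]]) auto
  finally show ?thesis .
qed

text \<open>Both sides are limits of the same ratio: stationarity moves the window of \<open>X\<close> by \<open>i\<close>, and in either
  position the factor at time 0, which is \<open>f 0\<close> or \<open>f i\<close>, forces \<open>|X\<^sub>0| > u\<close>.\<close>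

lemma tail_process_shift_test:
  fixes X :: "int \<Rightarrow> 'w \<Rightarrow> real ^ 'd" and Y :: "int \<Rightarrow> 'y \<Rightarrow> real ^ 'd"
  assumes nrm: "is_norm nrm" and X: "stationary_process M X" and Y: "tail_process nrm M X \<alpha> MY Y"
    and f: "\<And>j. continuous_on UNIV (f j)" "\<And>j x. 0 \<le> f j x" "\<And>j x. f j x \<le> (1::real)"
    and f0: "\<And>x. nrm x \<le> 1 \<Longrightarrow> f 0 x = 0" and fi: "\<And>x. nrm x \<le> 1 \<Longrightarrow> f i x = 0"
    and st: "s \<le> 0" "0 \<le> t" "s \<le> i" "i \<le> t"
  shows "(\<integral>\<omega>. (\<Prod>j\<in>{s..t}. f j (Y j \<omega>)) \<partial>MY) = (\<integral>\<omega>. (\<Prod>j\<in>{s..t}. f j (Y (j - i) \<omega>)) \<partial>MY)"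
proof -
  have P: "process M X" using X by (simp add: stationary_process_def)
  have [measurable]: "f j \<in> borel_measurable borel" for j
    using f(1) by (rule borel_measurable_continuous_onI)
  have re: "(\<Prod>j\<in>{s..t}. f j (Z (j - i))) = (\<Prod>k\<in>{s-i..t-i}. f (k + i) (Z k))" for Z
    by (rule prod.reindex_bij_witness[of _ "\<lambda>k. k + i" "\<lambda>j. j - i"]) auto
  have stat: "(\<integral>\<omega>. (\<Prod>j\<in>{s..t}. f j (X j \<omega> /\<^sub>R u)) \<partial>M)
      = (\<integral>\<omega>. (\<Prod>k\<in>{s-i..t-i}. f (k + i) (X k \<omega> /\<^sub>R u)) \<partial>M)" for u
    using stationary_integral[OF X, of "\<lambda>y. \<Prod>j\<in>{s..t}. f j (y j /\<^sub>R u)" "- i"]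
    by (simp add: re[of "\<lambda>j. X j _ /\<^sub>R u"])
  have A: "((\<lambda>u. (\<integral>\<omega>. (\<Prod>j\<in>{s..t}. f j (X j \<omega> /\<^sub>R u)) \<partial>M)
              / measure M {\<omega> \<in> space M. nrm (X 0 \<omega>) > u})
          \<longlongrightarrow> (\<integral>\<omega>. (\<Prod>j\<in>{s..t}. f j (Y j \<omega>)) \<partial>MY)) at_top"
    by (rule window_limit[OF nrm P Y, of f]) (use f f0 st in auto)
  have "((\<lambda>u. (\<integral>\<omega>. (\<Prod>k\<in>{s-i..t-i}. f (k + i) (X k \<omega> /\<^sub>R u)) \<partial>M)
              / measure M {\<omega> \<in> space M. nrm (X 0 \<omega>) > u})
          \<longlongrightarrow> (\<integral>\<omega>. (\<Prod>k\<in>{s-i..t-i}. f (k + i) (Y k \<omega>)) \<partial>MY)) at_top"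
    by (rule window_limit[OF nrm P Y, of "\<lambda>k. f (k + i)"]) (use f fi st in auto)
  with A show ?thesis
    unfolding stat re[of "\<lambda>j. Y j _"] by (rule tendsto_unique[OF trivial_limit_at_top_linorder])
qed

text \<open>For a test function that needs \<open>|X\<^sub>0| > ru\<close>, dividing by \<open>P(|X\<^sub>0| > u)\<close> or by \<open>P(|X\<^sub>0| > ru)\<close> gives the two
  integrals. The constant is the limit of the ratio of these probabilities; it is identified later
  from the Pareto tail of \<open>|Y\<^sub>0|\<close>.\<close>

lemma tail_process_scale_test:
  fixes X :: "int \<Rightarrow> 'w \<Rightarrow> real ^ 'd" and Y :: "int \<Rightarrow> 'y \<Rightarrow> real ^ 'd"
  assumes nrm: "is_norm nrm" and P: "process M X" and Y: "tail_process nrm M X \<alpha> MY Y"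
    and r: "1 \<le> r"
  shows "\<exists>c. \<forall>f s t. (\<forall>j. continuous_on UNIV (f j)) \<and> (\<forall>j x. 0 \<le> f j x \<and> f j x \<le> (1::real)) \<and>
      (\<forall>x. nrm x \<le> r \<longrightarrow> f 0 x = 0) \<and> s \<le> 0 \<and> 0 \<le> t \<longrightarrow>
      (\<integral>\<omega>. (\<Prod>j\<in>{s..t}. f j (Y j \<omega>)) \<partial>MY) = c * (\<integral>\<omega>. (\<Prod>j\<in>{s..t}. f j (r *\<^sub>R Y j \<omega>)) \<partial>MY)"
proof -
  define \<Phi> where "\<Phi> f s t u = (\<integral>\<omega>. (\<Prod>j\<in>{s..t}. f j (X j \<omega> /\<^sub>R u)) \<partial>M)"
    for f :: "int \<Rightarrow> real ^ 'd \<Rightarrow> real" and s t u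
  define l where "l f s t = (\<integral>\<omega>. (\<Prod>j\<in>{s..t}. f j (Y j \<omega>)) \<partial>MY)"
    for f :: "int \<Rightarrow> real ^ 'd \<Rightarrow> real" and s t
  define m where "m f s t = (\<integral>\<omega>. (\<Prod>j\<in>{s..t}. f j (r *\<^sub>R Y j \<omega>)) \<partial>MY)"
    for f :: "int \<Rightarrow> real ^ 'd \<Rightarrow> real" and s t
  define p where "p u = measure M {\<omega> \<in> space M. nrm (X 0 \<omega>) > u}" for u
  define ok where "ok f \<longleftrightarrow> (\<forall>j. continuous_on UNIV (f j)) \<and> (\<forall>j x. 0 \<le> f j x) \<and>
      (\<forall>j x. f j x \<le> 1) \<and> (\<forall>x. nrm x \<le> r \<longrightarrow> f 0 x = 0)" for f :: "int \<Rightarrow> real ^ 'd \<Rightarrow> real"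
  have lim1: "((\<lambda>u. \<Phi> f s t u / p u) \<longlongrightarrow> l f s t) at_top" if "ok f" "s \<le> 0" "0 \<le> t" for f s t
    unfolding \<Phi>_def l_def p_def
    by (rule window_limit[OF nrm P Y]) (use that r in \<open>auto simp: ok_def\<close>)
  have lim2: "((\<lambda>u. \<Phi> f s t u / p (r * u)) \<longlongrightarrow> m f s t) at_top" if f: "ok f" "s \<le> 0" "0 \<le> t" for f s t
  proof -
    have "((\<lambda>u. \<Phi> (\<lambda>j x. f j (r *\<^sub>R x)) s t u / p u) \<longlongrightarrow> m f s t) at_top"
      unfolding \<Phi>_def m_def p_def
    proof (rule window_limit[OF nrm P Y])
      show "continuous_on UNIV (\<lambda>x. f j (r *\<^sub>R x))" for j
      proof -
        have "continuous_on UNIV (f j)" using f by (simp add: ok_def)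
        moreover have "continuous_on UNIV (\<lambda>x :: real ^ 'd. r *\<^sub>R x)" by (intro continuous_intros)
        ultimately show ?thesis by (rule continuous_on_compose2) simp
      qed
      show "f 0 (r *\<^sub>R x) = 0" if "nrm x \<le> 1" for x
      proof -
        have "nrm (r *\<^sub>R x) \<le> r" using that nrm r by (simp add: is_norm_def)
        then show ?thesis using f by (simp add: ok_def)
      qed
    qed (use f in \<open>auto simp: ok_def\<close>)
    moreover have "filterlim (\<lambda>u. r * u) at_top at_top"
      using r by (intro filterlim_tendsto_pos_mult_at_top[OF tendsto_const]) (auto simp: filterlim_ident)
    ultimately have "((\<lambda>u. \<Phi> (\<lambda>j x. f j (r *\<^sub>R x)) s t (r * u) / p (r * u)) \<longlongrightarrow> m f s t) at_top"
      by (rule filterlim_compose)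
    moreover have "\<Phi> (\<lambda>j x. f j (r *\<^sub>R x)) s t (r * u) = \<Phi> f s t u" for u
      unfolding \<Phi>_def using r
      by (intro Bochner_Integration.integral_cong prod.cong refl arg_cong[where f = "f _"]) auto
    ultimately show ?thesis by simp
  qed
  \<comment> \<open>The two denominators \<open>p u\<close> and \<open>p (r * u)\<close> are exchanged between the factors, so the limit of
    their ratio does not have to be computed.\<close>
  have cross: "l f s t * m g s' t' = m f s t * l g s' t'"
    if "ok f" "s \<le> 0" "0 \<le> t" "ok g" "s' \<le> 0" "0 \<le> t'" for f g s t s' t'
  proof -
    have A: "((\<lambda>u. (\<Phi> f s t u / p u) * (\<Phi> g s' t' u / p (r * u))) \<longlongrightarrow> l f s t * m g s' t') at_top"
      by (intro tendsto_mult lim1 lim2 that)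
    have B: "((\<lambda>u. (\<Phi> f s t u / p (r * u)) * (\<Phi> g s' t' u / p u)) \<longlongrightarrow> m f s t * l g s' t') at_top"
      by (intro tendsto_mult lim1 lim2 that)
    have eq: "(\<Phi> f s t u / p u) * (\<Phi> g s' t' u / p (r * u)) = (\<Phi> f s t u / p (r * u)) * (\<Phi> g s' t' u / p u)" for u
      by simp
    show ?thesis
      by (rule tendsto_unique[OF trivial_limit_at_top_linorder A[unfolded eq] B])
  qed
  \<comment> \<open>A reference test function with a positive integral, which determines the constant.\<close>
  define g where "g = (\<lambda>j::int. \<lambda>x. min 1 (max 0 (nrm x - r)))"
  have okg: "ok g"
    using is_norm_continuous[OF nrm] unfolding ok_def g_def by (auto intro!: continuous_intros)
  have mg: "m g 0 0 > 0"
  proof -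
    have prob: "prob_space MY" and [measurable]: "Y j \<in> borel_measurable MY" for j
      using Y by (auto simp: tail_process_def process_def)
    interpret MY: prob_space MY by (rule prob)
    have [measurable]: "nrm \<in> borel_measurable borel" by (rule is_norm_measurable[OF nrm])
    have "measure MY {\<omega> \<in> space MY. nrm (Y 0 \<omega>) > 1} = 1"
    proof -
      have "\<forall>y\<ge>1. measure MY {\<omega> \<in> space MY. nrm (Y 0 \<omega>) > y} = y powr (- \<alpha>)"
        using Y unfolding tail_process_def by blast
      then show ?thesis by fastforce
    qed
    then have ae: "AE \<omega> in MY. nrm (Y 0 \<omega>) > 1"
      by (subst (asm) MY.prob_Collect_eq_1) auto
    have pos: "AE \<omega> in MY. 0 < g 0 (r *\<^sub>R Y 0 \<omega>)"
      using ae by eventually_elim (use nrm r in \<open>auto simp: g_def is_norm_def\<close>)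
    have int: "integrable MY (\<lambda>\<omega>. g 0 (r *\<^sub>R Y 0 \<omega>))"
      by (rule MY.integrable_const_bound[of _ 1]) (auto simp: g_def)
    have nn: "0 \<le> g 0 (r *\<^sub>R Y 0 \<omega>)" for \<omega> by (auto simp: g_def)
    have "m g 0 0 \<noteq> 0"
    proof
      assume "m g 0 0 = 0"
      then have "AE \<omega> in MY. g 0 (r *\<^sub>R Y 0 \<omega>) = 0"
        using int nn by (simp add: m_def integral_nonneg_eq_0_iff_AE)
      with pos have "AE \<omega> in MY. False" by eventually_elim auto
      then show False by simp
    qed
    moreover have "0 \<le> m g 0 0" using nn by (simp add: m_def)
    ultimately show ?thesis by simp
  qed
  show ?thesis
  proof (intro exI[of _ "l g 0 0 / m g 0 0"] allI impI)
    fix f :: "int \<Rightarrow> real ^ 'd \<Rightarrow> real" and s t :: int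
    assume A: "(\<forall>j. continuous_on UNIV (f j)) \<and> (\<forall>j x. 0 \<le> f j x \<and> f j x \<le> 1) \<and>
      (\<forall>x. nrm x \<le> r \<longrightarrow> f 0 x = 0) \<and> s \<le> 0 \<and> 0 \<le> t"
    then have "ok f" by (auto simp: ok_def)
    then have "l f s t * m g 0 0 = m f s t * l g 0 0" using A okg by (intro cross) auto
    then show "(\<integral>\<omega>. (\<Prod>j\<in>{s..t}. f j (Y j \<omega>)) \<partial>MY)
        = l g 0 0 / m g 0 0 * (\<integral>\<omega>. (\<Prod>j\<in>{s..t}. f j (r *\<^sub>R Y j \<omega>)) \<partial>MY)"
      using mg by (simp add: l_def[of f] m_def[of f] field_simps)
  qed
qed

section \<open>From test functions to measurable functionals\<close>

lemma open_indicator_approximation: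
  fixes U :: "'v::metric_space set"
  assumes "open U"
  obtains f :: "nat \<Rightarrow> 'v \<Rightarrow> real" where
    "\<And>n. continuous_on UNIV (f n)" "\<And>n x. 0 \<le> f n x" "\<And>n x. f n x \<le> 1"
    "\<And>n x. x \<notin> U \<Longrightarrow> f n x = 0" "\<And>x. (\<lambda>n. f n x) \<longlonglongrightarrow> indicator U x"
proof (cases "U = UNIV")
  case True
  then show thesis by (intro that[of "\<lambda>_ _. 1"]) auto
next
  case False
  define f where "f n x = min 1 (real n * infdist x (- U))" for n :: nat and x
  show thesis
  proof (rule that[of f])
    show "continuous_on UNIV (f n)" for n
      unfolding f_def by (intro continuous_intros)
    show z: "f n x = 0" if "x \<notin> U" for n x
      using that by (simp add: f_def)
    show "(\<lambda>n. f n x) \<longlonglongrightarrow> indicator U x" for x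
    proof (cases "x \<in> U")
      case True
      then have pos: "infdist x (- U) > 0"
        using False assms by (intro infdist_pos_not_in_closed) auto
      obtain k where k: "1 / infdist x (- U) < real k" using reals_Archimedean2 by blast
      have "f n x = 1" if "k \<le> n" for n
      proof -
        have "1 \<le> real k * infdist x (- U)" using k pos by (simp add: field_simps)
        also have "\<dots> \<le> real n * infdist x (- U)" using that pos by simp
        finally show ?thesis by (simp add: f_def)
      qed
      then have "eventually (\<lambda>n. f n x = indicator U x) sequentially"
        using True by (auto simp: eventually_sequentially)
      then show ?thesis by (rule tendsto_eventually)
    qed (simp add: z)
  qed (auto simp: f_def infdist_nonneg)
qed

lemma open_boxes_approximation:
  fixes V :: "'i \<Rightarrow> 'v::metric_space set"
  assumes "\<And>j. open (V j)"
  obtains f :: "'i \<Rightarrow> nat \<Rightarrow> 'v \<Rightarrow> real" where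
    "\<And>j n. continuous_on UNIV (f j n)" "\<And>j n x. 0 \<le> f j n x" "\<And>j n x. f j n x \<le> 1"
    "\<And>j n x. x \<notin> V j \<Longrightarrow> f j n x = 0" "\<And>j x. (\<lambda>n. f j n x) \<longlonglongrightarrow> indicator (V j) x"
proof -
  have "\<forall>j. \<exists>f. (\<forall>n. continuous_on UNIV (f n)) \<and> (\<forall>n x. 0 \<le> f n x) \<and> (\<forall>n x. f n x \<le> (1::real)) \<and>
      (\<forall>n x. x \<notin> V j \<longrightarrow> f n x = 0) \<and> (\<forall>x. (\<lambda>n. f n x) \<longlonglongrightarrow> indicator (V j) x)"
    using open_indicator_approximation[OF assms] by metis
  then obtain f where "\<forall>j. (\<forall>n. continuous_on UNIV (f j n)) \<and> (\<forall>n x. 0 \<le> f j n x) \<and>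
      (\<forall>n x. f j n x \<le> (1::real)) \<and> (\<forall>n x. x \<notin> V j \<longrightarrow> f j n x = 0) \<and>
      (\<forall>x. (\<lambda>n. f j n x) \<longlonglongrightarrow> indicator (V j) x)"
    using choice[of "\<lambda>j f. (\<forall>n. continuous_on UNIV (f n)) \<and> (\<forall>n x. 0 \<le> f n x) \<and> (\<forall>n x. f n x \<le> (1::real)) \<and>
      (\<forall>n x. x \<notin> V j \<longrightarrow> f n x = 0) \<and> (\<forall>x. (\<lambda>n. f n x) \<longlonglongrightarrow> indicator (V j) x)"] by blast
  then show thesis by (intro that[of f]) blast+
qed

text \<open>Passing from continuous test functions to products of open sets, by dominated convergence.\<close>

lemma box_probability_limit:
  fixes Z :: "int \<Rightarrow> 'w \<Rightarrow> real ^ 'd" and f :: "nat \<Rightarrow> int \<Rightarrow> real ^ 'd \<Rightarrow> real"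
  assumes Z: "process N Z" and J: "finite J" and U: "\<And>j. open (U j)"
    and f: "\<And>n j. continuous_on UNIV (f n j)" "\<And>n j x. 0 \<le> f n j x" "\<And>n j x. f n j x \<le> 1"
      "\<And>j x. (\<lambda>n. f n j x) \<longlonglongrightarrow> indicator (U j) x"
  shows "(\<lambda>n. \<integral>\<omega>. (\<Prod>j\<in>J. f n j (Z j \<omega>)) \<partial>N) \<longlonglongrightarrow> measure N {\<omega> \<in> space N. \<forall>j\<in>J. Z j \<omega> \<in> U j}"
proof -
  interpret N: prob_space N using Z by (simp add: process_def)
  have [measurable]: "Z j \<in> borel_measurable N" for j using Z by (simp add: process_def)
  have [measurable]: "f n j \<in> borel_measurable borel" for n j
    using f(1) by (rule borel_measurable_continuous_onI)
  have [measurable]: "U j \<in> sets borel" for j using U by simp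
  have [measurable]: "{\<omega> \<in> space N. \<forall>j\<in>J. Z j \<omega> \<in> U j} \<in> sets N"
    using J by (intro sets.sets_Collect_finite_All) auto
  have "(\<lambda>n. \<integral>\<omega>. (\<Prod>j\<in>J. f n j (Z j \<omega>)) \<partial>N) \<longlonglongrightarrow> (\<integral>\<omega>. (\<Prod>j\<in>J. indicator (U j) (Z j \<omega>)) \<partial>N)"
  proof (rule integral_dominated_convergence[where w = "\<lambda>_. 1"])
    show "AE \<omega> in N. (\<lambda>n. \<Prod>j\<in>J. f n j (Z j \<omega>)) \<longlonglongrightarrow> (\<Prod>j\<in>J. indicator (U j) (Z j \<omega>))"
      by (intro AE_I2 tendsto_prod f)
    show "AE \<omega> in N. norm (\<Prod>j\<in>J. f n j (Z j \<omega>)) \<le> 1" for n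
      using f by (intro AE_I2) (auto simp: abs_prod abs_of_nonneg intro!: prod_le_1)
  qed (use U in measurable)
  also have "(\<integral>\<omega>. (\<Prod>j\<in>J. indicator (U j) (Z j \<omega>) :: real) \<partial>N)
      = (\<integral>\<omega>. indicator {\<omega> \<in> space N. \<forall>j\<in>J. Z j \<omega> \<in> U j} \<omega> \<partial>N)"
  proof (rule Bochner_Integration.integral_cong[OF refl])
    fix \<omega> assume \<omega>: "\<omega> \<in> space N"
    show "(\<Prod>j\<in>J. indicator (U j) (Z j \<omega>)) = (indicator {\<omega> \<in> space N. \<forall>j\<in>J. Z j \<omega> \<in> U j} \<omega> :: real)"
    proof (cases "\<forall>j\<in>J. Z j \<omega> \<in> U j")
      case False
      then obtain k where "k \<in> J" "indicator (U k) (Z k \<omega>) = (0 :: real)" by auto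
      with J have "(\<Prod>j\<in>J. indicator (U j) (Z j \<omega>)) = (0 :: real)" by (intro prod_zero) auto
      with False show ?thesis by simp
    qed (simp add: \<omega>)
  qed
  also have "\<dots> = measure N {\<omega> \<in> space N. \<forall>j\<in>J. Z j \<omega> \<in> U j}"
    by (simp add: Int_absorb2)
  finally show ?thesis .
qed

lemma box_measurable:
  assumes "finite J" "\<And>j. open (U j)"
  shows "{y. \<forall>j\<in>J. y j \<in> U j} \<in> sets path_space"
proof (rule sets_path_Collect)
  have [measurable]: "U j \<in> sets borel" for j using assms by simp
  show "Measurable.pred path_space (\<lambda>y. \<forall>j\<in>J. y j \<in> U j)"
    using assms(1) by measurable
qed

text \<open>The open boxes over finitely many coordinates are stable under intersection and generate the
  product sigma algebra.\<close>

lemma path_measure_eqI: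
  fixes N1 N2 :: "(int \<Rightarrow> real ^ 'd) measure"
  assumes N: "sets N1 = sets path_space" "sets N2 = sets path_space" and fin: "finite_measure N1"
    and eq: "\<And>J U. finite J \<Longrightarrow> (\<And>j. open (U j)) \<Longrightarrow>
      emeasure N1 {y. \<forall>j\<in>J. y j \<in> U j} = emeasure N2 {y. \<forall>j\<in>J. y j \<in> U j}"
  shows "N1 = N2"
proof -
  define E :: "(int \<Rightarrow> real ^ 'd) set set" where
    "E = {{y. \<forall>j\<in>J. y j \<in> U j} |J U. finite J \<and> (\<forall>j. open (U j))}"
  have E: "{y. \<forall>j\<in>J. y j \<in> U j} \<in> E" if "finite J" "\<And>j. open (U j)" for J U
    using that by (auto simp: E_def)
  have gen: "sets (path_space :: (int \<Rightarrow> real ^ 'd) measure) = sigma_sets UNIV E"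
  proof
    \<comment> \<open>It suffices that the coordinates are measurable for the sigma algebra generated by the boxes.\<close>
    have "(\<lambda>y. y j) \<in> measurable (sigma UNIV E) borel" for j
    proof (rule borel_measurableI)
      fix S :: "(real ^ 'd) set" assume "open S"
      then have "{y. y j \<in> S} \<in> E" using E[of "{j}" "\<lambda>_. S"] by simp
      then show "(\<lambda>y. y j) -` S \<inter> space (sigma UNIV E) \<in> sets (sigma UNIV E)"
        by (auto simp: vimage_def)
    qed
    then have "(\<lambda>y j. y j) \<in> measurable (sigma UNIV E) path_space"
      by (rule measurable_abs_UNIV)
    from measurable_sets[OF this] show "sets path_space \<subseteq> sigma_sets UNIV E"
      by (auto simp: vimage_def)
    have "E \<subseteq> sets path_space"
      using box_measurable by (auto simp: E_def)
    then show "sigma_sets UNIV E \<subseteq> sets path_space"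
      using sets.sigma_sets_subset[of E path_space] by simp
  qed
  show ?thesis
  proof (rule measure_eqI_generator_eq[of E UNIV N1 N2 "\<lambda>_. UNIV"])
    show "Int_stable E"
    proof (rule Int_stableI)
      fix a b assume "a \<in> E" "b \<in> E"
      then obtain J U K V where *: "a = {y. \<forall>j\<in>J. y j \<in> U j}" "b = {y. \<forall>j\<in>K. y j \<in> V j}"
        "finite J" "finite K" "\<And>j. open (U j)" "\<And>j. open (V j)" unfolding E_def by blast
      define W where "W j = (if j \<in> J then U j else UNIV) \<inter> (if j \<in> K then V j else UNIV)" for j
      have "a \<inter> b = {y. \<forall>j\<in>J \<union> K. y j \<in> W j}" unfolding *(1,2) W_def by auto
      moreover have "\<dots> \<in> E" using * by (intro E) (auto simp: W_def)
      ultimately show "a \<inter> b \<in> E" by simp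
    qed
    show "range (\<lambda>_::nat. UNIV) \<subseteq> E" using E[of "{}"] by auto
    show "emeasure N1 UNIV \<noteq> \<infinity>" using finite_measure.emeasure_finite[OF fin] by simp
    show "emeasure N1 A = emeasure N2 A" if "A \<in> E" for A
      using that eq unfolding E_def by blast
  qed (auto simp: N gen)
qed

lemma sets_path_law [measurable_cong, simp]:
  "sets (path_law M X) = sets path_space"
  by (simp add: path_law_def)

lemma space_path_law [simp]: "space (path_law M X) = UNIV"
  by (simp add: path_law_def)

lemma nn_integral_path_law:
  assumes "process M X" "H \<in> borel_measurable path_space"
  shows "(\<integral>\<^sup>+y. H y \<partial>path_law M X) = (\<integral>\<^sup>+\<omega>. H (\<lambda>j. X j \<omega>) \<partial>M)"
  unfolding path_law_def using assms by (intro nn_integral_distr process_path_measurable) auto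

lemma prob_space_path_law:
  assumes "process M X"
  shows "prob_space (path_law M X)"
  unfolding path_law_def using assms
  by (intro prob_space.prob_space_distr process_path_measurable) (simp_all add: process_def)

lemma emeasure_path_law:
  assumes "process M X" "{y. P y} \<in> sets path_space"
  shows "emeasure (path_law M X) {y. P y} = ennreal (measure M {\<omega> \<in> space M. P (\<lambda>j. X j \<omega>)})"
proof -
  interpret prob_space M using assms by (simp add: process_def)
  have "(\<lambda>\<omega> j. X j \<omega>) -` {y. P y} \<inter> space M = {\<omega> \<in> space M. P (\<lambda>j. X j \<omega>)}" by auto
  then show ?thesis
    unfolding path_law_def using assms
    by (subst emeasure_distr[OF process_path_measurable]) (simp_all add: emeasure_eq_measure)
qed

lemma tail_process_process: "tail_process nrm M X \<alpha> MY Y \<Longrightarrow> process MY Y"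
  by (simp add: tail_process_def)

lemma tail_process_pareto:
  assumes "tail_process nrm M X \<alpha> MY Y" "1 \<le> y"
  shows "measure MY {\<omega> \<in> space MY. nrm (Y 0 \<omega>) > y} = y powr (- \<alpha>)"
  using assms unfolding tail_process_def by blast

lemma tail_process_exceeds:
  assumes nrm: "is_norm nrm" and Y: "tail_process nrm M X \<alpha> MY Y"
  shows "AE \<omega> in MY. nrm (Y 0 \<omega>) > 1"
proof -
  interpret prob_space MY using tail_process_process[OF Y] by (simp add: process_def)
  have [measurable]: "nrm \<in> borel_measurable borel" "Y 0 \<in> borel_measurable MY"
    using is_norm_measurable[OF nrm] tail_process_process[OF Y] by (auto simp: process_def)
  show ?thesis
    using tail_process_pareto[OF Y, of 1] by (simp add: prob_Collect_eq_1)
qed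

text \<open>Intersecting the boxes at the coordinates 0 and \<open>i\<close> with the open set of vectors of norm greater
  than 1 makes them admissible for the limits above.\<close>

lemma tail_law_shift_measure:
  fixes X :: "int \<Rightarrow> 'w \<Rightarrow> real ^ 'd" and Y :: "int \<Rightarrow> 'y \<Rightarrow> real ^ 'd"
  assumes nrm: "is_norm nrm" and X: "stationary_process M X" and Y: "tail_process nrm M X \<alpha> MY Y"
  defines "L \<equiv> path_law MY Y"
  shows "density L (indicator {y. nrm (y 0) > 1 \<and> nrm (y i) > 1})
    = distr (density L (indicator {y. nrm (y (- i)) > 1 \<and> nrm (y 0) > 1})) path_space (backshift i)"
    (is "?N1 = ?N2")
proof -
  have PY: "process MY Y" by (rule tail_process_process[OF Y])
  interpret MY: prob_space MY using PY by (simp add: process_def)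
  interpret L: prob_space L unfolding L_def by (rule prob_space_path_law[OF PY])
  have sL [measurable_cong]: "sets L = sets path_space" by (simp add: L_def)
  have spL [simp]: "space L = UNIV" by (simp add: L_def)
  have [measurable]: "nrm \<in> borel_measurable borel" by (rule is_norm_measurable[OF nrm])
  have [measurable]: "Y j \<in> borel_measurable MY" for j using PY by (simp add: process_def)
  have m: "{y. nrm (y j) > 1 \<and> nrm (y k) > 1} \<in> sets L" for j k
    unfolding sL by (rule sets_path_Collect) measurable
  have oU: "open {x. nrm x > 1}"
    using is_norm_continuous[OF nrm] by (intro open_Collect_less) auto
  show ?thesis
  proof (rule path_measure_eqI)
    show "finite_measure ?N1"
      by (rule L.finite_measure_restricted) (rule m)
    fix J :: "int set" and U :: "int \<Rightarrow> (real ^ 'd) set" assume J: "finite J" and U: "\<And>j. open (U j)"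
    define V where "V j = (if j \<in> J then U j else UNIV) \<inter> (if j = 0 \<or> j = i then {x. nrm x > 1} else UNIV)" for j :: int
    have V: "open (V j)" for j using U oU by (auto simp: V_def)
    define K where "K = insert 0 (insert i J)"
    define s t where "s = Min K" and "t = Max K"
    have K: "finite K" "0 \<in> K" "i \<in> K" "J \<subseteq> K" using J by (auto simp: K_def)
    have st: "s \<le> 0" "0 \<le> t" "s \<le> i" "i \<le> t" "K \<subseteq> {s..t}"
      using K by (auto simp: s_def t_def)
    from open_boxes_approximation[of V, OF V] obtain f :: "int \<Rightarrow> nat \<Rightarrow> real ^ 'd \<Rightarrow> real" where f:
      "\<And>j n. continuous_on UNIV (f j n)" "\<And>j n x. 0 \<le> f j n x" "\<And>j n x. f j n x \<le> 1"
      "\<And>j n x. x \<notin> V j \<Longrightarrow> f j n x = 0" "\<And>j x. (\<lambda>n. f j n x) \<longlonglongrightarrow> indicator (V j) x"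
      by blast
    have A: "(\<lambda>n. \<integral>\<omega>. (\<Prod>j\<in>{s..t}. f j n (Y j \<omega>)) \<partial>MY)
        \<longlonglongrightarrow> measure MY {\<omega> \<in> space MY. \<forall>j\<in>{s..t}. Y j \<omega> \<in> V j}"
      by (rule box_probability_limit[OF PY _ V]) (auto intro: f)
    have PB: "process MY (\<lambda>j. Y (j - i))" using PY by (simp add: process_def)
    have B: "(\<lambda>n. \<integral>\<omega>. (\<Prod>j\<in>{s..t}. f j n (Y (j - i) \<omega>)) \<partial>MY)
        \<longlonglongrightarrow> measure MY {\<omega> \<in> space MY. \<forall>j\<in>{s..t}. Y (j - i) \<omega> \<in> V j}"
      by (rule box_probability_limit[OF PB _ V]) (auto intro: f)
    have "(\<integral>\<omega>. (\<Prod>j\<in>{s..t}. f j n (Y j \<omega>)) \<partial>MY) = (\<integral>\<omega>. (\<Prod>j\<in>{s..t}. f j n (Y (j - i) \<omega>)) \<partial>MY)" for n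
    proof (rule tail_process_shift_test[OF nrm X Y, of "\<lambda>j. f j n"])
      show "f 0 n x = 0" "f i n x = 0" if "nrm x \<le> 1" for x
        using that by (auto intro!: f simp: V_def)
    qed (use f st in auto)
    with A B have main: "measure MY {\<omega> \<in> space MY. \<forall>j\<in>{s..t}. Y j \<omega> \<in> V j}
        = measure MY {\<omega> \<in> space MY. \<forall>j\<in>{s..t}. Y (j - i) \<omega> \<in> V j}"
      by (auto intro: LIMSEQ_unique)
    have win: "(\<forall>j\<in>{s..t}. z j \<in> V j) \<longleftrightarrow> (\<forall>j\<in>J. z j \<in> U j) \<and> nrm (z 0) > 1 \<and> nrm (z i) > 1" for z
    proof -
      have "(\<forall>j\<in>{s..t}. z j \<in> V j)
          \<longleftrightarrow> (\<forall>j\<in>{s..t}. (j \<in> J \<longrightarrow> z j \<in> U j) \<and> (j = 0 \<or> j = i \<longrightarrow> nrm (z j) > 1))"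
        by (intro ball_cong) (auto simp: V_def)
      also have "\<dots> \<longleftrightarrow> (\<forall>j\<in>J. z j \<in> U j) \<and> nrm (z 0) > 1 \<and> nrm (z i) > 1"
        using K st(5) by blast
      finally show ?thesis .
    qed
    have bm: "{y. \<forall>j\<in>J. y j \<in> U j} \<in> sets path_space" by (rule box_measurable[OF J U])
    note em = emeasure_path_law[OF PY, folded L_def]
    have m1: "{y. (\<forall>j\<in>J. y j \<in> U j) \<and> nrm (y 0) > 1 \<and> nrm (y i) > 1} \<in> sets path_space"
      using sets.Int[OF bm m[of 0 i, unfolded sL]] by (simp add: Int_def)
    have "emeasure ?N1 {y. \<forall>j\<in>J. y j \<in> U j}
        = emeasure L {y. (\<forall>j\<in>J. y j \<in> U j) \<and> nrm (y 0) > 1 \<and> nrm (y i) > 1}"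
      using bm m[of 0 i] by (simp add: emeasure_density_const emeasure_restricted sL Int_def conj_commute)
    also have "\<dots> = measure MY {\<omega> \<in> space MY. \<forall>j\<in>{s..t}. Y j \<omega> \<in> V j}"
      using em[OF m1] by (simp only: win)
    finally have 1: "emeasure ?N1 {y. \<forall>j\<in>J. y j \<in> U j} = \<dots>" .
    have bs: "{y. \<forall>j\<in>J. y (j - i) \<in> U j} \<in> sets path_space"
      using measurable_sets[OF measurable_backshift[of i] bm] by (simp add: vimage_def backshift_def)
    have m2: "{y. (\<forall>j\<in>J. y (j - i) \<in> U j) \<and> nrm (y (- i)) > 1 \<and> nrm (y 0) > 1} \<in> sets path_space"
      using sets.Int[OF bs m[of "- i" 0, unfolded sL]] by (simp add: Int_def)
    have "emeasure ?N2 {y. \<forall>j\<in>J. y j \<in> U j}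
        = emeasure (density L (indicator {y. nrm (y (- i)) > 1 \<and> nrm (y 0) > 1})) {y. \<forall>j\<in>J. y (j - i) \<in> U j}"
      using bm by (subst emeasure_distr) (auto simp: backshift_def vimage_def)
    also have "\<dots> = emeasure L {y. (\<forall>j\<in>J. y (j - i) \<in> U j) \<and> nrm (y (- i)) > 1 \<and> nrm (y 0) > 1}"
      using bs m[of "- i" 0] by (simp add: emeasure_restricted sL Int_def conj_commute)
    also have "\<dots> = measure MY {\<omega> \<in> space MY. \<forall>j\<in>{s..t}. Y (j - i) \<omega> \<in> V j}"
      using em[OF m2] win[of "\<lambda>j. Y (j - i) _"] by simp
    finally show "emeasure ?N1 {y. \<forall>j\<in>J. y j \<in> U j} = emeasure ?N2 {y. \<forall>j\<in>J. y j \<in> U j}"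
      using 1 main by simp
  qed (simp_all add: sL)
qed

lemma tail_law_shift:
  fixes X :: "int \<Rightarrow> 'w \<Rightarrow> real ^ 'd" and Y :: "int \<Rightarrow> 'y \<Rightarrow> real ^ 'd"
  assumes nrm: "is_norm nrm" and X: "stationary_process M X" and Y: "tail_process nrm M X \<alpha> MY Y"
    and H [measurable]: "H \<in> borel_measurable path_space"
  shows "(\<integral>\<^sup>+y. H y * indicator {y. nrm (y i) > 1} y \<partial>path_law MY Y)
    = (\<integral>\<^sup>+y. H (backshift i y) * indicator {y. nrm (y (- i)) > 1} y \<partial>path_law MY Y)"
proof -
  let ?L = "path_law MY Y"
  have [measurable]: "nrm \<in> borel_measurable borel" by (rule is_norm_measurable[OF nrm])
  have PY: "process MY Y" by (rule tail_process_process[OF Y])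
  have ae: "AE y in ?L. nrm (y 0) > 1"
    unfolding path_law_def
    by (subst AE_distr_iff[OF process_path_measurable[OF PY]])
       (use tail_process_exceeds[OF nrm Y] in \<open>auto intro!: sets_path_Collect\<close>)
  have m: "{y. nrm (y j) > 1 \<and> nrm (y k) > 1} \<in> sets path_space" for j k
    by (rule sets_path_Collect) measurable
  have "(\<integral>\<^sup>+y. H y * indicator {y. nrm (y i) > 1} y \<partial>?L)
      = (\<integral>\<^sup>+y. indicator {y. nrm (y 0) > 1 \<and> nrm (y i) > 1} y * H y \<partial>?L)"
    using ae by (intro nn_integral_cong_AE) (auto elim!: eventually_mono simp: indicator_def)
  also have "\<dots> = (\<integral>\<^sup>+y. H y \<partial>density ?L (indicator {y. nrm (y 0) > 1 \<and> nrm (y i) > 1}))"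
    using m by (subst nn_integral_density) auto
  also have "\<dots> = (\<integral>\<^sup>+y. H (backshift i y) \<partial>density ?L (indicator {y. nrm (y (- i)) > 1 \<and> nrm (y 0) > 1}))"
    unfolding tail_law_shift_measure[OF nrm X Y] by (subst nn_integral_distr) auto
  also have "\<dots> = (\<integral>\<^sup>+y. indicator {y. nrm (y (- i)) > 1 \<and> nrm (y 0) > 1} y * H (backshift i y) \<partial>?L)"
    using m by (subst nn_integral_density) auto
  also have "\<dots> = (\<integral>\<^sup>+y. H (backshift i y) * indicator {y. nrm (y (- i)) > 1} y \<partial>?L)"
    using ae by (intro nn_integral_cong_AE) (auto elim!: eventually_mono simp: indicator_def)
  finally show ?thesis .
qed

lemma tail_law_scale_measure:
  fixes X :: "int \<Rightarrow> 'w \<Rightarrow> real ^ 'd" and Y :: "int \<Rightarrow> 'y \<Rightarrow> real ^ 'd"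
  assumes nrm: "is_norm nrm" and P: "process M X" and Y: "tail_process nrm M X \<alpha> MY Y"
    and r: "1 \<le> r"
  defines "L \<equiv> path_law MY Y"
  shows "density L (indicator {y. nrm (y 0) > r})
    = scale_measure (ennreal (r powr (- \<alpha>))) (distr L path_space (\<lambda>y j. r *\<^sub>R y j))"
    (is "?N1 = ?N2")
proof -
  have PY: "process MY Y" by (rule tail_process_process[OF Y])
  interpret MY: prob_space MY using PY by (simp add: process_def)
  interpret L: prob_space L unfolding L_def by (rule prob_space_path_law[OF PY])
  have sL [measurable_cong]: "sets L = sets path_space" by (simp add: L_def)
  have spL [simp]: "space L = UNIV" by (simp add: L_def)
  have [measurable]: "nrm \<in> borel_measurable borel" by (rule is_norm_measurable[OF nrm])
  have m: "{y. nrm (y 0) > r} \<in> sets L"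
    unfolding sL by (rule sets_path_Collect) measurable
  have oU: "open {x. nrm x > r}"
    using is_norm_continuous[OF nrm] by (intro open_Collect_less) auto
  obtain c where c: "\<forall>f s t. (\<forall>j. continuous_on UNIV (f j)) \<and> (\<forall>j x. 0 \<le> f j x \<and> f j x \<le> (1::real)) \<and>
      (\<forall>x. nrm x \<le> r \<longrightarrow> f 0 x = 0) \<and> s \<le> 0 \<and> 0 \<le> t \<longrightarrow>
      (\<integral>\<omega>. (\<Prod>j\<in>{s..t}. f j (Y j \<omega>)) \<partial>MY) = c * (\<integral>\<omega>. (\<Prod>j\<in>{s..t}. f j (r *\<^sub>R Y j \<omega>)) \<partial>MY)"
    using tail_process_scale_test[OF nrm P Y r] ..
  have box: "measure MY {\<omega> \<in> space MY. (\<forall>j\<in>J. Y j \<omega> \<in> U j) \<and> nrm (Y 0 \<omega>) > r}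
      = c * measure MY {\<omega> \<in> space MY. (\<forall>j\<in>J. r *\<^sub>R Y j \<omega> \<in> U j) \<and> nrm (r *\<^sub>R Y 0 \<omega>) > r}"
    if J: "finite J" and U: "\<And>j. open (U j)" for J :: "int set" and U :: "int \<Rightarrow> (real ^ 'd) set"
  proof -
    define V where "V j = (if j \<in> J then U j else UNIV) \<inter> (if j = 0 then {x. nrm x > r} else UNIV)" for j :: int
    have V: "open (V j)" for j using U oU by (auto simp: V_def)
    define K where "K = insert 0 J"
    define s t where "s = Min K" and "t = Max K"
    have K: "finite K" "0 \<in> K" "J \<subseteq> K" using J by (auto simp: K_def)
    have st: "s \<le> 0" "0 \<le> t" "K \<subseteq> {s..t}"
      using K by (auto simp: s_def t_def)
    from open_boxes_approximation[of V, OF V] obtain f :: "int \<Rightarrow> nat \<Rightarrow> real ^ 'd \<Rightarrow> real" where f: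
      "\<And>j n. continuous_on UNIV (f j n)" "\<And>j n x. 0 \<le> f j n x" "\<And>j n x. f j n x \<le> 1"
      "\<And>j n x. x \<notin> V j \<Longrightarrow> f j n x = 0" "\<And>j x. (\<lambda>n. f j n x) \<longlonglongrightarrow> indicator (V j) x"
      by blast
    have A: "(\<lambda>n. \<integral>\<omega>. (\<Prod>j\<in>{s..t}. f j n (Y j \<omega>)) \<partial>MY)
        \<longlonglongrightarrow> measure MY {\<omega> \<in> space MY. \<forall>j\<in>{s..t}. Y j \<omega> \<in> V j}"
      by (rule box_probability_limit[OF PY _ V]) (auto intro: f)
    have PB: "process MY (\<lambda>j \<omega>. r *\<^sub>R Y j \<omega>)"
      using PY by (auto simp: process_def intro: borel_measurable_scaleR)
    have B: "(\<lambda>n. \<integral>\<omega>. (\<Prod>j\<in>{s..t}. f j n (r *\<^sub>R Y j \<omega>)) \<partial>MY)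
        \<longlonglongrightarrow> measure MY {\<omega> \<in> space MY. \<forall>j\<in>{s..t}. r *\<^sub>R Y j \<omega> \<in> V j}"
      by (rule box_probability_limit[OF PB _ V]) (auto intro: f)
    have "(\<integral>\<omega>. (\<Prod>j\<in>{s..t}. f j n (Y j \<omega>)) \<partial>MY) = c * (\<integral>\<omega>. (\<Prod>j\<in>{s..t}. f j n (r *\<^sub>R Y j \<omega>)) \<partial>MY)" for n
    proof -
      have "f 0 n x = 0" if "nrm x \<le> r" for x
        using that by (auto intro!: f simp: V_def)
      then show ?thesis
        using c[rule_format, of "\<lambda>j. f j n" s t] f st by blast
    qed
    then have main: "measure MY {\<omega> \<in> space MY. \<forall>j\<in>{s..t}. Y j \<omega> \<in> V j}
        = c * measure MY {\<omega> \<in> space MY. \<forall>j\<in>{s..t}. r *\<^sub>R Y j \<omega> \<in> V j}"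
      using A tendsto_mult_left[OF B, of c] by (auto intro: LIMSEQ_unique)
    have win: "(\<forall>j\<in>{s..t}. z j \<in> V j) \<longleftrightarrow> (\<forall>j\<in>J. z j \<in> U j) \<and> nrm (z 0) > r" for z
    proof -
      have "(\<forall>j\<in>{s..t}. z j \<in> V j)
          \<longleftrightarrow> (\<forall>j\<in>{s..t}. (j \<in> J \<longrightarrow> z j \<in> U j) \<and> (j = 0 \<longrightarrow> nrm (z j) > r))"
        by (intro ball_cong) (auto simp: V_def)
      also have "\<dots> \<longleftrightarrow> (\<forall>j\<in>J. z j \<in> U j) \<and> nrm (z 0) > r"
        using K st(3) by blast
      finally show ?thesis .
    qed
    show ?thesis using main unfolding win[of "\<lambda>j. Y j _"] win[of "\<lambda>j. r *\<^sub>R Y j _"] .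
  qed
  have exc: "AE \<omega> in MY. nrm (r *\<^sub>R Y 0 \<omega>) > r"
    using tail_process_exceeds[OF nrm Y] by eventually_elim (use nrm r in \<open>auto simp: is_norm_def\<close>)
  have [measurable]: "Y j \<in> borel_measurable MY" for j using PY by (simp add: process_def)
  have "measure MY {\<omega> \<in> space MY. nrm (r *\<^sub>R Y 0 \<omega>) > r} = 1"
    using exc by (subst MY.prob_Collect_eq_1) auto
  \<comment> \<open>The box without constraints isolates \<open>P(|Y\<^sub>0| > r)\<close>.\<close>
  then have cval: "c = r powr (- \<alpha>)"
    using box[of "{}" "\<lambda>_. UNIV"] tail_process_pareto[OF Y r] by simp
  show ?thesis
  proof (rule path_measure_eqI)
    show "finite_measure ?N1"
      by (rule L.finite_measure_restricted) (rule m)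
    fix J :: "int set" and U :: "int \<Rightarrow> (real ^ 'd) set" assume J: "finite J" and U: "\<And>j. open (U j)"
    have bm: "{y. \<forall>j\<in>J. y j \<in> U j} \<in> sets path_space" by (rule box_measurable[OF J U])
    note em = emeasure_path_law[OF PY, folded L_def]
    have m1: "{y. (\<forall>j\<in>J. y j \<in> U j) \<and> nrm (y 0) > r} \<in> sets path_space"
      using sets.Int[OF bm m[unfolded sL]] by (simp add: Int_def)
    have "emeasure ?N1 {y. \<forall>j\<in>J. y j \<in> U j} = emeasure L {y. (\<forall>j\<in>J. y j \<in> U j) \<and> nrm (y 0) > r}"
      using bm m by (simp add: emeasure_restricted sL Int_def conj_commute)
    also have "\<dots> = measure MY {\<omega> \<in> space MY. (\<forall>j\<in>J. Y j \<omega> \<in> U j) \<and> nrm (Y 0 \<omega>) > r}"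
      by (rule em[OF m1])
    finally have 1: "emeasure ?N1 {y. \<forall>j\<in>J. y j \<in> U j} = \<dots>" .
    have bs: "{y. \<forall>j\<in>J. r *\<^sub>R y j \<in> U j} \<in> sets path_space"
      using measurable_sets[OF measurable_scale_path[of r] bm] by (simp add: vimage_def)
    have "emeasure (distr L path_space (\<lambda>y j. r *\<^sub>R y j)) {y. \<forall>j\<in>J. y j \<in> U j}
        = emeasure L {y. \<forall>j\<in>J. r *\<^sub>R y j \<in> U j}"
      using bm by (subst emeasure_distr) (auto simp: vimage_def)
    also have "\<dots> = measure MY {\<omega> \<in> space MY. \<forall>j\<in>J. r *\<^sub>R Y j \<omega> \<in> U j}"
      by (rule em[OF bs])
    also have "measure MY {\<omega> \<in> space MY. \<forall>j\<in>J. r *\<^sub>R Y j \<omega> \<in> U j}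
        = measure MY {\<omega> \<in> space MY. (\<forall>j\<in>J. r *\<^sub>R Y j \<omega> \<in> U j) \<and> nrm (r *\<^sub>R Y 0 \<omega>) > r}"
    proof (rule measure_eq_AE)
      show "AE \<omega> in MY. (\<omega> \<in> {\<omega> \<in> space MY. \<forall>j\<in>J. r *\<^sub>R Y j \<omega> \<in> U j})
          = (\<omega> \<in> {\<omega> \<in> space MY. (\<forall>j\<in>J. r *\<^sub>R Y j \<omega> \<in> U j) \<and> nrm (r *\<^sub>R Y 0 \<omega>) > r})"
        using exc by eventually_elim auto
      have [measurable]: "U j \<in> sets borel" for j using U by simp
      show "{\<omega> \<in> space MY. \<forall>j\<in>J. r *\<^sub>R Y j \<omega> \<in> U j} \<in> sets MY"
        using J by measurable
      show "{\<omega> \<in> space MY. (\<forall>j\<in>J. r *\<^sub>R Y j \<omega> \<in> U j) \<and> nrm (r *\<^sub>R Y 0 \<omega>) > r} \<in> sets MY"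
        using J by measurable
    qed
    finally show "emeasure ?N1 {y. \<forall>j\<in>J. y j \<in> U j} = emeasure ?N2 {y. \<forall>j\<in>J. y j \<in> U j}"
      using 1 box[OF J U] by (simp add: cval ennreal_mult)
  qed (simp_all add: sL)
qed

text \<open>The law of \<open>Y\<close> conditioned on \<open>|Y\<^sub>0| > r\<close> is the law of \<open>rY\<close>. This contains the independence of \<open>|Y\<^sub>0|\<close>
  and \<open>\<Theta>\<close>.\<close>

lemma tail_law_scale:
  fixes X :: "int \<Rightarrow> 'w \<Rightarrow> real ^ 'd" and Y :: "int \<Rightarrow> 'y \<Rightarrow> real ^ 'd"
  assumes nrm: "is_norm nrm" and P: "process M X" and Y: "tail_process nrm M X \<alpha> MY Y"
    and r: "1 \<le> r" and H [measurable]: "H \<in> borel_measurable path_space"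
  shows "(\<integral>\<^sup>+y. H (\<lambda>j. r *\<^sub>R y j) \<partial>path_law MY Y)
    = ennreal (r powr \<alpha>) * (\<integral>\<^sup>+y. H y * indicator {y. nrm (y 0) > r} y \<partial>path_law MY Y)"
proof -
  let ?L = "path_law MY Y"
  have [measurable]: "nrm \<in> borel_measurable borel" by (rule is_norm_measurable[OF nrm])
  have m [measurable]: "{y. nrm (y 0) > r} \<in> sets path_space"
    by (rule sets_path_Collect) measurable
  have "(\<integral>\<^sup>+y. H y * indicator {y. nrm (y 0) > r} y \<partial>?L) = (\<integral>\<^sup>+y. H y \<partial>density ?L (indicator {y. nrm (y 0) > r}))"
    by (subst nn_integral_density) (auto simp: mult.commute)
  also have "\<dots> = ennreal (r powr (- \<alpha>)) * (\<integral>\<^sup>+y. H (\<lambda>j. r *\<^sub>R y j) \<partial>?L)"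
    unfolding tail_law_scale_measure[OF nrm P Y r]
    by (subst nn_integral_scale_measure, simp, subst nn_integral_distr) auto
  finally have "ennreal (r powr \<alpha>) * (\<integral>\<^sup>+y. H y * indicator {y. nrm (y 0) > r} y \<partial>?L)
      = (ennreal (r powr \<alpha>) * ennreal (r powr (- \<alpha>))) * (\<integral>\<^sup>+y. H (\<lambda>j. r *\<^sub>R y j) \<partial>?L)"
    by (simp add: mult.assoc)
  also have "ennreal (r powr \<alpha>) * ennreal (r powr (- \<alpha>)) = 1"
    using r by (simp flip: ennreal_mult powr_add)
  finally show ?thesis by simp
qed

section \<open>Sums over the integers\<close>

lemma nn_integral_int_eq_SUP:
  fixes f :: "int \<Rightarrow> ennreal" and A :: "int set"
  shows "(\<integral>\<^sup>+i. f i \<partial>count_space A) = (SUP n. \<Sum>i\<in>A \<inter> {- int n..int n}. f i)"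
proof -
  have "(\<Sum>i\<in>A \<inter> {- int n..int n}. f i)
      = (\<integral>\<^sup>+i. f i * indicator {- int n..int n} i \<partial>count_space A)" for n
    by (subst nn_integral_count_space'[of "A \<inter> {- int n..int n}"]) (auto intro!: sum.cong)
  then have "(SUP n. \<Sum>i\<in>A \<inter> {- int n..int n}. f i)
      = (SUP n. \<integral>\<^sup>+i. f i * indicator {- int n..int n} i \<partial>count_space A)" by simp
  also have "\<dots> = (\<integral>\<^sup>+i. (SUP n. f i * indicator {- int n..int n} i) \<partial>count_space A)"
    by (rule nn_integral_monotone_convergence_SUP[symmetric])
       (auto simp: incseq_def le_fun_def indicator_def)
  also have "\<dots> = (\<integral>\<^sup>+i. f i \<partial>count_space A)"
  proof (rule nn_integral_cong)
    fix i :: int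
    show "(SUP n. f i * indicator {- int n..int n} i) = f i"
    proof (rule antisym)
      have "f i = f i * indicator {- int (nat \<bar>i\<bar>)..int (nat \<bar>i\<bar>)} i" by (auto simp: indicator_def)
      also have "\<dots> \<le> (SUP n. f i * indicator {- int n..int n} i)" by (rule SUP_upper) simp
      finally show "f i \<le> (SUP n. f i * indicator {- int n..int n} i)" .
    qed (auto intro!: SUP_least simp: indicator_def)
  qed
  finally show ?thesis ..
qed

lemma sum_le_count_space_integral:
  fixes f :: "'i \<Rightarrow> ennreal"
  assumes "finite F" "F \<subseteq> A"
  shows "sum f F \<le> (\<integral>\<^sup>+i. f i \<partial>count_space A)"
proof -
  have "sum f F = (\<integral>\<^sup>+i. f i * indicator F i \<partial>count_space A)"
    using assms by (subst nn_integral_count_space'[of F]) auto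
  also have "\<dots> \<le> (\<integral>\<^sup>+i. f i \<partial>count_space A)"
    by (rule nn_integral_mono) (simp add: indicator_def)
  finally show ?thesis .
qed

lemma infsum_int_eq_nn_integral:
  fixes f :: "int \<Rightarrow> ennreal" and A :: "int set"
  shows "(\<Sum>\<^sub>\<infinity>i\<in>A. f i) = (\<integral>\<^sup>+i. f i \<partial>count_space A)"
proof (rule antisym)
  show "(\<Sum>\<^sub>\<infinity>i\<in>A. f i) \<le> (\<integral>\<^sup>+i. f i \<partial>count_space A)"
  proof (subst nonneg_infsum_complete)
    show "(SUP F\<in>{F. finite F \<and> F \<subseteq> A}. sum f F) \<le> (\<integral>\<^sup>+i. f i \<partial>count_space A)"
    proof (rule SUP_least)
      fix F assume "F \<in> {F. finite F \<and> F \<subseteq> A}"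
      then show "sum f F \<le> (\<integral>\<^sup>+i. f i \<partial>count_space A)"
        by (intro sum_le_count_space_integral) auto
    qed
  qed simp
  show "(\<integral>\<^sup>+i. f i \<partial>count_space A) \<le> (\<Sum>\<^sub>\<infinity>i\<in>A. f i)"
    unfolding nn_integral_int_eq_SUP
    by (subst nonneg_infsum_complete) (auto intro!: SUP_mono)
qed

lemma nn_integral_int_shift:
  fixes f :: "int \<Rightarrow> ennreal"
  shows "(\<integral>\<^sup>+i. f (i - k) \<partial>count_space UNIV) = (\<integral>\<^sup>+i. f i \<partial>count_space UNIV)"
  by (rule nn_integral_bij_count_space) (rule bij_betwI[of _ _ _ "\<lambda>i. i + k"], auto)

lemma nn_integral_int_reflect:
  fixes f :: "int \<Rightarrow> ennreal"
  shows "(\<integral>\<^sup>+i. f (- i) \<partial>count_space UNIV) = (\<integral>\<^sup>+i. f i \<partial>count_space UNIV)"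
  by (rule nn_integral_bij_count_space) (rule bij_betwI[of _ _ _ uminus], auto)

text \<open>Up to time \<open>m\<close> the truncated differences add up to the increase of the running supremum, which is
  small at times far in the past.\<close>

lemma sum_record_increments:
  fixes a :: "int \<Rightarrow> ennreal"
  assumes small: "\<And>e. e > 0 \<Longrightarrow> \<exists>n. \<forall>k<n. a k \<le> ennreal e"
  shows "(\<integral>\<^sup>+i. a i - (SUP k\<in>{..<i}. a k) \<partial>count_space UNIV) = (SUP k. a k)"
proof -
  define b where "b i = (SUP k\<in>{..<i}. a k)" for i
  define T where "T = (\<integral>\<^sup>+i. a i - b i \<partial>count_space UNIV)"
  have step: "a i - b i + b i = b (i + 1)" for i
  proof -
    have "{..<i + 1} = insert i {..<i}" by auto
    then have "b (i + 1) = max (a i) (b i)" by (simp add: b_def sup_max)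
    also have "\<dots> = a i - b i + b i"
    proof (cases "b i \<le> a i")
      case False
      then show ?thesis
        by (cases "b i = top") (auto simp: max_def diff_eq_0_ennreal less_top)
    qed (auto simp: max_def diff_add_cancel_ennreal)
    finally show ?thesis ..
  qed
  have tele: "(\<Sum>i\<in>{n..<n + int m}. a i - b i) + b n = b (n + int m)" for n m
  proof (induction m)
    case (Suc m)
    have "{n..<n + int (Suc m)} = insert (n + int m) {n..<n + int m}" by auto
    then have "(\<Sum>i\<in>{n..<n + int (Suc m)}. a i - b i) + b n
        = (a (n + int m) - b (n + int m)) + ((\<Sum>i\<in>{n..<n + int m}. a i - b i) + b n)"
      by (simp add: add.assoc)
    also have "\<dots> = b (n + int m + 1)" unfolding Suc step ..
    finally show ?case by (simp add: algebra_simps)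
  qed simp
  have part: "(\<Sum>i\<in>F. a i - b i) \<le> T" if "finite F" for F
    unfolding T_def using that by (rule sum_le_count_space_integral) simp
  have "T \<le> (SUP k. a k)"
    unfolding T_def nn_integral_int_eq_SUP
  proof (rule SUP_least)
    fix n
    have "(\<Sum>i\<in>UNIV \<inter> {- int n..int n}. a i - b i)
        = (\<Sum>i\<in>{- int n..<- int n + int (2 * n + 1)}. a i - b i)"
      by (rule sum.cong) auto
    also have "\<dots> \<le> b (- int n + int (2 * n + 1))"
      unfolding tele[symmetric] by simp
    also have "\<dots> \<le> (SUP k. a k)" unfolding b_def by (rule SUP_subset_mono) auto
    finally show "(\<Sum>i\<in>UNIV \<inter> {- int n..int n}. a i - b i) \<le> (SUP k. a k)" .
  qed
  moreover have "(SUP k. a k) \<le> T"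
  proof (rule SUP_least)
    fix k
    show "a k \<le> T"
    proof (rule ennreal_le_epsilon)
      fix e :: real assume "0 < e"
      then obtain n where n: "\<forall>k<n. a k \<le> ennreal e" using small by blast
      define l where "l = min n k"
      have bl: "b l \<le> ennreal e" unfolding b_def using n by (intro SUP_least) (auto simp: l_def)
      have "a k \<le> b (k + 1)" unfolding b_def by (rule SUP_upper) simp
      also have "k + 1 = l + int (nat (k + 1 - l))" by (auto simp: l_def min_def)
      also have "b \<dots> \<le> T + ennreal e"
        unfolding tele[symmetric] using part bl by (intro add_mono) auto
      finally show "a k \<le> T + ennreal e" .
    qed
  qed
  ultimately show ?thesis unfolding T_def b_def by (rule antisym)
qed

lemma sum_reverse_record_increments:
  fixes a :: "int \<Rightarrow> ennreal"
  assumes small: "\<And>e. e > 0 \<Longrightarrow> \<exists>n. \<forall>k>n. a k \<le> ennreal e"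
  shows "(\<integral>\<^sup>+i. a i - (SUP k\<in>{i<..}. a k) \<partial>count_space UNIV) = (SUP k. a k)"
proof -
  have im: "uminus ` {..<i} = {- i<..}" for i :: int
    by (auto intro!: image_eqI[of _ _ "- _"])
  have sup: "(SUP k\<in>{..<i}. a (- k)) = (SUP k\<in>{- i<..}. a k)" for i
    by (simp only: im[symmetric] image_image)
  have "(SUP k. a (- k)) = (SUP k\<in>range uminus. a k)" by (simp only: image_image)
  then have all: "(SUP k. a (- k)) = (SUP k. a k)" by (simp add: surj_uminus)
  have "\<exists>n. \<forall>k<n. a (- k) \<le> ennreal e" if "e > 0" for e
  proof -
    from small[OF that] obtain n where "\<forall>k>n. a k \<le> ennreal e" ..
    then show ?thesis by (intro exI[of _ "- n"]) auto
  qed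
  then have "(\<integral>\<^sup>+i. a (- i) - (SUP k\<in>{..<i}. a (- k)) \<partial>count_space UNIV) = (SUP k. a k)"
    using sum_record_increments[of "\<lambda>k. a (- k)"] by (simp add: all)
  then show ?thesis
    unfolding sup by (subst nn_integral_int_reflect[symmetric]) simp
qed

lemma ennreal_powr_mult:
  assumes "c > 0"
  shows "ennreal_powr (ennreal c * x) p = ennreal (c powr p) * ennreal_powr x p"
proof (cases x rule: ennreal_cases)
  case (real r)
  then show ?thesis
    using assms by (auto simp: ennreal_powr_def powr_mult ennreal_mult ennreal_mult_top simp flip: ennreal_mult)
next
  case top
  then show ?thesis
    using assms by (auto simp: ennreal_powr_def ennreal_mult_top)
qed

lemma ennreal_powr_ennreal: "x > 0 \<Longrightarrow> ennreal_powr (ennreal x) p = ennreal (x powr p)"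
  by (simp add: ennreal_powr_def)

lemma ennreal_powr_mono:
  assumes "0 \<le> p" "x \<le> y"
  shows "ennreal_powr x p \<le> ennreal_powr y p"
  using assms
  by (cases x rule: ennreal_cases; cases y rule: ennreal_cases)
     (auto simp: ennreal_powr_def top_unique intro!: ennreal_leI powr_mono2)

lemma measurable_ennreal_powr [measurable]:
  "(\<lambda>x. ennreal_powr x p) \<in> borel_measurable borel"
  unfolding ennreal_powr_def by measurable

text \<open>At \<open>x = \<infinity>\<close> with \<open>p < 1\<close> the left side is 0 while the right side is infinite.\<close>

lemma mult_ennreal_powr_minus_1:
  assumes "x < \<infinity> \<or> 1 \<le> p" "0 < p"
  shows "x * ennreal_powr x (p - 1) = ennreal_powr x p"
proof (cases x rule: ennreal_cases)
  case (real r)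
  then show ?thesis
    using assms by (cases "r = 0") (auto simp: ennreal_powr_def powr_diff simp flip: ennreal_mult)
next
  case top
  then show ?thesis using assms by (auto simp: ennreal_powr_def ennreal_mult_top)
qed

text \<open>Sum a finite window of mass more than \<open>2c\<close> from the left and let \<open>j\<close> be the position at which the
  partial sums first reach \<open>c\<close>: before \<open>j\<close> there is less than \<open>c\<close>, hence more than \<open>c\<close> remains from \<open>j\<close> on.\<close>

lemma split_mass:
  fixes x :: "int \<Rightarrow> ennreal" and c :: real
  assumes c: "c > 0" and S: "ennreal (2 * c) < (\<integral>\<^sup>+i. x i \<partial>count_space UNIV)"
  obtains j where "ennreal c \<le> (\<integral>\<^sup>+i. x i \<partial>count_space {..j})" "ennreal c \<le> (\<integral>\<^sup>+i. x i \<partial>count_space {j..})"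
proof -
  from S obtain n where n: "ennreal (2 * c) < (\<Sum>i\<in>{- int n..int n}. x i)"
    unfolding nn_integral_int_eq_SUP less_SUP_iff by auto
  define F where "F m = (\<Sum>i\<in>{- int n..<- int n + int m}. x i)" for m
  have top: "F (2 * n + 1) = (\<Sum>i\<in>{- int n..int n}. x i)"
    unfolding F_def by (rule sum.cong) auto
  have "ennreal c \<le> ennreal (2 * c)" using c by (intro ennreal_leI) simp
  also note n
  finally have Ftop: "ennreal c \<le> F (2 * n + 1)" using top by simp
  define m where "m = (LEAST k. ennreal c \<le> F k)"
  have m: "ennreal c \<le> F m" "\<And>k. k < m \<Longrightarrow> \<not> ennreal c \<le> F k" "m \<le> 2 * n + 1"
    unfolding m_def using Ftop by (rule LeastI, auto dest: not_less_Least intro!: Least_le Ftop)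
  \<comment> \<open>The summand with which \<open>F\<close> first reaches \<open>c\<close> sits at \<open>j\<close>.\<close>
  have "F 0 = 0" by (simp add: F_def)
  then have "m \<noteq> 0" using m(1) c by (intro notI) (simp add: ennreal_eq_0_iff)
  then obtain q where q: "m = Suc q" by (cases m) auto
  define j where "j = - int n + int q"
  show thesis
  proof (rule that[of j])
    show "ennreal c \<le> (\<integral>\<^sup>+i. x i \<partial>count_space {..j})"
      using m(1) unfolding F_def by (rule order_trans) (auto intro!: sum_le_count_space_integral simp: q j_def)
    have "{- int n..int n} = {- int n..<- int n + int q} \<union> {j..int n}"
      using m(3) by (auto simp: q j_def)
    then have "(\<Sum>i\<in>{- int n..int n}. x i) = F q + (\<Sum>i\<in>{j..int n}. x i)"
      unfolding F_def by (simp add: sum.union_disjoint j_def ivl_disj_int)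
    with n have *: "ennreal c + ennreal c < F q + (\<Sum>i\<in>{j..int n}. x i)"
      using c by (simp flip: ennreal_plus)
    have "F q < ennreal c" using m(2)[of q] by (simp add: q not_le)
    have "ennreal c \<le> (\<Sum>i\<in>{j..int n}. x i)"
    proof (rule ccontr)
      assume "\<not> ?thesis"
      then have "F q + (\<Sum>i\<in>{j..int n}. x i) \<le> ennreal c + ennreal c"
        using \<open>F q < ennreal c\<close> by (intro add_mono) auto
      with * show False by simp
    qed
    also have "\<dots> \<le> (\<integral>\<^sup>+i. x i \<partial>count_space {j..})" by (rule sum_le_count_space_integral) auto
    finally show "ennreal c \<le> (\<integral>\<^sup>+i. x i \<partial>count_space {j..})" .
  qed
qed

text \<open>At a position \<open>j\<close> that has mass \<open>c\<close> on either side, the terms up to \<open>j\<close> already contribute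
  \<open>c c\<^sup>p\<^sup>-\<^sup>1\<close>, since every tail sum that starts at or before \<open>j\<close> is at least \<open>c\<close>. Any \<open>c\<close> below half of the
  total mass is available.\<close>

lemma powr_sum_le_sum_tail_powr:
  fixes x :: "int \<Rightarrow> ennreal"
  assumes p: "1 \<le> p"
  shows "ennreal_powr (\<integral>\<^sup>+i. x i \<partial>count_space UNIV) p
    \<le> ennreal (2 powr p) * (\<integral>\<^sup>+j. x j * ennreal_powr (\<integral>\<^sup>+i. x i \<partial>count_space {j..}) (p - 1) \<partial>count_space UNIV)"
    (is "ennreal_powr ?S p \<le> _ * ?V")
proof -
  have below: "ennreal (c powr p) \<le> ?V" if c: "c > 0" "ennreal (2 * c) < ?S" for c
  proof -
    obtain j where j: "ennreal c \<le> (\<integral>\<^sup>+i. x i \<partial>count_space {..j})" "ennreal c \<le> (\<integral>\<^sup>+i. x i \<partial>count_space {j..})"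
      using split_mass[OF c] .
    have tail: "ennreal c \<le> (\<integral>\<^sup>+i. x i \<partial>count_space {k..})" if "k \<le> j" for k
    proof -
      have "(\<integral>\<^sup>+i. x i \<partial>count_space {j..}) \<le> (\<integral>\<^sup>+i. x i \<partial>count_space {k..})"
        using that by (simp add: nn_integral_count_space_indicator) (intro nn_integral_mono, auto simp: indicator_def)
      with j(2) show ?thesis by (rule order_trans)
    qed
    have "ennreal (c powr p) = ennreal c * ennreal (c powr (p - 1))"
      using c by (simp add: powr_diff flip: ennreal_mult)
    also have "\<dots> \<le> (\<integral>\<^sup>+i. x i \<partial>count_space {..j}) * ennreal (c powr (p - 1))"
      using j(1) by (intro mult_right_mono) auto
    also have "\<dots> = (\<integral>\<^sup>+i. x i * ennreal (c powr (p - 1)) \<partial>count_space {..j})"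
      by (simp add: nn_integral_multc)
    also have "\<dots> \<le> (\<integral>\<^sup>+k. x k * ennreal_powr (\<integral>\<^sup>+i. x i \<partial>count_space {k..}) (p - 1) \<partial>count_space {..j})"
    proof (rule nn_integral_mono)
      fix k assume "k \<in> space (count_space {..j})"
      then have "ennreal_powr (ennreal c) (p - 1) \<le> ennreal_powr (\<integral>\<^sup>+i. x i \<partial>count_space {k..}) (p - 1)"
        using p by (intro ennreal_powr_mono tail) auto
      then show "x k * ennreal (c powr (p - 1)) \<le> x k * ennreal_powr (\<integral>\<^sup>+i. x i \<partial>count_space {k..}) (p - 1)"
        using c by (intro mult_left_mono) (auto simp: ennreal_powr_ennreal)
    qed
    also have "\<dots> \<le> ?V"
      by (simp add: nn_integral_count_space_indicator) (intro nn_integral_mono, auto simp: indicator_def)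
    finally show ?thesis .
  qed
  show ?thesis
  proof (cases ?V rule: ennreal_cases)
    case top
    then show ?thesis by (simp add: ennreal_mult_top)
  next
    case (real v)
    have "?S \<le> ennreal (2 * v powr (1 / p))"
    proof (rule ccontr)
      assume "\<not> ?thesis"
      then have "ennreal (2 * v powr (1 / p)) < ?S" by simp
      then obtain z where z: "ennreal (2 * v powr (1 / p)) < z" "z < ?S" using dense by blast
      then have "z < top" using less_le_trans top_greatest by blast
      then obtain w where w: "z = ennreal w" "w \<ge> 0" by (cases z rule: ennreal_cases) auto
      define c where "c = w / 2"
      have c: "v powr (1 / p) < c" using z(1) w by (simp add: c_def ennreal_less_iff)
      then have c0: "c > 0" using powr_ge_zero[of v "1 / p"] by linarith
      have "c powr p \<le> v"
        using below[OF c0] z(2) w real by (simp add: c_def)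
      moreover have "(v powr (1 / p)) powr p < c powr p"
        using c p by (intro powr_less_mono2) auto
      moreover have "(v powr (1 / p)) powr p = v"
        using real p by (cases "v = 0") (auto simp: powr_powr)
      ultimately show False by simp
    qed
    then have "ennreal_powr ?S p \<le> ennreal_powr (ennreal (2 * v powr (1 / p))) p"
      using p by (intro ennreal_powr_mono) auto
    also have "\<dots> \<le> ennreal (2 powr p) * ennreal v"
    proof (cases "v = 0")
      case True
      then show ?thesis using p by (simp add: ennreal_powr_def)
    next
      case False
      then have "(2 * v powr (1 / p)) powr p = 2 powr p * v"
        using real p by (simp add: powr_mult powr_powr)
      then have "ennreal_powr (ennreal (2 * v powr (1 / p))) p = ennreal (2 powr p * v)"
        using False by (subst ennreal_powr_ennreal) simp_all
      then show ?thesis using real by (simp add: ennreal_mult)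
    qed
    finally show ?thesis using real by simp
  qed
qed

section \<open>Homogeneous functionals\<close>

definition homogeneous :: "real \<Rightarrow> ((int \<Rightarrow> real ^ 'd) \<Rightarrow> ennreal) \<Rightarrow> bool" where
  "homogeneous p H \<longleftrightarrow> (\<forall>c>0. \<forall>y. H (\<lambda>j. c *\<^sub>R y j) = ennreal (c powr p) * H y)"

lemma homogeneous_scaled: "homogeneous p H \<Longrightarrow> c > 0 \<Longrightarrow> H (\<lambda>j. c *\<^sub>R y j) = ennreal (c powr p) * H y"
  by (simp add: homogeneous_def)

lemma homogeneous_0_scaled: "homogeneous 0 H \<Longrightarrow> c > 0 \<Longrightarrow> H (\<lambda>j. c *\<^sub>R y j) = H y"
  by (simp add: homogeneous_def)

lemma homogeneous_mult:
  "homogeneous p G \<Longrightarrow> homogeneous q H \<Longrightarrow> homogeneous (p + q) (\<lambda>y. G y * H y)"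
  by (simp add: homogeneous_def powr_add ennreal_mult ac_simps)

lemma homogeneous_divide:
  assumes "homogeneous p G" "homogeneous p H"
  shows "homogeneous 0 (\<lambda>y. G y / H y)"
  unfolding homogeneous_def
proof (intro allI impI)
  fix c :: real and y assume c: "c > 0"
  then have "G (\<lambda>j. c *\<^sub>R y j) / H (\<lambda>j. c *\<^sub>R y j) = (G y * ennreal (c powr p)) / (H y * ennreal (c powr p))"
    using assms by (simp add: homogeneous_def mult.commute)
  also have "\<dots> = G y / H y" using c by (intro divide_mult_eq) auto
  finally show "G (\<lambda>j. c *\<^sub>R y j) / H (\<lambda>j. c *\<^sub>R y j) = ennreal (c powr 0) * (G y / H y)"
    using c by simp
qed

lemma homogeneous_SUP:
  "(\<And>i. i \<in> I \<Longrightarrow> homogeneous p (G i)) \<Longrightarrow> homogeneous p (\<lambda>y. SUP i\<in>I. G i y)"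
  by (simp add: homogeneous_def SUP_mult_left_ennreal)

lemma homogeneous_diff:
  "homogeneous p G \<Longrightarrow> homogeneous p H \<Longrightarrow> homogeneous p (\<lambda>y. G y - H y)"
  by (simp add: homogeneous_def ennreal_right_diff_distrib)

lemma homogeneous_sum:
  "(\<And>i. homogeneous p (G i)) \<Longrightarrow> homogeneous p (\<lambda>y. \<integral>\<^sup>+i. G i y \<partial>count_space I)"
  by (simp add: homogeneous_def nn_integral_cmult)

lemma homogeneous_ennreal_powr:
  assumes "homogeneous p G"
  shows "homogeneous (p * q) (\<lambda>y. ennreal_powr (G y) q)"
  using assms by (simp add: homogeneous_def ennreal_powr_mult powr_powr)

lemma homogeneous_0_compose:
  "homogeneous 0 G \<Longrightarrow> homogeneous 0 (\<lambda>y. f (G y))"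
  by (simp add: homogeneous_def)

lemma measurable_int_sum [measurable]:
  fixes G :: "int \<Rightarrow> 'a \<Rightarrow> ennreal"
  assumes [measurable]: "\<And>i. G i \<in> borel_measurable M"
  shows "(\<lambda>y. \<integral>\<^sup>+i. G i y \<partial>count_space I) \<in> borel_measurable M"
  unfolding nn_integral_int_eq_SUP by measurable

section \<open>Polar decomposition and time change\<close>

text \<open>What remains of the tail measure \<open>\<nu>\<close> once it is restricted to \<open>{|y\<^sub>0| > 1}\<close>: \<open>shift_law\<close> is shift
  invariance of \<open>\<nu>\<close> and \<open>scale_law\<close> is its homogeneity.\<close>

locale tail_law =
  fixes nrm :: "real ^ 'd \<Rightarrow> real" and \<alpha> :: real and L :: "(int \<Rightarrow> real ^ 'd) measure"
  assumes is_norm: "is_norm nrm" and index_pos: "0 < \<alpha>"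
    and prob: "prob_space L" and sets_L [measurable_cong]: "sets L = sets path_space"
    and exceeds: "AE y in L. 1 < nrm (y 0)"
    and shift_law: "\<And>H i. H \<in> borel_measurable path_space \<Longrightarrow>
      (\<integral>\<^sup>+y. H y * indicator {y. 1 < nrm (y i)} y \<partial>L)
        = (\<integral>\<^sup>+y. H (backshift i y) * indicator {y. 1 < nrm (y (- i))} y \<partial>L)"
    and scale_law: "\<And>H r. H \<in> borel_measurable path_space \<Longrightarrow> 1 \<le> r \<Longrightarrow>
      (\<integral>\<^sup>+y. H (\<lambda>j. r *\<^sub>R y j) \<partial>L) = ennreal (r powr \<alpha>) * (\<integral>\<^sup>+y. H y * indicator {y. r < nrm (y 0)} y \<partial>L)"
    and vanishes: "AE y in L. ((\<lambda>k. nrm (y k)) \<longlongrightarrow> 0) at_top \<and> ((\<lambda>k. nrm (y k)) \<longlongrightarrow> 0) at_bot"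
begin

sublocale prob_space L by (rule prob)

lemma space_L [simp]: "space L = UNIV"
  using sets_eq_imp_space_eq[OF sets_L] by simp

lemma measurable_nrm [measurable]: "nrm \<in> borel_measurable borel"
  by (rule is_norm_measurable[OF is_norm])

lemma nrm_nonneg: "0 \<le> nrm x" and nrm_eq_0: "nrm x = 0 \<longleftrightarrow> x = 0"
  and nrm_scale: "nrm (c *\<^sub>R x) = \<bar>c\<bar> * nrm x"
  using is_norm by (auto simp: is_norm_def)

definition mag :: "int \<Rightarrow> (int \<Rightarrow> real ^ 'd) \<Rightarrow> ennreal" where
  "mag i y = ennreal (nrm (y i) powr \<alpha>)"

lemma measurable_mag [measurable]: "mag i \<in> borel_measurable path_space"
  unfolding mag_def by measurable

lemma homogeneous_mag: "homogeneous \<alpha> (mag i)"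
  by (simp add: homogeneous_def mag_def nrm_scale powr_mult nrm_nonneg ennreal_mult)

lemma mag_backshift: "mag i (backshift k y) = mag (i - k) y"
  by (simp add: mag_def backshift_def)

lemma mag_finite: "mag i y < \<infinity>" by (simp add: mag_def)

lemma mag_eq_0: "mag i y = 0 \<longleftrightarrow> y i = 0"
  using index_pos by (simp add: mag_def nrm_eq_0)

lemma less_mag:
  assumes "0 \<le> r"
  shows "ennreal (r powr \<alpha>) < mag i y \<longleftrightarrow> r < nrm (y i)"
proof
  assume "r < nrm (y i)"
  then show "ennreal (r powr \<alpha>) < mag i y"
    using assms index_pos by (auto simp: mag_def ennreal_less_iff intro!: powr_less_mono2)
next
  assume *: "ennreal (r powr \<alpha>) < mag i y"
  show "r < nrm (y i)"
  proof (rule ccontr)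
    assume "\<not> r < nrm (y i)"
    then have "nrm (y i) powr \<alpha> \<le> r powr \<alpha>"
      using index_pos by (intro powr_mono2) (auto simp: nrm_nonneg)
    with * show False by (simp add: mag_def ennreal_less_iff)
  qed
qed

lemma mag_0_gt_1: "AE y in L. 1 < mag 0 y"
  using exceeds by eventually_elim (use less_mag[of 1] in simp)

text \<open>For \<open>0 < v < 1\<close> the event is \<open>|Y\<^sub>0| > r\<close> with \<open>r\<^sup>\<alpha> = 1/v\<close>, and rescaling the path by \<open>r\<close> does not change \<open>K\<close>.\<close>

lemma polar_const:
  assumes K [measurable]: "K \<in> borel_measurable path_space" and K0: "homogeneous 0 K"
  shows "(\<integral>\<^sup>+y. K y * indicator {y. 1 < v * mag 0 y} y \<partial>L) = min 1 v * (\<integral>\<^sup>+y. K y \<partial>L)"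
proof (cases "1 \<le> v")
  case True
  have "AE y in L. 1 < v * mag 0 y"
    using mag_0_gt_1
  proof eventually_elim
    fix y assume "1 < mag 0 y"
    also have "mag 0 y \<le> v * mag 0 y" using mult_right_mono[OF True, of "mag 0 y"] by simp
    finally show "1 < v * mag 0 y" .
  qed
  then have "(\<integral>\<^sup>+y. K y * indicator {y. 1 < v * mag 0 y} y \<partial>L) = (\<integral>\<^sup>+y. K y \<partial>L)"
    by (intro nn_integral_cong_AE) (auto elim!: eventually_mono)
  then show ?thesis using True by (simp add: min_absorb1)
next
  case False
  then have "v < top" using less_trans[of v 1 top] by simp
  then obtain x where x: "v = ennreal x" "0 \<le> x" by (cases v rule: ennreal_cases) auto
  have x1: "x < 1" using False x by (simp add: not_le ennreal_less_iff flip: ennreal_1)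
  show ?thesis
  proof (cases "x = 0")
    case True
    then show ?thesis using x by simp
  next
    case False
    then have x0: "0 < x" using x by simp
    define r where "r = x powr (- 1 / \<alpha>)"
    have r\<alpha>: "r powr \<alpha> = 1 / x"
      using x0 index_pos unfolding r_def powr_powr by (simp add: powr_minus_divide)
    have r1: "1 \<le> r"
    proof (rule ccontr)
      assume "\<not> 1 \<le> r"
      then have "r powr \<alpha> < 1 powr \<alpha>"
        using index_pos by (intro powr_less_mono2) (auto simp: r_def)
      moreover have "1 < 1 / x" using x0 x1 by simp
      ultimately show False using r\<alpha> by simp
    qed
    have set: "1 < v * mag 0 y \<longleftrightarrow> r < nrm (y 0)" for y
    proof -
      have "1 < v * mag 0 y \<longleftrightarrow> 1 < x * nrm (y 0) powr \<alpha>"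
        using x by (simp add: mag_def ennreal_less_iff flip: ennreal_mult ennreal_1)
      also have "\<dots> \<longleftrightarrow> r powr \<alpha> < nrm (y 0) powr \<alpha>"
        unfolding r\<alpha> using x0 by (simp add: field_simps)
      also have "\<dots> \<longleftrightarrow> r < nrm (y 0)"
        using less_mag[of r 0 y] r1 by (simp add: mag_def ennreal_less_iff)
      finally show ?thesis .
    qed
    have "(\<integral>\<^sup>+y. K y \<partial>L) = (\<integral>\<^sup>+y. K (\<lambda>j. r *\<^sub>R y j) \<partial>L)"
      using r1 by (simp add: homogeneous_0_scaled[OF K0])
    also have "\<dots> = ennreal (1 / x) * (\<integral>\<^sup>+y. K y * indicator {y. 1 < v * mag 0 y} y \<partial>L)"
      unfolding scale_law[OF K r1] r\<alpha> set ..
    finally have "v * (\<integral>\<^sup>+y. K y \<partial>L) = (ennreal x * ennreal (1 / x)) * (\<integral>\<^sup>+y. K y * indicator {y. 1 < v * mag 0 y} y \<partial>L)"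
      by (simp add: x mult.assoc)
    also have "ennreal x * ennreal (1 / x) = 1"
      using x0 by (simp flip: ennreal_mult)
    finally have "v * (\<integral>\<^sup>+y. K y \<partial>L) = (\<integral>\<^sup>+y. K y * indicator {y. 1 < v * mag 0 y} y \<partial>L)" by simp
    moreover have "min 1 v = v" using \<open>\<not> 1 \<le> v\<close> by simp
    ultimately show ?thesis by simp
  qed
qed

text \<open>Since \<open>1/a\<^sub>0\<close> is uniform on \<open>(0,1)\<close> and independent of \<open>\<Theta>\<close>, the conditional probability of
  \<open>1/a\<^sub>0 < \<rho>\<close> given \<open>\<Theta>\<close> is \<open>min 1 \<rho>\<close>.\<close>

lemma polar:
  assumes K [measurable]: "K \<in> borel_measurable path_space" and K0: "homogeneous 0 K"
    and \<rho> [measurable]: "\<rho> \<in> borel_measurable path_space" and \<rho>0: "homogeneous 0 \<rho>"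
  shows "(\<integral>\<^sup>+y. K y * indicator {y. 1 < \<rho> y * mag 0 y} y \<partial>L) = (\<integral>\<^sup>+y. K y * min 1 (\<rho> y) \<partial>L)"
proof -
  \<comment> \<open>The simple functions approximate the identity on the values of \<open>\<rho>\<close>, so that every \<open>f n \<circ> \<rho>\<close> inherits
    degree 0 from \<open>\<rho>\<close>.\<close>
  obtain f :: "nat \<Rightarrow> ennreal \<Rightarrow> ennreal" where
    f: "\<And>n. simple_function borel (f n)" "incseq f" "\<And>x. (SUP n. f n x) = x"
    by (rule borel_measurable_implies_simple_function_sequence'[of "\<lambda>x. x" borel]) auto
  have [measurable]: "f n \<in> borel_measurable borel" for n
    using f(1) by (rule borel_measurable_simple_function)
  have fin: "finite (range (f n))" for n
    using simple_functionD(1)[OF f(1)[of n]] by simp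
  have simple: "(\<integral>\<^sup>+y. K y * indicator {y. 1 < f n (\<rho> y) * mag 0 y} y \<partial>L)
      = (\<integral>\<^sup>+y. K y * min 1 (f n (\<rho> y)) \<partial>L)" for n
  proof -
    define Kv where "Kv v y = (if f n (\<rho> y) = v then K y else 0)" for v y
    have Kvm [measurable]: "Kv v \<in> borel_measurable path_space" for v
      unfolding Kv_def by measurable
    have Kv0: "homogeneous 0 (Kv v)" for v
      using K0 \<rho>0 by (simp add: homogeneous_def Kv_def)
    have pick: "(\<Sum>v\<in>range (f n). Kv v y * h v) = K y * h (f n (\<rho> y))" for y and h :: "ennreal \<Rightarrow> ennreal"
    proof -
      have "(\<Sum>v\<in>range (f n). Kv v y * h v) = (\<Sum>v\<in>range (f n). if f n (\<rho> y) = v then K y * h v else 0)"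
        by (rule sum.cong) (auto simp: Kv_def)
      also have "\<dots> = K y * h (f n (\<rho> y))" by (subst sum.delta'[OF fin]) auto
      finally show ?thesis .
    qed
    have "(\<integral>\<^sup>+y. K y * indicator {y. 1 < f n (\<rho> y) * mag 0 y} y \<partial>L)
        = (\<integral>\<^sup>+y. (\<Sum>v\<in>range (f n). Kv v y * indicator {y. 1 < v * mag 0 y} y) \<partial>L)"
      using pick[of _ "\<lambda>v. indicator {y. 1 < v * mag 0 y} _"]
      by (intro nn_integral_cong) (simp add: indicator_def)
    also have "\<dots> = (\<Sum>v\<in>range (f n). \<integral>\<^sup>+y. Kv v y * indicator {y. 1 < v * mag 0 y} y \<partial>L)"
    proof (rule nn_integral_sum)
      fix v
      have [measurable]: "{y. 1 < v * mag 0 y} \<in> sets path_space"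
        by (rule sets_path_Collect) measurable
      show "(\<lambda>y. Kv v y * indicator {y. 1 < v * mag 0 y} y) \<in> borel_measurable L" by measurable
    qed
    also have "\<dots> = (\<Sum>v\<in>range (f n). \<integral>\<^sup>+y. Kv v y * min 1 v \<partial>L)"
      by (simp add: polar_const[OF Kvm Kv0] nn_integral_multc mult.commute)
    also have "\<dots> = (\<integral>\<^sup>+y. (\<Sum>v\<in>range (f n). Kv v y * min 1 v) \<partial>L)"
      by (rule nn_integral_sum[symmetric]) measurable
    also have "\<dots> = (\<integral>\<^sup>+y. K y * min 1 (f n (\<rho> y)) \<partial>L)" by (simp add: pick)
    finally show ?thesis .
  qed
  have m [measurable]: "{y. 1 < f n (\<rho> y) * mag 0 y} \<in> sets path_space" for n
    by (rule sets_path_Collect) measurable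
  have mono: "f n x \<le> f m x" if "n \<le> m" for n m x
    using f(2) that by (auto simp: incseq_def le_fun_def)
  have "(\<integral>\<^sup>+y. K y * indicator {y. 1 < \<rho> y * mag 0 y} y \<partial>L)
      = (\<integral>\<^sup>+y. (SUP n. K y * indicator {y. 1 < f n (\<rho> y) * mag 0 y} y) \<partial>L)"
  proof (rule nn_integral_cong)
    fix y
    have ex: "1 < \<rho> y * mag 0 y \<longleftrightarrow> (\<exists>n. 1 < f n (\<rho> y) * mag 0 y)"
      by (subst (1) f(3)[of "\<rho> y", symmetric]) (simp add: SUP_mult_right_ennreal less_SUP_iff)
    show "K y * indicator {y. 1 < \<rho> y * mag 0 y} y = (SUP n. K y * indicator {y. 1 < f n (\<rho> y) * mag 0 y} y)"
    proof (cases "1 < \<rho> y * mag 0 y")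
      case True
      then obtain n where n: "1 < f n (\<rho> y) * mag 0 y" using ex by blast
      have "(SUP n. K y * indicator {y. 1 < f n (\<rho> y) * mag 0 y} y) = K y"
      proof (rule antisym)
        have "K y = K y * indicator {y. 1 < f n (\<rho> y) * mag 0 y} y" using n by simp
        also have "\<dots> \<le> (SUP n. K y * indicator {y. 1 < f n (\<rho> y) * mag 0 y} y)"
          by (rule SUP_upper) simp
        finally show "K y \<le> \<dots>" .
      qed (auto intro!: SUP_least simp: indicator_def)
      with True show ?thesis by simp
    next
      case False
      then have "\<not> 1 < f n (\<rho> y) * mag 0 y" for n using ex by blast
      with False show ?thesis by simp
    qed
  qed
  also have "\<dots> = (SUP n. \<integral>\<^sup>+y. K y * indicator {y. 1 < f n (\<rho> y) * mag 0 y} y \<partial>L)"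
  proof (rule nn_integral_monotone_convergence_SUP)
    have "1 < f m (\<rho> y) * mag 0 y" if "n \<le> m" "1 < f n (\<rho> y) * mag 0 y" for n m y
      using that(2) mult_right_mono[OF mono[OF that(1)], of "mag 0 y" "\<rho> y"] by simp
    then show "incseq (\<lambda>n y. K y * indicator {y. 1 < f n (\<rho> y) * mag 0 y} y)"
      by (auto simp: incseq_def le_fun_def indicator_def)
  qed measurable
  also have "\<dots> = (SUP n. \<integral>\<^sup>+y. K y * min 1 (f n (\<rho> y)) \<partial>L)"
    by (simp only: simple)
  also have "\<dots> = (\<integral>\<^sup>+y. (SUP n. K y * min 1 (f n (\<rho> y))) \<partial>L)"
  proof (rule nn_integral_monotone_convergence_SUP[symmetric])
    show "incseq (\<lambda>n y. K y * min 1 (f n (\<rho> y)))"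
      by (auto simp: incseq_def le_fun_def intro!: mult_left_mono min.mono mono)
  qed measurable
  also have "\<dots> = (\<integral>\<^sup>+y. K y * min 1 (\<rho> y) \<partial>L)"
  proof (rule nn_integral_cong)
    fix y
    have "(SUP n. K y * min 1 (f n (\<rho> y))) = K y * min 1 (SUP n. f n (\<rho> y))"
      by (simp only: SUP_mult_left_ennreal[symmetric] inf_SUP flip: inf_min)
    then show "(SUP n. K y * min 1 (f n (\<rho> y))) = K y * min 1 (\<rho> y)" by (simp only: f(3))
  qed
  finally show ?thesis .
qed

text \<open>The time change formula. For \<open>N \<ge> 1\<close>, \<open>polar\<close> evaluates \<open>N E[K(Y); a\<^sub>i > N]\<close> to
  \<open>E[K(Y) min N (a\<^sub>i/a\<^sub>0)]\<close>, while shifting by \<open>i\<close> and rescaling to level 1 evaluates it to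
  \<open>E[K(B\<^sup>iY); N a\<^sub>-\<^sub>i > 1]\<close>. Both are monotone in \<open>N\<close>.\<close>

lemma spectral_shift:
  assumes K [measurable]: "K \<in> borel_measurable path_space" and K0: "homogeneous 0 K"
  shows "(\<integral>\<^sup>+y. K y * (mag i y / mag 0 y) \<partial>L) = (\<integral>\<^sup>+y. K (backshift i y) * indicator {y. y (- i) \<noteq> 0} y \<partial>L)"
proof -
  define N where "N n = real (Suc n)" for n
  define r where "r n = N n powr (1 / \<alpha>)" for n
  have N: "1 \<le> N n" for n by (simp add: N_def)
  have r1: "1 \<le> r n" for n using N[of n] index_pos by (simp add: r_def ge_one_powr_ge_zero)
  have r\<alpha>: "r n powr \<alpha> = N n" for n using N[of n] index_pos by (simp add: r_def powr_powr)
  have pos: "AE y in L. 0 < mag 0 y"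
    using mag_0_gt_1 by eventually_elim (rule less_trans[of 0 1], auto)
  have levels: "(\<integral>\<^sup>+y. K y * min (ennreal (N n)) (mag i y / mag 0 y) \<partial>L)
      = (\<integral>\<^sup>+y. K (backshift i y) * indicator {y. 1 < r n * nrm (y (- i))} y \<partial>L)" for n
  proof -
    let ?N = "ennreal (N n)"
    have N0: "?N \<noteq> 0" "?N \<noteq> top" using N[of n] by auto
    have m: "{y. ?N < mag i y} \<in> sets path_space" "{y. 1 < nrm (y (- i))} \<in> sets path_space"
      by (rule sets_path_Collect, measurable)+
    note m [measurable]
    have split: "min ?N (x / z) = ?N * min 1 (x / (z * ?N))" for x z
    proof -
      have "?N * (x / (z * ?N)) = x / z"
        using divide_mult_eq[of ?N x z] N0 by (simp add: ennreal_times_divide mult.commute)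
      then show ?thesis using mult_left_mono[of "x / (z * ?N)" 1 ?N] mult_left_mono[of 1 "x / (z * ?N)" ?N]
        by (auto simp: min_def)
    qed
    have "(\<integral>\<^sup>+y. K y * min ?N (mag i y / mag 0 y) \<partial>L)
        = ?N * (\<integral>\<^sup>+y. K y * min 1 (mag i y / (mag 0 y * ?N)) \<partial>L)"
      unfolding split by (subst nn_integral_cmult[symmetric]) (auto simp: ac_simps)
    also have "(\<integral>\<^sup>+y. K y * min 1 (mag i y / (mag 0 y * ?N)) \<partial>L)
        = (\<integral>\<^sup>+y. K y * indicator {y. 1 < mag i y / (mag 0 y * ?N) * mag 0 y} y \<partial>L)"
    proof (rule polar[symmetric, OF K K0])
      show "homogeneous 0 (\<lambda>y. mag i y / (mag 0 y * ?N))"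
        by (rule homogeneous_divide[OF homogeneous_mag])
           (use homogeneous_mag[of 0] in \<open>simp add: homogeneous_def mult.assoc\<close>)
    qed measurable
    also have "\<dots> = (\<integral>\<^sup>+y. K y * indicator {y. ?N < mag i y} y \<partial>L)"
    proof (rule nn_integral_cong_AE)
      show "AE y in L. K y * indicator {y. 1 < mag i y / (mag 0 y * ?N) * mag 0 y} y
          = K y * indicator {y. ?N < mag i y} y"
        using pos
      proof eventually_elim
        fix y assume "0 < mag 0 y"
        then have "mag i y / (mag 0 y * ?N) * mag 0 y = mag i y / ?N"
          using divide_mult_eq[of "mag 0 y" "mag i y" ?N] mag_finite[of 0 y]
          by (simp add: ennreal_divide_times ennreal_times_divide mult.commute)
        moreover have "1 < mag i y / ?N \<longleftrightarrow> ?N < mag i y"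
          using N[of n] by (simp add: mag_def divide_ennreal ennreal_less_iff flip: ennreal_1)
        ultimately show "K y * indicator {y. 1 < mag i y / (mag 0 y * ?N) * mag 0 y} y
            = K y * indicator {y. ?N < mag i y} y" by (simp add: indicator_def)
      qed
    qed
    also have "\<dots> = (\<integral>\<^sup>+y. K y * indicator {y. ?N < mag i y} y * indicator {y. 1 < nrm (y i)} y \<partial>L)"
    proof (rule nn_integral_cong)
      fix y
      have "1 < nrm (y i)" if "?N < mag i y"
        using that less_mag[of "r n" i y] r\<alpha>[of n] r1[of n] by simp
      then show "K y * indicator {y. ?N < mag i y} y
          = K y * indicator {y. ?N < mag i y} y * indicator {y. 1 < nrm (y i)} y"
        by (auto simp: indicator_def)
    qed
    also have "\<dots> = (\<integral>\<^sup>+y. K (backshift i y) * indicator {y. ?N < mag i y} (backshift i y)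
        * indicator {y. 1 < nrm (y (- i))} y \<partial>L)"
      by (rule shift_law) measurable
    also have "\<dots> = (\<integral>\<^sup>+y. (K (backshift i y) * indicator {y. 1 < nrm (y (- i))} y)
        * indicator {y. r n < nrm (y 0)} y \<partial>L)"
      using less_mag[of "r n" 0] r1[of n]
      by (intro nn_integral_cong) (simp add: indicator_def mag_backshift r\<alpha>)
    finally have "(\<integral>\<^sup>+y. K y * min ?N (mag i y / mag 0 y) \<partial>L)
        = ennreal (r n powr \<alpha>) * (\<integral>\<^sup>+y. (K (backshift i y) * indicator {y. 1 < nrm (y (- i))} y)
        * indicator {y. r n < nrm (y 0)} y \<partial>L)" by (simp only: r\<alpha>)
    also have "\<dots> = (\<integral>\<^sup>+y. K (backshift i (\<lambda>j. r n *\<^sub>R y j))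
        * indicator {y. 1 < nrm (y (- i))} (\<lambda>j. r n *\<^sub>R y j) \<partial>L)"
      by (rule scale_law[symmetric]) (use r1 in measurable)
    also have "\<dots> = (\<integral>\<^sup>+y. K (backshift i y) * indicator {y. 1 < r n * nrm (y (- i))} y \<partial>L)"
    proof (rule nn_integral_cong)
      fix y
      have "K (backshift i (\<lambda>j. r n *\<^sub>R y j)) = K (backshift i y)"
        using homogeneous_0_scaled[OF K0, of "r n" "backshift i y"] r1[of n] by (simp add: backshift_def)
      then show "K (backshift i (\<lambda>j. r n *\<^sub>R y j)) * indicator {y. 1 < nrm (y (- i))} (\<lambda>j. r n *\<^sub>R y j)
          = K (backshift i y) * indicator {y. 1 < r n * nrm (y (- i))} y"
        using r1[of n] by (simp add: indicator_def nrm_scale)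
    qed
    finally show ?thesis .
  qed
  have Nmono: "N n \<le> N m" if "n \<le> m" for n m using that by (simp add: N_def)
  have rmono: "r n \<le> r m" if "n \<le> m" for n m
    unfolding r_def using Nmono[OF that] N[of n] index_pos by (intro powr_mono2) auto
  have SN: "(SUP n. ennreal (N n)) = top"
  proof (rule ennreal_SUP_eq_top)
    fix n :: nat show "\<exists>i\<in>UNIV. of_nat n \<le> ennreal (N i)"
      by (intro bexI[of _ n]) (auto simp: N_def ennreal_of_nat_eq_real_of_nat intro!: ennreal_leI)
  qed
  have "(\<integral>\<^sup>+y. K y * (mag i y / mag 0 y) \<partial>L) = (\<integral>\<^sup>+y. (SUP n. K y * min (ennreal (N n)) (mag i y / mag 0 y)) \<partial>L)"
  proof (rule nn_integral_cong)
    fix y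
    have "(SUP n. K y * min (ennreal (N n)) (mag i y / mag 0 y)) = K y * min (SUP n. ennreal (N n)) (mag i y / mag 0 y)"
      by (simp only: SUP_mult_left_ennreal[symmetric] SUP_inf flip: inf_min)
    then show "K y * (mag i y / mag 0 y) = (SUP n. K y * min (ennreal (N n)) (mag i y / mag 0 y))"
      by (simp add: SN)
  qed
  also have "\<dots> = (SUP n. \<integral>\<^sup>+y. K y * min (ennreal (N n)) (mag i y / mag 0 y) \<partial>L)"
  proof (rule nn_integral_monotone_convergence_SUP)
    show "incseq (\<lambda>n y. K y * min (ennreal (N n)) (mag i y / mag 0 y))"
      by (auto simp: incseq_def le_fun_def intro!: mult_left_mono min.mono ennreal_leI Nmono)
  qed measurable
  also have "\<dots> = (SUP n. \<integral>\<^sup>+y. K (backshift i y) * indicator {y. 1 < r n * nrm (y (- i))} y \<partial>L)"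
    by (simp only: levels)
  also have "\<dots> = (\<integral>\<^sup>+y. (SUP n. K (backshift i y) * indicator {y. 1 < r n * nrm (y (- i))} y) \<partial>L)"
  proof (rule nn_integral_monotone_convergence_SUP[symmetric])
    have "1 < r m * nrm (y (- i))" if "n \<le> m" "1 < r n * nrm (y (- i))" for n m y
      using that(2) mult_right_mono[OF rmono[OF that(1)] nrm_nonneg] by (rule less_le_trans)
    then show "incseq (\<lambda>n y. K (backshift i y) * indicator {y. 1 < r n * nrm (y (- i))} y)"
      by (auto simp: incseq_def le_fun_def indicator_def)
    have [measurable]: "{y. 1 < r n * nrm (y (- i))} \<in> sets path_space" for n
      by (rule sets_path_Collect) measurable
    show "(\<lambda>y. K (backshift i y) * indicator {y. 1 < r n * nrm (y (- i))} y) \<in> borel_measurable L" for n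
      by measurable
  qed
  also have "\<dots> = (\<integral>\<^sup>+y. K (backshift i y) * indicator {y. y (- i) \<noteq> 0} y \<partial>L)"
  proof (rule nn_integral_cong)
    fix y
    show "(SUP n. K (backshift i y) * indicator {y. 1 < r n * nrm (y (- i))} y)
        = K (backshift i y) * indicator {y. y (- i) \<noteq> 0} y"
    proof (cases "y (- i) = 0")
      case True
      then show ?thesis using nrm_eq_0[of 0] by simp
    next
      case False
      then have nz: "0 < nrm (y (- i))" using nrm_nonneg[of "y (- i)"] nrm_eq_0[of "y (- i)"] by linarith
      obtain n where n: "(1 / nrm (y (- i))) powr \<alpha> < real n" using reals_Archimedean2 by blast
      have "1 / nrm (y (- i)) < r n"
      proof (rule ccontr)
        assume "\<not> ?thesis"
        then have "r n powr \<alpha> \<le> (1 / nrm (y (- i))) powr \<alpha>"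
          using r1[of n] index_pos by (intro powr_mono2) auto
        with n show False unfolding r\<alpha> by (simp add: N_def)
      qed
      then have n: "1 < r n * nrm (y (- i))" using nz by (simp add: field_simps)
      have "(SUP n. K (backshift i y) * indicator {y. 1 < r n * nrm (y (- i))} y) = K (backshift i y)"
      proof (rule antisym)
        have "K (backshift i y) = K (backshift i y) * indicator {y. 1 < r n * nrm (y (- i))} y" using n by simp
        also have "\<dots> \<le> (SUP n. K (backshift i y) * indicator {y. 1 < r n * nrm (y (- i))} y)"
          by (rule SUP_upper) simp
        finally show "K (backshift i y) \<le> \<dots>" .
      qed (auto intro!: SUP_least simp: indicator_def)
      with False show ?thesis by simp
    qed
  qed
  finally show ?thesis .
qed

end

section \<open>Mass transport\<close>

lemma ennreal_divide_mult_divide: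
  fixes x z w :: ennreal
  assumes "z \<noteq> 0" "z < \<infinity>"
  shows "(x / z) * (z / w) = x / w"
  using assms by (simp add: ennreal_times_divide ennreal_divide_times)

lemma SUP_int_shift:
  fixes f :: "int \<Rightarrow> ennreal"
  shows "(SUP k\<in>{..<i}. f (k - n)) = (SUP k\<in>{..<i - n}. f k)"
    and "(SUP k\<in>{i<..}. f (k - n)) = (SUP k\<in>{i - n<..}. f k)"
    and "(SUP k. f (k - n)) = (SUP k. f k)"
proof -
  have "(\<lambda>k. k - n) ` {..<i} = {..<i - n}" "(\<lambda>k. k - n) ` {i<..} = {i - n<..}" "range (\<lambda>k. k - n) = UNIV"
    by (auto intro!: image_eqI[where x = "_ + n"])
  then show "(SUP k\<in>{..<i}. f (k - n)) = (SUP k\<in>{..<i - n}. f k)"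
    "(SUP k\<in>{i<..}. f (k - n)) = (SUP k\<in>{i - n<..}. f k)" "(SUP k. f (k - n)) = (SUP k. f k)"
    by (metis image_image)+
qed

context tail_law
begin

text \<open>Apply the time change to \<open>m(0,j,y)/a\<^sub>j\<close>, which has degree 0: the mass sent from 0 to \<open>j\<close> becomes the
  mass sent from \<open>-j\<close> to 0.\<close>

lemma mass_transport:
  fixes m :: "int \<Rightarrow> int \<Rightarrow> (int \<Rightarrow> real ^ 'd) \<Rightarrow> ennreal"
  assumes [measurable]: "\<And>i j. m i j \<in> borel_measurable path_space"
    and equiv: "\<And>i j k y. m i j (backshift k y) = m (i - k) (j - k) y"
    and hom: "\<And>i j. homogeneous \<alpha> (m i j)"
    and zero: "\<And>i j y. y i = 0 \<or> y j = 0 \<Longrightarrow> m i j y = 0"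
  shows "(\<integral>\<^sup>+y. (\<integral>\<^sup>+j. m 0 j y \<partial>count_space UNIV) / mag 0 y \<partial>L)
    = (\<integral>\<^sup>+y. (\<integral>\<^sup>+i. m i 0 y \<partial>count_space UNIV) / mag 0 y \<partial>L)"
proof -
  have single: "(\<integral>\<^sup>+y. m 0 j y / mag 0 y \<partial>L) = (\<integral>\<^sup>+y. m (- j) 0 y / mag 0 y \<partial>L)" for j
  proof -
    have "(\<integral>\<^sup>+y. m 0 j y / mag 0 y \<partial>L) = (\<integral>\<^sup>+y. (m 0 j y / mag j y) * (mag j y / mag 0 y) \<partial>L)"
    proof (rule nn_integral_cong)
      fix y
      show "m 0 j y / mag 0 y = (m 0 j y / mag j y) * (mag j y / mag 0 y)"
      proof (cases "y j = 0")
        case True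
        then show ?thesis using zero[of y 0 j] by simp
      next
        case False
        then show ?thesis using mag_eq_0[of j y] mag_finite[of j y] by (simp add: ennreal_divide_mult_divide)
      qed
    qed
    also have "\<dots> = (\<integral>\<^sup>+y. (m 0 j (backshift j y) / mag j (backshift j y)) * indicator {y. y (- j) \<noteq> 0} y \<partial>L)"
      by (rule spectral_shift) (auto intro!: homogeneous_divide hom homogeneous_mag)
    also have "\<dots> = (\<integral>\<^sup>+y. m (- j) 0 y / mag 0 y \<partial>L)"
      using zero[of _ "- j" 0] by (intro nn_integral_cong) (auto simp: equiv mag_backshift indicator_def)
    finally show ?thesis .
  qed
  have pull: "(\<integral>\<^sup>+y. (\<integral>\<^sup>+j. f j y \<partial>count_space UNIV) / mag 0 y \<partial>L)
      = (\<integral>\<^sup>+j. (\<integral>\<^sup>+y. f j y / mag 0 y \<partial>L) \<partial>count_space UNIV)"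
    if [measurable]: "\<And>j. f j \<in> borel_measurable path_space" for f :: "int \<Rightarrow> _ \<Rightarrow> ennreal"
  proof -
    have "(\<integral>\<^sup>+y. (\<integral>\<^sup>+j. f j y \<partial>count_space UNIV) / mag 0 y \<partial>L)
        = (\<integral>\<^sup>+y. (\<integral>\<^sup>+j. f j y / mag 0 y \<partial>count_space UNIV) \<partial>L)"
      by (simp add: nn_integral_divide)
    also have "\<dots> = (\<integral>\<^sup>+j. (\<integral>\<^sup>+y. f j y / mag 0 y \<partial>L) \<partial>count_space UNIV)"
      by (rule nn_integral_count_space_nn_integral) auto
    finally show ?thesis .
  qed
  have "(\<integral>\<^sup>+y. (\<integral>\<^sup>+j. m 0 j y \<partial>count_space UNIV) / mag 0 y \<partial>L)
      = (\<integral>\<^sup>+j. (\<integral>\<^sup>+y. m (- j) 0 y / mag 0 y \<partial>L) \<partial>count_space UNIV)"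
    by (subst pull) (simp_all only: single, measurable)
  also have "\<dots> = (\<integral>\<^sup>+i. (\<integral>\<^sup>+y. m i 0 y / mag 0 y \<partial>L) \<partial>count_space UNIV)"
    by (rule nn_integral_int_reflect)
  also have "\<dots> = (\<integral>\<^sup>+y. (\<integral>\<^sup>+i. m i 0 y \<partial>count_space UNIV) / mag 0 y \<partial>L)"
    by (rule pull[symmetric]) measurable
  finally show ?thesis .
qed

definition peak :: "(int \<Rightarrow> real ^ 'd) \<Rightarrow> ennreal" where
  "peak y = (SUP i. mag i y)"

text \<open>The subtraction is truncated at 0. Because \<open>mag i y\<close> is finite, the difference also vanishes when the
  supremum is infinite; in particular it vanishes whenever \<open>y\<^sub>i = 0\<close>.\<close>

definition rise :: "int \<Rightarrow> (int \<Rightarrow> real ^ 'd) \<Rightarrow> ennreal" where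
  "rise i y = mag i y - (SUP k\<in>{..<i}. mag k y)"

definition drop_after :: "int \<Rightarrow> (int \<Rightarrow> real ^ 'd) \<Rightarrow> ennreal" where
  "drop_after i y = mag i y - (SUP k\<in>{i<..}. mag k y)"

lemma measurable_peak_rise [measurable]:
  "peak \<in> borel_measurable path_space" "rise i \<in> borel_measurable path_space"
  "drop_after i \<in> borel_measurable path_space"
  unfolding peak_def[abs_def] rise_def[abs_def] drop_after_def[abs_def] by measurable

lemma homogeneous_peak_rise:
  "homogeneous \<alpha> peak" "homogeneous \<alpha> (rise i)" "homogeneous \<alpha> (drop_after i)"
  unfolding peak_def[abs_def] rise_def[abs_def] drop_after_def[abs_def]
  by (intro homogeneous_SUP homogeneous_diff homogeneous_mag)+

lemma backshift_peak_rise: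
  "peak (backshift k y) = peak y" "rise i (backshift k y) = rise (i - k) y"
  "drop_after i (backshift k y) = drop_after (i - k) y"
  unfolding peak_def rise_def drop_after_def mag_backshift
  by (simp_all only: SUP_int_shift[where f = "\<lambda>k. mag k y"])

lemma rise_at_zero: "y i = 0 \<Longrightarrow> rise i y = 0" "y i = 0 \<Longrightarrow> drop_after i y = 0"
  using mag_eq_0[of i y] by (simp_all add: rise_def drop_after_def)

lemma mag_small:
  assumes "((\<lambda>k. nrm (y k)) \<longlongrightarrow> 0) F" "0 < e"
  shows "eventually (\<lambda>k. mag k y \<le> ennreal e) F"
proof -
  have "eventually (\<lambda>k. nrm (y k) < e powr (1 / \<alpha>)) F"
    using assms by (intro order_tendstoD) auto
  then show ?thesis
  proof eventually_elim
    fix k assume "nrm (y k) < e powr (1 / \<alpha>)"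
    then have "nrm (y k) powr \<alpha> \<le> (e powr (1 / \<alpha>)) powr \<alpha>"
      using index_pos nrm_nonneg by (intro powr_mono2) auto
    then show "mag k y \<le> ennreal e"
      using assms(2) index_pos by (simp add: mag_def powr_powr)
  qed
qed

definition tame :: "(int \<Rightarrow> real ^ 'd) \<Rightarrow> bool" where
  "tame y \<longleftrightarrow> 0 < mag 0 y \<and> 0 < peak y \<and> peak y < \<infinity>
    \<and> (\<integral>\<^sup>+i. rise i y \<partial>count_space UNIV) = peak y
    \<and> (\<integral>\<^sup>+i. drop_after i y \<partial>count_space UNIV) = peak y"

lemma tame_simps:
  assumes "tame y"
  shows "mag 0 y \<noteq> 0" "mag 0 y \<noteq> top" "mag 0 y / mag 0 y = 1"
    "peak y \<noteq> 0" "peak y \<noteq> top" "peak y / peak y = 1"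
    "(\<integral>\<^sup>+i. rise i y \<partial>count_space UNIV) = peak y"
    "(\<integral>\<^sup>+i. drop_after i y \<partial>count_space UNIV) = peak y"
  using assms mag_finite[of 0 y] by (auto simp: tame_def intro!: ennreal_divide_self)

text \<open>A path that vanishes at infinity has only finitely many coordinates of norm at least 1, and its
  records from either end climb from 0 to the peak.\<close>

lemma AE_tame:
  "AE y in L. tame y"
  using mag_0_gt_1 vanishes
proof eventually_elim
  fix y assume m0: "1 < mag 0 y"
    and v: "((\<lambda>k. nrm (y k)) \<longlongrightarrow> 0) at_top \<and> ((\<lambda>k. nrm (y k)) \<longlongrightarrow> 0) at_bot"
  have right: "\<exists>n. \<forall>k>n. mag k y \<le> ennreal e" if "e > 0" for e
  proof -
    from mag_small[OF conjunct1[OF v] that] show ?thesis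
      unfolding eventually_at_top_linorder by (meson less_imp_le)
  qed
  have left: "\<exists>n. \<forall>k<n. mag k y \<le> ennreal e" if "e > 0" for e
  proof -
    from mag_small[OF conjunct2[OF v] that] show ?thesis
      unfolding eventually_at_bot_linorder by (meson less_imp_le)
  qed
  from right[of 1] obtain r where r: "\<forall>k>r. mag k y \<le> ennreal 1" by auto
  from left[of 1] obtain l where l: "\<forall>k<l. mag k y \<le> ennreal 1" by auto
  have "peak y \<le> 1 + (\<Sum>k\<in>{l..r}. mag k y)"
    unfolding peak_def
  proof (rule SUP_least)
    fix k
    show "mag k y \<le> 1 + (\<Sum>k\<in>{l..r}. mag k y)"
    proof (cases "k \<in> {l..r}")
      case True
      then have "mag k y \<le> (\<Sum>k\<in>{l..r}. mag k y)" by (intro member_le_sum) auto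
      then show ?thesis by (rule add_increasing[rotated]) simp
    next
      case False
      then have "mag k y \<le> 1" using l r by auto
      then show ?thesis by (rule add_increasing2[rotated]) simp
    qed
  qed
  also have "\<dots> < \<infinity>" by (simp add: mag_def sum_ennreal)
  finally have "peak y < \<infinity>" .
  moreover have p: "0 < mag 0 y" using less_trans[of 0 1, OF _ m0] by simp
  moreover have "0 < peak y"
  proof -
    have "mag 0 y \<le> peak y" unfolding peak_def by (rule SUP_upper) simp
    with p show ?thesis by (rule less_le_trans)
  qed
  moreover have "(\<integral>\<^sup>+i. rise i y \<partial>count_space UNIV) = peak y"
    unfolding rise_def peak_def using left by (rule sum_record_increments)
  moreover have "(\<integral>\<^sup>+i. drop_after i y \<partial>count_space UNIV) = peak y"
    unfolding drop_after_def peak_def using right by (rule sum_reverse_record_increments)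
  ultimately show "tame y" unfolding tame_def by blast
qed

text \<open>Let the position \<open>i\<close> send the fraction \<open>rise i / peak\<close> of \<open>v\<^sub>j\<close> to every \<open>j\<close>. These fractions add up to
  1, so the position 0 receives \<open>v\<^sub>0\<close>.\<close>

lemma anchored_transport:
  assumes [measurable]: "\<And>i. v i \<in> borel_measurable path_space"
    and equiv: "\<And>i k y. v i (backshift k y) = v (i - k) y"
    and hom: "\<And>i. homogeneous \<alpha> (v i)"
    and zero: "\<And>i y. y i = 0 \<Longrightarrow> v i y = 0"
  shows "(\<integral>\<^sup>+y. rise 0 y / mag 0 y * ((\<integral>\<^sup>+j. v j y \<partial>count_space UNIV) / peak y) \<partial>L)
    = (\<integral>\<^sup>+y. v 0 y / mag 0 y \<partial>L)"
proof -
  define m where "m i j y = rise i y / peak y * v j y" for i j y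
  have "(\<integral>\<^sup>+y. rise 0 y / mag 0 y * ((\<integral>\<^sup>+j. v j y \<partial>count_space UNIV) / peak y) \<partial>L)
      = (\<integral>\<^sup>+y. (\<integral>\<^sup>+j. m 0 j y \<partial>count_space UNIV) / mag 0 y \<partial>L)"
  proof (rule nn_integral_cong)
    fix y
    have "(\<integral>\<^sup>+j. m 0 j y \<partial>count_space UNIV) = rise 0 y / peak y * (\<integral>\<^sup>+j. v j y \<partial>count_space UNIV)"
      by (simp add: m_def nn_integral_cmult)
    then show "rise 0 y / mag 0 y * ((\<integral>\<^sup>+j. v j y \<partial>count_space UNIV) / peak y)
        = (\<integral>\<^sup>+j. m 0 j y \<partial>count_space UNIV) / mag 0 y"
      by (simp add: divide_ennreal_def ac_simps)
  qed
  also have "\<dots> = (\<integral>\<^sup>+y. (\<integral>\<^sup>+i. m i 0 y \<partial>count_space UNIV) / mag 0 y \<partial>L)"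
  proof (rule mass_transport)
    show "homogeneous \<alpha> (m i j)" for i j
      using homogeneous_mult[OF homogeneous_divide[OF homogeneous_peak_rise(2) homogeneous_peak_rise(1)] hom]
      unfolding m_def[abs_def] by simp
    show "m i j (backshift k y) = m (i - k) (j - k) y" for i j k y
      by (simp add: m_def backshift_peak_rise equiv)
    show "m i j y = 0" if "y i = 0 \<or> y j = 0" for i j y
      using that by (auto simp: m_def rise_at_zero zero)
  qed (simp add: m_def[abs_def])
  also have "\<dots> = (\<integral>\<^sup>+y. v 0 y / mag 0 y \<partial>L)"
  proof (rule nn_integral_cong_AE)
    show "AE y in L. (\<integral>\<^sup>+i. m i 0 y \<partial>count_space UNIV) / mag 0 y = v 0 y / mag 0 y"
      using AE_tame
    proof eventually_elim
      fix y assume *: "tame y"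
      then show "(\<integral>\<^sup>+i. m i 0 y \<partial>count_space UNIV) / mag 0 y = v 0 y / mag 0 y"
        by (simp add: m_def nn_integral_multc nn_integral_divide tame_simps)
    qed
  qed
  finally show ?thesis .
qed

lemma one_minus_min_divide:
  fixes m s :: ennreal
  assumes "0 < m" "m < \<infinity>"
  shows "1 - min 1 (s / m) = (m - s) / m"
proof -
  from assms obtain p where p: "m = ennreal p" "p > 0" by (cases m rule: ennreal_cases) auto
  show ?thesis
  proof (cases s rule: ennreal_cases)
    case (real q)
    then have sm: "s / m = ennreal (q / p)" using p by (simp add: divide_ennreal)
    show ?thesis
    proof (cases "q \<le> p")
      case True
      then have "s / m \<le> 1" using p sm real by (simp flip: ennreal_1)
      then have "1 - min 1 (s / m) = ennreal (1 - q / p)"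
        using sm real p by (simp add: min_absorb2 ennreal_minus flip: ennreal_1)
      also have "1 - q / p = (p - q) / p" using p by (simp add: field_simps)
      also have "ennreal ((p - q) / p) = (m - s) / m"
        using True real p by (simp add: ennreal_minus divide_ennreal)
      finally show ?thesis .
    next
      case False
      then have "1 \<le> s / m" using p sm real by (simp flip: ennreal_1)
      moreover have "m - s = 0" using False p real by (simp add: ennreal_minus ennreal_neg)
      ultimately show ?thesis by (simp add: min_absorb1)
    qed
  next
    case top
    then show ?thesis using p by (simp add: ennreal_top_divide)
  qed
qed

text \<open>This complements \<open>polar\<close> with \<open>\<rho> = (sup\<^sub>J a)/a\<^sub>0\<close>. Subtracting requires a finite integral of \<open>K\<close>, which
  truncation provides.\<close>

lemma no_exceedance:
  assumes K [measurable]: "K \<in> borel_measurable path_space" and K0: "homogeneous 0 K"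
  shows "(\<integral>\<^sup>+y. K y * indicator {y. \<forall>k\<in>J. nrm (y k) \<le> 1} y \<partial>L)
    = (\<integral>\<^sup>+y. K y * ((mag 0 y - (SUP k\<in>J. mag k y)) / mag 0 y) \<partial>L)"
proof -
  define \<rho> where "\<rho> y = (SUP k\<in>J. mag k y) / mag 0 y" for y
  have [measurable]: "\<rho> \<in> borel_measurable path_space" unfolding \<rho>_def by measurable
  have \<rho>0: "homogeneous 0 \<rho>"
    unfolding \<rho>_def by (intro homogeneous_divide[where p = \<alpha>] homogeneous_SUP homogeneous_mag)
  define A where "A = {y. 1 < \<rho> y * mag 0 y}"
  have [measurable]: "A \<in> sets path_space" unfolding A_def by (rule sets_path_Collect) measurable
  have bounded: "(\<integral>\<^sup>+y. G y * indicator (- A) y \<partial>L) = (\<integral>\<^sup>+y. G y * (1 - min 1 (\<rho> y)) \<partial>L)"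
    if [measurable]: "G \<in> borel_measurable path_space" and G0: "homogeneous 0 G"
      and fin: "(\<integral>\<^sup>+y. G y \<partial>L) < \<infinity>" for G
  proof -
    have "- A \<in> sets path_space" using sets.compl_sets[of A path_space] by (simp add: Compl_eq_Diff_UNIV)
    note this [measurable]
    have "(\<integral>\<^sup>+y. G y * indicator A y \<partial>L) + (\<integral>\<^sup>+y. G y * indicator (- A) y \<partial>L) = (\<integral>\<^sup>+y. G y \<partial>L)"
      by (subst nn_integral_add[symmetric]) (auto intro!: nn_integral_cong simp: indicator_def)
    also have "\<dots> = (\<integral>\<^sup>+y. G y * min 1 (\<rho> y) + G y * (1 - min 1 (\<rho> y)) \<partial>L)"
      by (intro nn_integral_cong) (simp add: add_diff_inverse_ennreal flip: distrib_left)
    also have "\<dots> = (\<integral>\<^sup>+y. G y * min 1 (\<rho> y) \<partial>L) + (\<integral>\<^sup>+y. G y * (1 - min 1 (\<rho> y)) \<partial>L)"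
      by (rule nn_integral_add) measurable
    also have "(\<integral>\<^sup>+y. G y * min 1 (\<rho> y) \<partial>L) = (\<integral>\<^sup>+y. G y * indicator A y \<partial>L)"
      unfolding A_def by (rule polar[symmetric, OF _ G0 _ \<rho>0]) measurable
    finally have eq: "(\<integral>\<^sup>+y. G y * indicator A y \<partial>L) + (\<integral>\<^sup>+y. G y * indicator (- A) y \<partial>L)
      = (\<integral>\<^sup>+y. G y * indicator A y \<partial>L) + (\<integral>\<^sup>+y. G y * (1 - min 1 (\<rho> y)) \<partial>L)" .
    have "(\<integral>\<^sup>+y. G y * indicator A y \<partial>L) \<le> (\<integral>\<^sup>+y. G y \<partial>L)"
      by (rule nn_integral_mono) (simp add: indicator_def)
    then have "(\<integral>\<^sup>+y. G y * indicator A y \<partial>L) \<noteq> top" using fin by (auto simp: top_unique)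
    with eq show ?thesis by (simp add: ennreal_add_left_cancel)
  qed
  have trunc: "(\<integral>\<^sup>+y. K y * W y \<partial>L) = (SUP n. \<integral>\<^sup>+y. min (of_nat n) (K y) * W y \<partial>L)"
    if [measurable]: "W \<in> borel_measurable path_space" for W :: "_ \<Rightarrow> ennreal"
  proof -
    have "K y * W y = (SUP n. min (of_nat n) (K y) * W y)" for y
    proof -
      have "(SUP n. min (of_nat n) (K y)) = min (SUP n. of_nat n) (K y)"
        by (simp only: SUP_inf flip: inf_min)
      also have "\<dots> = K y" by (simp add: ennreal_SUP_of_nat_eq_top)
      finally show ?thesis by (simp flip: SUP_mult_right_ennreal)
    qed
    then have "(\<integral>\<^sup>+y. K y * W y \<partial>L) = (\<integral>\<^sup>+y. (SUP n. min (of_nat n) (K y) * W y) \<partial>L)" by simp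
    also have "\<dots> = (SUP n. \<integral>\<^sup>+y. min (of_nat n) (K y) * W y \<partial>L)"
      by (rule nn_integral_monotone_convergence_SUP)
         (auto simp: incseq_def le_fun_def intro!: mult_right_mono min.mono)
    finally show ?thesis .
  qed
  have "- A \<in> sets path_space" using sets.compl_sets[of A path_space] by (simp add: Compl_eq_Diff_UNIV)
  note this [measurable]
  have "(\<integral>\<^sup>+y. K y * indicator (- A) y \<partial>L) = (\<integral>\<^sup>+y. K y * (1 - min 1 (\<rho> y)) \<partial>L)"
  proof -
    have "(\<integral>\<^sup>+y. min (of_nat n) (K y) * indicator (- A) y \<partial>L)
        = (\<integral>\<^sup>+y. min (of_nat n) (K y) * (1 - min 1 (\<rho> y)) \<partial>L)" for n
    proof (rule bounded)
      have "(\<integral>\<^sup>+y. min (of_nat n) (K y) \<partial>L) \<le> (\<integral>\<^sup>+y. of_nat n \<partial>L)" by (rule nn_integral_mono) simp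
      also have "\<dots> < \<infinity>" by (simp add: emeasure_space_1[simplified] of_nat_less_top)
      finally show "(\<integral>\<^sup>+y. min (of_nat n) (K y) \<partial>L) < \<infinity>" .
      show "homogeneous 0 (\<lambda>y. min (of_nat n) (K y))" using K0 by (rule homogeneous_0_compose)
    qed measurable
    then show ?thesis by (subst (1 2) trunc) simp_all
  qed
  moreover have "(\<integral>\<^sup>+y. K y * indicator {y. \<forall>k\<in>J. nrm (y k) \<le> 1} y \<partial>L) = (\<integral>\<^sup>+y. K y * indicator (- A) y \<partial>L)"
  proof (rule nn_integral_cong_AE)
    show "AE y in L. K y * indicator {y. \<forall>k\<in>J. nrm (y k) \<le> 1} y = K y * indicator (- A) y"
      using AE_tame
    proof eventually_elim
      fix y assume *: "tame y"
      then have "\<rho> y * mag 0 y = (SUP k\<in>J. mag k y)"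
        by (simp add: \<rho>_def ennreal_divide_times tame_simps)
      then have "y \<in> A \<longleftrightarrow> (\<exists>k\<in>J. 1 < mag k y)" by (simp add: A_def less_SUP_iff)
      also have "\<dots> \<longleftrightarrow> (\<exists>k\<in>J. 1 < nrm (y k))" using less_mag[of 1] by simp
      finally show "K y * indicator {y. \<forall>k\<in>J. nrm (y k) \<le> 1} y = K y * indicator (- A) y"
        by (auto simp: indicator_def not_le)
    qed
  qed
  moreover have "(\<integral>\<^sup>+y. K y * ((mag 0 y - (SUP k\<in>J. mag k y)) / mag 0 y) \<partial>L) = (\<integral>\<^sup>+y. K y * (1 - min 1 (\<rho> y)) \<partial>L)"
  proof (rule nn_integral_cong_AE)
    show "AE y in L. K y * ((mag 0 y - (SUP k\<in>J. mag k y)) / mag 0 y) = K y * (1 - min 1 (\<rho> y))"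
      using AE_tame by eventually_elim (simp only: \<rho>_def one_minus_min_divide mag_finite tame_def)
  qed
  ultimately show ?thesis by simp
qed

end

section \<open>Moments of clusters and of the spectral tail process\<close>

context tail_law
begin

definition size_at :: "int \<Rightarrow> (int \<Rightarrow> real ^ 'd) \<Rightarrow> ennreal" where
  "size_at i y = ennreal (nrm (y i))"

definition mass :: "int set \<Rightarrow> (int \<Rightarrow> real ^ 'd) \<Rightarrow> ennreal" where
  "mass J y = (\<integral>\<^sup>+i. size_at i y \<partial>count_space J)"

definition mag_sum :: "(int \<Rightarrow> real ^ 'd) \<Rightarrow> ennreal" where
  "mag_sum y = (\<integral>\<^sup>+i. mag i y \<partial>count_space UNIV)"

lemma measurable_mass [measurable]:
  "size_at i \<in> borel_measurable path_space" "mass J \<in> borel_measurable path_space"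
  "mag_sum \<in> borel_measurable path_space"
  unfolding size_at_def[abs_def] mass_def[abs_def] mag_sum_def[abs_def] by measurable

lemma homogeneous_mass:
  "homogeneous 1 (size_at i)" "homogeneous 1 (mass J)" "homogeneous \<alpha> mag_sum"
proof -
  show "homogeneous 1 (size_at i)" for i
    by (simp add: homogeneous_def size_at_def nrm_scale nrm_nonneg ennreal_mult)
  then show "homogeneous 1 (mass J)" unfolding mass_def[abs_def] by (rule homogeneous_sum)
  show "homogeneous \<alpha> mag_sum" unfolding mag_sum_def[abs_def] by (intro homogeneous_sum homogeneous_mag)
qed

lemma size_at_backshift: "size_at i (backshift k y) = size_at (i - k) y"
  by (simp add: size_at_def backshift_def)

lemma mass_backshift:
  "mass UNIV (backshift k y) = mass UNIV y" "mass {i..} (backshift k y) = mass {i - k..} y"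
  "mag_sum (backshift k y) = mag_sum y"
proof -
  show "mass UNIV (backshift k y) = mass UNIV y"
    unfolding mass_def size_at_backshift by (rule nn_integral_int_shift)
  show "mag_sum (backshift k y) = mag_sum y"
    unfolding mag_sum_def mag_backshift by (rule nn_integral_int_shift)
  have "bij_betw (\<lambda>j. j - k) {i..} {i - k..}"
    by (rule bij_betwI[of _ _ _ "\<lambda>j. j + k"]) auto
  then show "mass {i..} (backshift k y) = mass {i - k..} y"
    unfolding mass_def size_at_backshift by (rule nn_integral_bij_count_space)
qed

lemma size_at_eq_0: "size_at i y = 0 \<longleftrightarrow> y i = 0"
  using nrm_nonneg[of "y i"] by (auto simp: size_at_def ennreal_eq_0_iff nrm_eq_0[symmetric])

lemma mag_sum_transport:
  "(\<integral>\<^sup>+y. rise 0 y / mag 0 y * (mag_sum y / peak y) \<partial>L) = 1"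
proof -
  have "(\<integral>\<^sup>+y. rise 0 y / mag 0 y * (mag_sum y / peak y) \<partial>L) = (\<integral>\<^sup>+y. mag 0 y / mag 0 y \<partial>L)"
    unfolding mag_sum_def
    by (rule anchored_transport) (auto simp: mag_backshift mag_eq_0 intro: homogeneous_mag)
  also have "\<dots> = (\<integral>\<^sup>+y. 1 \<partial>L)"
    by (rule nn_integral_cong_AE)
       (use AE_tame in eventually_elim, simp add: tame_simps)
  also have "\<dots> = 1" using emeasure_space_1 by simp
  finally show ?thesis .
qed

text \<open>On the event \<open>B\<close> that the sum is infinite, transporting \<open>v\<^sub>j = a\<^sub>j\<close> would require an infinite integrand
  wherever \<open>rise 0\<close> is positive; as the integral is 1, \<open>rise 0\<close> vanishes on \<open>B\<close>. Transporting \<open>a\<^sub>j 1\<^sub>B\<close>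
  then gives \<open>P(B) = 0\<close>.\<close>

lemma mag_sum_finite: "AE y in L. mag_sum y < \<infinity>"
proof -
  define B where "B = {y. mag_sum y = \<infinity>}"
  have Bm [measurable]: "B \<in> sets path_space" unfolding B_def by (rule sets_path_Collect) measurable
  have scale: "(\<lambda>j. c *\<^sub>R y j) \<in> B \<longleftrightarrow> y \<in> B" if "c > 0" for c y
    using that homogeneous_scaled[OF homogeneous_mass(3) that] by (simp add: B_def ennreal_mult_eq_top_iff)
  have "AE y in L. rise 0 y / mag 0 y * (mag_sum y / peak y) \<noteq> \<infinity>"
    by (rule nn_integral_PInf_AE) (use mag_sum_transport in auto)
  moreover note AE_tame
  ultimately have "AE y in L. rise 0 y / mag 0 y * ((\<integral>\<^sup>+j. mag j y * indicator B y \<partial>count_space UNIV) / peak y) = 0"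
  proof eventually_elim
    fix y assume fin: "rise 0 y / mag 0 y * (mag_sum y / peak y) \<noteq> \<infinity>"
      and *: "tame y"
    show "rise 0 y / mag 0 y * ((\<integral>\<^sup>+j. mag j y * indicator B y \<partial>count_space UNIV) / peak y) = 0"
    proof (cases "y \<in> B")
      case True
      then have "mag_sum y / peak y = \<infinity>"
        using * by (simp add: B_def ennreal_divide_eq_top_iff tame_simps)
      with fin have "rise 0 y / mag 0 y = 0" by (auto simp: ennreal_mult_top split: if_splits)
      then show ?thesis by simp
    qed simp
  qed
  then have "(\<integral>\<^sup>+y. rise 0 y / mag 0 y * ((\<integral>\<^sup>+j. mag j y * indicator B y \<partial>count_space UNIV) / peak y) \<partial>L)
      = (\<integral>\<^sup>+y. 0 \<partial>L)" by (rule nn_integral_cong_AE)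
  moreover have "(\<integral>\<^sup>+y. rise 0 y / mag 0 y * ((\<integral>\<^sup>+j. mag j y * indicator B y \<partial>count_space UNIV) / peak y) \<partial>L)
      = (\<integral>\<^sup>+y. mag 0 y * indicator B y / mag 0 y \<partial>L)"
  proof (rule anchored_transport)
    show "homogeneous \<alpha> (\<lambda>y. mag i y * indicator B y)" for i
      using homogeneous_scaled[OF homogeneous_mag, of _ i]
      by (simp add: homogeneous_def indicator_def scale mult.assoc)
    show "mag i (backshift k y) * indicator B (backshift k y) = mag (i - k) y * indicator B y" for i k y
      by (simp add: mag_backshift B_def mass_backshift indicator_def)
    show "mag i y * indicator B y = 0" if "y i = 0" for i y using that by (simp add: mag_eq_0)
  qed measurable
  ultimately have "(\<integral>\<^sup>+y. mag 0 y * indicator B y / mag 0 y \<partial>L) = 0" by simp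
  then have "AE y in L. mag 0 y * indicator B y / mag 0 y = 0"
    by (subst (asm) nn_integral_0_iff_AE) auto
  with AE_tame show ?thesis
  proof eventually_elim
    fix y assume "tame y" "mag 0 y * indicator B y / mag 0 y = 0"
    then have "y \<notin> B" by (auto simp: tame_simps)
    then show "mag_sum y < \<infinity>" by (simp add: B_def less_top)
  qed
qed

lemma size_at_le: "size_at i y \<le> ennreal b \<longleftrightarrow> mag i y \<le> ennreal (b powr \<alpha>)" if "0 \<le> b"
  using less_mag[OF that, of i y] that by (auto simp: size_at_def not_less[symmetric] ennreal_less_iff)

lemma peak_eq_powr_SUP_size:
  assumes "peak y < \<infinity>"
  obtains q where "0 \<le> q" "peak y = ennreal (q powr \<alpha>)" "(SUP i. size_at i y) = ennreal q"
proof -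
  from assms obtain p where p: "peak y = ennreal p" "0 \<le> p" by (cases "peak y" rule: ennreal_cases) auto
  define q where "q = p powr (1 / \<alpha>)"
  have q: "0 \<le> q" "q powr \<alpha> = p" using p index_pos by (auto simp: q_def powr_powr)
  have "size_at i y \<le> ennreal q" for i
    unfolding size_at_le[OF q(1)] q(2) p(1)[symmetric] peak_def by (rule SUP_upper) simp
  then have le: "(SUP i. size_at i y) \<le> ennreal q" by (rule SUP_least)
  then obtain s where s: "(SUP i. size_at i y) = ennreal s" "0 \<le> s"
    by (cases "SUP i. size_at i y" rule: ennreal_cases) (auto simp: top_unique)
  have "mag i y \<le> ennreal (s powr \<alpha>)" for i
    unfolding size_at_le[OF s(2), symmetric] s(1)[symmetric] by (rule SUP_upper) simp
  then have "peak y \<le> ennreal (s powr \<alpha>)" unfolding peak_def by (rule SUP_least)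
  then have "q powr \<alpha> \<le> s powr \<alpha>" using p q by (simp add: ennreal_le_iff)
  then have "q \<le> s" using index_pos q s powr_less_mono2[of \<alpha> s q] by (auto simp: not_le[symmetric])
  moreover have "s \<le> q" using le s q by (simp add: ennreal_le_iff)
  ultimately show thesis using s p q by (intro that[of q]) auto
qed

text \<open>With \<open>q = sup |y\<^sub>i|\<close> one has \<open>|y\<^sub>i| \<le> q\<^sup>1\<^sup>-\<^sup>\<alpha> |y\<^sub>i|\<^sup>\<alpha>\<close>.\<close>

lemma mass_finite:
  assumes "\<alpha> \<le> 1"
  shows "AE y in L. mass UNIV y < \<infinity>"
  using AE_tame mag_sum_finite
proof eventually_elim
  fix y assume *: "tame y"
    and fin: "mag_sum y < \<infinity>"
  then obtain q where q: "0 \<le> q" "(SUP i. size_at i y) = ennreal q"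
    using peak_eq_powr_SUP_size[of y] by (metis tame_def)
  have "size_at i y \<le> ennreal (q powr (1 - \<alpha>)) * mag i y" for i
  proof -
    have "size_at i y \<le> ennreal q" unfolding q(2)[symmetric] by (rule SUP_upper) simp
    then have le: "nrm (y i) \<le> q" using q(1) by (simp add: size_at_def)
    have "nrm (y i) \<le> q powr (1 - \<alpha>) * nrm (y i) powr \<alpha>"
    proof (cases "nrm (y i) = 0")
      case False
      then have "nrm (y i) = nrm (y i) powr (1 - \<alpha>) * nrm (y i) powr \<alpha>"
        using nrm_nonneg[of "y i"] by (simp flip: powr_add)
      also have "\<dots> \<le> q powr (1 - \<alpha>) * nrm (y i) powr \<alpha>"
        using le assms nrm_nonneg by (intro mult_right_mono powr_mono2) auto
      finally show ?thesis .
    qed simp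
    then show ?thesis by (simp add: size_at_def mag_def flip: ennreal_mult) 
  qed
  then have "mass UNIV y \<le> (\<integral>\<^sup>+i. ennreal (q powr (1 - \<alpha>)) * mag i y \<partial>count_space UNIV)"
    unfolding mass_def by (intro nn_integral_mono) auto
  also have "\<dots> = ennreal (q powr (1 - \<alpha>)) * mag_sum y"
    by (simp add: nn_integral_cmult mag_sum_def)
  also have "\<dots> < \<infinity>" using fin by (simp add: ennreal_mult_less_top)
  finally show "mass UNIV y < \<infinity>" .
qed

definition spectral_moment :: "int set \<Rightarrow> ennreal" where
  "spectral_moment J = (\<integral>\<^sup>+y. ennreal_powr (mass J (\<lambda>j. y j /\<^sub>R nrm (y 0))) (\<alpha> - 1) \<partial>L)"

lemma spectral_moment_eq:
  "spectral_moment J = (\<integral>\<^sup>+y. size_at 0 y * ennreal_powr (mass J y) (\<alpha> - 1) / mag 0 y \<partial>L)"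
  unfolding spectral_moment_def
proof (rule nn_integral_cong_AE)
  show "AE y in L. ennreal_powr (mass J (\<lambda>j. y j /\<^sub>R nrm (y 0))) (\<alpha> - 1)
      = size_at 0 y * ennreal_powr (mass J y) (\<alpha> - 1) / mag 0 y"
    using exceeds
  proof eventually_elim
    fix y :: "int \<Rightarrow> real ^ 'd" assume n: "1 < nrm (y 0)"
    define n0 where "n0 = nrm (y 0)"
    have n0: "n0 > 0" using n by (simp add: n0_def)
    have "mass J (\<lambda>j. y j /\<^sub>R nrm (y 0)) = ennreal (inverse n0) * mass J y"
      using homogeneous_scaled[OF homogeneous_mass(2), of "inverse n0" J y] n0
      by (simp add: n0_def)
    then have "ennreal_powr (mass J (\<lambda>j. y j /\<^sub>R nrm (y 0))) (\<alpha> - 1)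
        = ennreal (inverse n0 powr (\<alpha> - 1)) * ennreal_powr (mass J y) (\<alpha> - 1)"
      using n0 by (simp add: ennreal_powr_mult)
    also have "inverse n0 powr (\<alpha> - 1) = n0 / n0 powr \<alpha>"
      using n0 by (simp add: powr_diff inverse_eq_divide powr_divide)
    also have "ennreal (n0 / n0 powr \<alpha>) = size_at 0 y / mag 0 y"
      using n0 by (simp add: size_at_def mag_def n0_def divide_ennreal)
    finally show "ennreal_powr (mass J (\<lambda>j. y j /\<^sub>R nrm (y 0))) (\<alpha> - 1)
      = size_at 0 y * ennreal_powr (mass J y) (\<alpha> - 1) / mag 0 y"
      by (simp add: divide_ennreal_def ac_simps)
  qed
qed

text \<open>For a path distributed as \<open>Y\<close> given \<open>past_small\<close>, this is distributed as \<open>\<Sum>|Q\<^sub>j|\<close>.\<close>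

definition cluster_size :: "(int \<Rightarrow> real ^ 'd) \<Rightarrow> ennreal" where
  "cluster_size y = mass UNIV (\<lambda>j. y j /\<^sub>R enn2real (SUP i. size_at i y))"

definition past_small :: "(int \<Rightarrow> real ^ 'd) set" where
  "past_small = {y. \<forall>k\<in>{..-1}. nrm (y k) \<le> 1}"

lemma lessThan_0_int: "{..<0::int} = {..-1}" "{0::int<..} = {1..}"
  by auto

lemma cluster_moment_eq:
  "(\<integral>\<^sup>+y. ennreal_powr (cluster_size y) \<alpha> * indicator past_small y \<partial>L)
    = (\<integral>\<^sup>+y. rise 0 y / mag 0 y * (ennreal_powr (mass UNIV y) \<alpha> / peak y) \<partial>L)"
proof -
  have "(\<integral>\<^sup>+y. ennreal_powr (cluster_size y) \<alpha> * indicator past_small y \<partial>L)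
      = (\<integral>\<^sup>+y. ennreal_powr (mass UNIV y) \<alpha> / peak y * indicator past_small y \<partial>L)"
  proof (rule nn_integral_cong_AE)
    show "AE y in L. ennreal_powr (cluster_size y) \<alpha> * indicator past_small y
        = ennreal_powr (mass UNIV y) \<alpha> / peak y * indicator past_small y"
      using AE_tame
    proof eventually_elim
      fix y assume *: "tame y"
      then obtain q where q: "0 \<le> q" "peak y = ennreal (q powr \<alpha>)" "(SUP i. size_at i y) = ennreal q"
        using peak_eq_powr_SUP_size[of y] by (metis tame_def)
      have q0: "q > 0" using q * by (cases "q = 0") (auto simp: tame_simps)
      have "cluster_size y = ennreal (inverse q) * mass UNIV y"
        using homogeneous_scaled[OF homogeneous_mass(2), of "inverse q" UNIV y] q q0
        by (simp add: cluster_size_def)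
      then have "ennreal_powr (cluster_size y) \<alpha> = ennreal (inverse q powr \<alpha>) * ennreal_powr (mass UNIV y) \<alpha>"
        using q0 by (simp add: ennreal_powr_mult)
      also have "ennreal (inverse q powr \<alpha>) = inverse (peak y)"
        using q0 q by (simp add: inverse_ennreal inverse_eq_divide powr_divide)
      finally show "ennreal_powr (cluster_size y) \<alpha> * indicator past_small y
          = ennreal_powr (mass UNIV y) \<alpha> / peak y * indicator past_small y"
        by (simp add: divide_ennreal_def ac_simps)
    qed
  qed
  also have "\<dots> = (\<integral>\<^sup>+y. ennreal_powr (mass UNIV y) \<alpha> / peak y * (rise 0 y / mag 0 y) \<partial>L)"
    unfolding past_small_def rise_def lessThan_0_int
  proof (rule no_exceedance)
    show "homogeneous 0 (\<lambda>y. ennreal_powr (mass UNIV y) \<alpha> / peak y)"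
      using homogeneous_ennreal_powr[OF homogeneous_mass(2)[of UNIV], of \<alpha>] homogeneous_peak_rise(1)
      by (intro homogeneous_divide[where p = \<alpha>]) simp_all
  qed measurable
  finally show ?thesis by (simp add: mult.commute)
qed

text \<open>Transport of \<open>v\<^sub>j = |y\<^sub>j| S\<^sup>\<alpha>\<^sup>-\<^sup>1\<close>.\<close>

lemma cluster_moment_eq_spectral_moment:
  "(\<integral>\<^sup>+y. ennreal_powr (cluster_size y) \<alpha> * indicator past_small y \<partial>L) = spectral_moment UNIV"
proof -
  have "(\<integral>\<^sup>+y. rise 0 y / mag 0 y * (ennreal_powr (mass UNIV y) \<alpha> / peak y) \<partial>L)
      = (\<integral>\<^sup>+y. rise 0 y / mag 0 y *
          ((\<integral>\<^sup>+j. size_at j y * ennreal_powr (mass UNIV y) (\<alpha> - 1) \<partial>count_space UNIV) / peak y) \<partial>L)"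
  proof (rule nn_integral_cong_AE)
    have "AE y in L. mass UNIV y < \<infinity> \<or> 1 \<le> \<alpha>"
      using mass_finite by (cases "1 \<le> \<alpha>") auto
    then show "AE y in L. rise 0 y / mag 0 y * (ennreal_powr (mass UNIV y) \<alpha> / peak y)
      = rise 0 y / mag 0 y *
          ((\<integral>\<^sup>+j. size_at j y * ennreal_powr (mass UNIV y) (\<alpha> - 1) \<partial>count_space UNIV) / peak y)"
    proof eventually_elim
      fix y assume "mass UNIV y < \<infinity> \<or> 1 \<le> \<alpha>"
      then have "(\<integral>\<^sup>+j. size_at j y * ennreal_powr (mass UNIV y) (\<alpha> - 1) \<partial>count_space UNIV)
          = ennreal_powr (mass UNIV y) \<alpha>"
        using mult_ennreal_powr_minus_1[of "mass UNIV y" \<alpha>] index_pos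
        by (simp add: nn_integral_multc mass_def)
      then show "rise 0 y / mag 0 y * (ennreal_powr (mass UNIV y) \<alpha> / peak y)
        = rise 0 y / mag 0 y *
          ((\<integral>\<^sup>+j. size_at j y * ennreal_powr (mass UNIV y) (\<alpha> - 1) \<partial>count_space UNIV) / peak y)" by simp
    qed
  qed
  also have "\<dots> = (\<integral>\<^sup>+y. size_at 0 y * ennreal_powr (mass UNIV y) (\<alpha> - 1) / mag 0 y \<partial>L)"
  proof (rule anchored_transport)
    show "homogeneous \<alpha> (\<lambda>y. size_at i y * ennreal_powr (mass UNIV y) (\<alpha> - 1))" for i
      using homogeneous_mult[OF homogeneous_mass(1)[of i] homogeneous_ennreal_powr[OF homogeneous_mass(2)[of UNIV]],
          of "\<alpha> - 1"] by simp
  qed (simp_all add: size_at_backshift mass_backshift size_at_eq_0)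
  finally show ?thesis unfolding cluster_moment_eq spectral_moment_eq .
qed

text \<open>Transport of \<open>v\<^sub>j = |y\<^sub>j| (\<Sum>\<^sub>i\<^sub>\<ge>\<^sub>j |y\<^sub>i|)\<^sup>\<alpha>\<^sup>-\<^sup>1\<close>, whose sum dominates \<open>2\<^sup>-\<^sup>\<alpha> S\<^sup>\<alpha>\<close>.\<close>

lemma cluster_moment_le_tail_moment:
  assumes "1 \<le> \<alpha>"
  shows "(\<integral>\<^sup>+y. ennreal_powr (cluster_size y) \<alpha> * indicator past_small y \<partial>L)
    \<le> ennreal (2 powr \<alpha>) * spectral_moment {0..}"
proof -
  let ?v = "\<lambda>j y. size_at j y * ennreal_powr (mass {j..} y) (\<alpha> - 1)"
  have "(\<integral>\<^sup>+y. rise 0 y / mag 0 y * (ennreal_powr (mass UNIV y) \<alpha> / peak y) \<partial>L)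
      \<le> (\<integral>\<^sup>+y. ennreal (2 powr \<alpha>) * (rise 0 y / mag 0 y * ((\<integral>\<^sup>+j. ?v j y \<partial>count_space UNIV) / peak y)) \<partial>L)"
  proof (rule nn_integral_mono)
    fix y
    have "ennreal_powr (mass UNIV y) \<alpha> \<le> ennreal (2 powr \<alpha>) * (\<integral>\<^sup>+j. ?v j y \<partial>count_space UNIV)"
      unfolding mass_def by (rule powr_sum_le_sum_tail_powr[OF assms])
    then have "rise 0 y / mag 0 y * (ennreal_powr (mass UNIV y) \<alpha> / peak y)
        \<le> rise 0 y / mag 0 y * (ennreal (2 powr \<alpha>) * (\<integral>\<^sup>+j. ?v j y \<partial>count_space UNIV) / peak y)"
      by (intro mult_left_mono divide_right_mono_ennreal) auto
    then show "rise 0 y / mag 0 y * (ennreal_powr (mass UNIV y) \<alpha> / peak y)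
        \<le> ennreal (2 powr \<alpha>) * (rise 0 y / mag 0 y * ((\<integral>\<^sup>+j. ?v j y \<partial>count_space UNIV) / peak y))"
      by (simp add: divide_ennreal_def ac_simps)
  qed
  also have "\<dots> = ennreal (2 powr \<alpha>) *
      (\<integral>\<^sup>+y. rise 0 y / mag 0 y * ((\<integral>\<^sup>+j. ?v j y \<partial>count_space UNIV) / peak y) \<partial>L)"
    by (rule nn_integral_cmult) measurable
  also have "(\<integral>\<^sup>+y. rise 0 y / mag 0 y * ((\<integral>\<^sup>+j. ?v j y \<partial>count_space UNIV) / peak y) \<partial>L)
      = (\<integral>\<^sup>+y. ?v 0 y / mag 0 y \<partial>L)"
  proof (rule anchored_transport)
    show "homogeneous \<alpha> (?v i)" for i
      using homogeneous_mult[OF homogeneous_mass(1)[of i] homogeneous_ennreal_powr[OF homogeneous_mass(2)[of "{i..}"]],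
          of "\<alpha> - 1"] by simp
  qed (simp_all add: size_at_backshift mass_backshift size_at_eq_0)
  finally show ?thesis unfolding cluster_moment_eq spectral_moment_eq .
qed

lemma no_exceedance_probability:
  "emeasure L {y. \<forall>k\<in>J. nrm (y k) \<le> 1} = (\<integral>\<^sup>+y. (mag 0 y - (SUP k\<in>J. mag k y)) / mag 0 y \<partial>L)"
proof -
  have [measurable]: "{y. \<forall>k\<in>J. nrm (y k) \<le> 1} \<in> sets path_space"
    by (rule sets_path_Collect) measurable
  have "homogeneous 0 (\<lambda>_. 1)" by (simp add: homogeneous_def)
  from no_exceedance[OF _ this, of J] show ?thesis by simp
qed

text \<open>Transport from the records read forwards in time to the records read backwards.\<close>

lemma past_small_eq_future_small:
  "emeasure L past_small = emeasure L {y. \<forall>k\<in>{1..}. nrm (y k) \<le> 1}"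
proof -
  have "emeasure L past_small = (\<integral>\<^sup>+y. rise 0 y / mag 0 y \<partial>L)"
    unfolding past_small_def no_exceedance_probability rise_def lessThan_0_int ..
  also have "\<dots> = (\<integral>\<^sup>+y. rise 0 y / mag 0 y * ((\<integral>\<^sup>+j. drop_after j y \<partial>count_space UNIV) / peak y) \<partial>L)"
    by (rule nn_integral_cong_AE) (use AE_tame in eventually_elim, simp add: tame_simps)
  also have "\<dots> = (\<integral>\<^sup>+y. drop_after 0 y / mag 0 y \<partial>L)"
    by (rule anchored_transport) (auto simp: backshift_peak_rise rise_at_zero intro: homogeneous_peak_rise)
  also have "\<dots> = emeasure L {y. \<forall>k\<in>{1..}. nrm (y k) \<le> 1}"
    unfolding no_exceedance_probability drop_after_def lessThan_0_int ..
  finally show ?thesis .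
qed

text \<open>If \<open>rise 0\<close> were almost surely 0, the transport of \<open>v\<^sub>j = a\<^sub>j\<close> would give \<open>0 = 1\<close>.\<close>

lemma past_small_positive: "emeasure L past_small \<noteq> 0"
proof
  assume "emeasure L past_small = 0"
  then have "(\<integral>\<^sup>+y. rise 0 y / mag 0 y \<partial>L) = 0"
    unfolding past_small_def no_exceedance_probability rise_def lessThan_0_int .
  then have "AE y in L. rise 0 y / mag 0 y = 0"
    by (subst (asm) nn_integral_0_iff_AE) auto
  then have "(\<integral>\<^sup>+y. rise 0 y / mag 0 y * (mag_sum y / peak y) \<partial>L) = (\<integral>\<^sup>+y. 0 \<partial>L)"
    by (intro nn_integral_cong_AE) (auto elim!: eventually_mono)
  then show False using mag_sum_transport by simp
qed

lemma spectral_moment_le_1: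
  assumes "\<alpha> \<le> 1" "0 \<in> J"
  shows "spectral_moment J \<le> 1"
proof -
  have "spectral_moment J \<le> (\<integral>\<^sup>+y. 1 \<partial>L)"
    unfolding spectral_moment_def
  proof (rule nn_integral_mono_AE)
    show "AE y in L. ennreal_powr (mass J (\<lambda>j. y j /\<^sub>R nrm (y 0))) (\<alpha> - 1) \<le> 1"
      using exceeds
    proof eventually_elim
      fix y :: "int \<Rightarrow> real ^ 'd" assume n: "1 < nrm (y 0)"
      let ?s = "mass J (\<lambda>j. y j /\<^sub>R nrm (y 0))"
      let ?y = "\<lambda>j. y j /\<^sub>R nrm (y 0)"
      have "1 = size_at 0 ?y" using n by (simp add: size_at_def nrm_scale)
      also have "\<dots> = (\<integral>\<^sup>+j. size_at j ?y * indicator {0} j \<partial>count_space J)"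
        using assms(2) by (subst nn_integral_count_space'[of "{0}"]) auto
      also have "\<dots> \<le> ?s" unfolding mass_def by (rule nn_integral_mono) (simp add: indicator_def)
      finally have s: "1 \<le> ?s" .
      show "ennreal_powr ?s (\<alpha> - 1) \<le> 1"
      proof (cases ?s rule: ennreal_cases)
        case (real r)
        then have "1 \<le> r" using s by (simp flip: ennreal_1)
        then have "r powr (\<alpha> - 1) \<le> 1" using assms(1) powr_mono[of "\<alpha> - 1" 0 r] by simp
        then show ?thesis using real \<open>1 \<le> r\<close> by (simp add: ennreal_powr_def flip: ennreal_1)
      qed (use assms(1) in \<open>simp add: ennreal_powr_def\<close>)
    qed
  qed
  also have "\<dots> = 1" using emeasure_space_1 by simp
  finally show ?thesis .
qed

lemma spectral_moment_mono:
  assumes "1 \<le> \<alpha>" "I \<subseteq> J"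
  shows "spectral_moment I \<le> spectral_moment J"
  unfolding spectral_moment_def
proof (intro nn_integral_mono ennreal_powr_mono)
  fix y
  show "mass I (\<lambda>j. y j /\<^sub>R nrm (y 0)) \<le> mass J (\<lambda>j. y j /\<^sub>R nrm (y 0))"
    unfolding mass_def using assms(2) by (simp add: nn_integral_count_space_indicator)
      (intro nn_integral_mono, auto simp: indicator_def)
qed (use assms in simp)

end

section \<open>The tail process of a regularly varying time series\<close>

lemma tail_law_path_law:
  fixes X :: "int \<Rightarrow> 'w \<Rightarrow> real ^ 'd" and Y :: "int \<Rightarrow> 'y \<Rightarrow> real ^ 'd"
  assumes nrm: "is_norm nrm" and X: "stationary_process M X"
    and \<alpha>: "0 < \<alpha>" and Y: "tail_process nrm M X \<alpha> MY Y"
    and vanish: "AE \<omega> in MY. ((\<lambda>k. nrm (Y k \<omega>)) \<longlongrightarrow> 0) at_top \<and> ((\<lambda>k. nrm (Y k \<omega>)) \<longlongrightarrow> 0) at_bot"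
  shows "tail_law nrm \<alpha> (path_law MY Y)"
proof -
  have PY: "process MY Y" by (rule tail_process_process[OF Y])
  have PX: "process M X" using X by (simp add: stationary_process_def)
  have [measurable]: "nrm \<in> borel_measurable borel" by (rule is_norm_measurable[OF nrm])
  have AE_path: "AE y in path_law MY Y. P y" if "AE \<omega> in MY. P (\<lambda>j. Y j \<omega>)" "Measurable.pred path_space P" for P
    unfolding path_law_def using that
    by (subst AE_distr_iff[OF process_path_measurable[OF PY]]) (simp_all add: pred_def)
  \<comment> \<open>Countably many thresholds make convergence to 0 visibly measurable.\<close>
  have lim_iff: "((\<lambda>k. nrm (y k)) \<longlongrightarrow> 0) F \<longleftrightarrow> (\<forall>n. eventually (\<lambda>k. nrm (y k) < 1 / real (Suc n)) F)"
    for y :: "int \<Rightarrow> real ^ 'd" and F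
  proof
    assume "((\<lambda>k. nrm (y k)) \<longlongrightarrow> 0) F"
    then show "\<forall>n. eventually (\<lambda>k. nrm (y k) < 1 / real (Suc n)) F"
      by (intro allI order_tendstoD) auto
  next
    assume *: "\<forall>n. eventually (\<lambda>k. nrm (y k) < 1 / real (Suc n)) F"
    show "((\<lambda>k. nrm (y k)) \<longlongrightarrow> 0) F"
    proof (rule tendstoI)
      fix e :: real assume "0 < e"
      then obtain n where n: "1 / real (Suc n) < e" using nat_approx_posE by blast
      show "eventually (\<lambda>k. dist (nrm (y k)) 0 < e) F"
        using *[rule_format, of n]
        by eventually_elim (use n nrm in \<open>auto simp: is_norm_def intro: less_trans\<close>)
    qed
  qed
  show ?thesis
  proof (rule tail_law.intro)
    show "is_norm nrm" "0 < \<alpha>" by fact+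
    show "prob_space (path_law MY Y)" by (rule prob_space_path_law[OF PY])
    show "AE y in path_law MY Y. 1 < nrm (y 0)"
      using tail_process_exceeds[OF nrm Y] by (rule AE_path) measurable
    show "AE y in path_law MY Y. ((\<lambda>k. nrm (y k)) \<longlongrightarrow> 0) at_top \<and> ((\<lambda>k. nrm (y k)) \<longlongrightarrow> 0) at_bot"
    proof (rule AE_path[OF vanish])
      show "Measurable.pred path_space
          (\<lambda>y. ((\<lambda>k. nrm (y k)) \<longlongrightarrow> 0) at_top \<and> ((\<lambda>k. nrm (y k)) \<longlongrightarrow> 0) at_bot)"
        unfolding lim_iff eventually_at_top_linorder eventually_at_bot_linorder by measurable
    qed
  qed (simp, rule tail_law_shift[OF nrm X Y], assumption, rule tail_law_scale[OF nrm PX Y], assumption+)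
qed

theorem lemma3p11:
  fixes nrm :: "real ^ 'd \<Rightarrow> real"
    and M :: "'w measure" and X :: "int \<Rightarrow> 'w \<Rightarrow> real ^ 'd"
    and \<alpha> :: real
    and MY :: "'y measure" and Y :: "int \<Rightarrow> 'y \<Rightarrow> real ^ 'd"
    and MQ :: "'q measure" and Q :: "int \<Rightarrow> 'q \<Rightarrow> real ^ 'd"
  assumes "is_norm nrm"
    and "stationary_process M X"
    and "regularly_varying nrm M X \<alpha>"
    and "tail_process nrm M X \<alpha> MY Y"
    and "AE \<omega> in MY. ((\<lambda>k. nrm (Y k \<omega>)) \<longlongrightarrow> 0) at_top \<and> ((\<lambda>k. nrm (Y k \<omega>)) \<longlongrightarrow> 0) at_bot"
    and "Q_sequence nrm MY Y MQ Q"
  shows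
    "let \<Theta> = spectral_tail_process nrm Y;
         \<theta> = ennreal (candidate_extremal_index nrm MY Y);
         EQ = (\<integral>\<^sup>+\<omega>. ennreal_powr (sum_norm nrm Q UNIV \<omega>) \<alpha> \<partial>MQ);
         E\<Theta> = (\<integral>\<^sup>+\<omega>. ennreal_powr (sum_norm nrm \<Theta> UNIV \<omega>) (\<alpha> - 1) \<partial>MY);
         E\<Theta>_pos = (\<integral>\<^sup>+\<omega>. ennreal_powr (sum_norm nrm \<Theta> {0..} \<omega>) (\<alpha> - 1) \<partial>MY)
     in \<theta> * EQ = E\<Theta> \<and>
        (\<alpha> \<le> 1 \<longrightarrow> EQ < \<infinity> \<and> E\<Theta> < \<infinity>) \<and>
        (\<alpha> > 1 \<longrightarrow> (EQ < \<infinity> \<longleftrightarrow> E\<Theta> < \<infinity>)) \<and>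
        (EQ < \<infinity> \<longleftrightarrow> E\<Theta>_pos < \<infinity>)"
proof -
  have \<alpha>: "0 < \<alpha>" using assms(3) by (simp add: regularly_varying_def)
  have PY: "process MY Y" by (rule tail_process_process[OF assms(4)])
  interpret MY: prob_space MY using PY by (simp add: process_def)
  define L where "L = path_law MY Y"
  interpret tail_law nrm \<alpha> L
    unfolding L_def using assms(1,2) \<alpha> assms(4,5) by (rule tail_law_path_law)
  have [measurable]: "Y j \<in> borel_measurable MY" for j using PY by (simp add: process_def)
  have pull: "(\<integral>\<^sup>+y. H y \<partial>L) = (\<integral>\<^sup>+\<omega>. H (\<lambda>j. Y j \<omega>) \<partial>MY)" if "H \<in> borel_measurable path_space" for H
    unfolding L_def using PY that by (rule nn_integral_path_law)
  have scaled [measurable]: "(\<lambda>y j. y j /\<^sub>R f y) \<in> measurable path_space path_space"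
    if [measurable]: "f \<in> borel_measurable path_space" for f :: "(int \<Rightarrow> real ^ 'd) \<Rightarrow> real"
    by (rule measurable_abs_UNIV) measurable
  have sum: "sum_norm nrm Z J \<omega> = mass J (\<lambda>j. Z j \<omega>)" for Z :: "int \<Rightarrow> 'z \<Rightarrow> real ^ 'd" and J \<omega>
    by (simp add: sum_norm_def infsum_int_eq_nn_integral mass_def size_at_def)

  define E\<Theta> where "E\<Theta> J = (\<integral>\<^sup>+\<omega>. ennreal_powr (sum_norm nrm (spectral_tail_process nrm Y) J \<omega>) (\<alpha> - 1) \<partial>MY)" for J
  have E\<Theta>: "E\<Theta> J = spectral_moment J" for J
    unfolding E\<Theta>_def spectral_moment_def
    by (subst pull) (simp_all add: sum_norm_def infsum_int_eq_nn_integral mass_def size_at_def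
      spectral_tail_process_def)

  define \<theta> where "\<theta> = ennreal (candidate_extremal_index nrm MY Y)"
  define EQ where "EQ = (\<integral>\<^sup>+\<omega>. ennreal_powr (sum_norm nrm Q UNIV \<omega>) \<alpha> \<partial>MQ)"
  have sup_iff: "sup_norm nrm Y J \<omega> \<le> 1 \<longleftrightarrow> (\<forall>k\<in>J. nrm (Y k \<omega>) \<le> 1)" for J \<omega>
    by (simp add: sup_norm_def SUP_le_iff flip: ennreal_1)
  have small: "emeasure L {y. \<forall>k\<in>J. nrm (y k) \<le> 1} = emeasure MY {\<omega> \<in> space MY. sup_norm nrm Y J \<omega> \<le> 1}" for J
  proof -
    have "{y. \<forall>k\<in>J. nrm (y k) \<le> 1} \<in> sets path_space" by (rule sets_path_Collect) measurable
    then show ?thesis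
      unfolding L_def sup_iff by (simp add: emeasure_path_law[OF PY] MY.emeasure_eq_measure)
  qed
  let ?A = "{\<omega> \<in> space MY. sup_norm nrm Y {..-1} \<omega> \<le> 1}"
  have \<theta>: "\<theta> = emeasure MY ?A"
  proof -
    have "\<theta> = emeasure L {y. \<forall>k\<in>{1..}. nrm (y k) \<le> 1}"
      unfolding small \<theta>_def candidate_extremal_index_def by (simp add: MY.emeasure_eq_measure)
    also have "\<dots> = emeasure L past_small" by (rule past_small_eq_future_small[symmetric])
    also have "\<dots> = emeasure MY ?A" unfolding past_small_def small ..
    finally show ?thesis .
  qed
  have \<theta>0: "\<theta> \<noteq> 0" using past_small_positive unfolding past_small_def small \<theta> .
  have \<theta>top: "\<theta> \<noteq> top" by (simp add: \<theta>_def)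
  have A: "?A \<in> sets MY" using \<theta>0 unfolding \<theta> by (rule emeasure_neq_0_sets)

  let ?norm = "\<lambda>y j. y j /\<^sub>R enn2real (SUP i. size_at i y) :: real ^ 'd"
  let ?U = "uniform_measure MY ?A"
  have "process ?U (\<lambda>j \<omega>. Y j \<omega> /\<^sub>R enn2real (sup_norm nrm Y UNIV \<omega>))"
    unfolding process_def
  proof (intro conjI allI)
    show "prob_space ?U"
      using \<theta>0 \<theta>top unfolding \<theta> by (intro prob_space_uniform_measure) auto
    have "(\<lambda>\<omega>. sup_norm nrm Y UNIV \<omega>) \<in> borel_measurable MY"
      unfolding sup_norm_def[abs_def] by measurable
    note this [measurable]
    show "(\<lambda>\<omega>. Y j \<omega> /\<^sub>R enn2real (sup_norm nrm Y UNIV \<omega>)) \<in> borel_measurable ?U" for j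
      by measurable
  qed
  note PU = this
  have PQ: "process MQ Q" and law: "path_law MQ Q = path_law ?U (\<lambda>j \<omega>. Y j \<omega> /\<^sub>R enn2real (sup_norm nrm Y UNIV \<omega>))"
    using assms(6) by (auto simp: Q_sequence_def)
  have "EQ = (\<integral>\<^sup>+q. ennreal_powr (mass UNIV q) \<alpha> \<partial>path_law MQ Q)"
    unfolding EQ_def sum by (rule nn_integral_path_law[OF PQ, symmetric]) measurable
  also have "\<dots> = (\<integral>\<^sup>+\<omega>. ennreal_powr (cluster_size (\<lambda>j. Y j \<omega>)) \<alpha> \<partial>?U)"
    unfolding law by (subst nn_integral_path_law[OF PU]) (simp_all add: cluster_size_def sup_norm_def size_at_def)
  also have "\<dots> = (\<integral>\<^sup>+\<omega>. ennreal_powr (cluster_size (\<lambda>j. Y j \<omega>)) \<alpha> * indicator ?A \<omega> \<partial>MY) / \<theta>"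
    unfolding \<theta>
  proof (rule nn_integral_uniform_measure[OF _ A])
    have "(\<lambda>y. ennreal_powr (cluster_size y) \<alpha>) \<in> borel_measurable path_space"
      unfolding cluster_size_def by measurable
    from measurable_compose[OF process_path_measurable[OF PY] this]
    show "(\<lambda>\<omega>. ennreal_powr (cluster_size (\<lambda>j. Y j \<omega>)) \<alpha>) \<in> borel_measurable MY" .
  qed
  also have "(\<integral>\<^sup>+\<omega>. ennreal_powr (cluster_size (\<lambda>j. Y j \<omega>)) \<alpha> * indicator ?A \<omega> \<partial>MY)
      = (\<integral>\<^sup>+y. ennreal_powr (cluster_size y) \<alpha> * indicator past_small y \<partial>L)"
  proof (subst pull)
    have [measurable]: "past_small \<in> sets path_space"
      unfolding past_small_def by (rule sets_path_Collect) measurable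
    show "(\<lambda>y. ennreal_powr (cluster_size y) \<alpha> * indicator past_small y) \<in> borel_measurable path_space"
      unfolding cluster_size_def by measurable
    show "(\<integral>\<^sup>+\<omega>. ennreal_powr (cluster_size (\<lambda>j. Y j \<omega>)) \<alpha> * indicator ?A \<omega> \<partial>MY)
      = (\<integral>\<^sup>+\<omega>. ennreal_powr (cluster_size (\<lambda>j. Y j \<omega>)) \<alpha> * indicator past_small (\<lambda>j. Y j \<omega>) \<partial>MY)"
      by (intro nn_integral_cong) (simp add: past_small_def indicator_def sup_iff)
  qed
  finally have "EQ = (\<integral>\<^sup>+y. ennreal_powr (cluster_size y) \<alpha> * indicator past_small y \<partial>L) / \<theta>" .
  then have EQ: "\<theta> * EQ = (\<integral>\<^sup>+y. ennreal_powr (cluster_size y) \<alpha> * indicator past_small y \<partial>L)"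
    using mult_divide_eq_ennreal[OF \<theta>0 \<theta>top] by (simp only: ennreal_times_divide mult.commute[of \<theta>])

  have main: "\<theta> * EQ = E\<Theta> UNIV"
    unfolding EQ E\<Theta> by (rule cluster_moment_eq_spectral_moment)
  have fin: "EQ < \<infinity> \<longleftrightarrow> E\<Theta> UNIV < \<infinity>"
    unfolding main[symmetric] infinity_ennreal_def ennreal_mult_less_top
    using \<theta>0 \<theta>top by (auto simp: less_top)
  have low: "E\<Theta> J < \<infinity>" if "\<alpha> \<le> 1" "0 \<in> J" for J
    using le_less_trans[OF spectral_moment_le_1[OF that]] by (simp add: E\<Theta>)
  have pos: "EQ < \<infinity> \<longleftrightarrow> E\<Theta> {0..} < \<infinity>"
  proof (cases "\<alpha> \<le> 1")
    case True
    then show ?thesis using low fin by simp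
  next
    case False
    then have \<alpha>1: "1 \<le> \<alpha>" by simp
    show ?thesis
    proof
      assume "EQ < \<infinity>"
      moreover have "E\<Theta> {0..} \<le> E\<Theta> UNIV" unfolding E\<Theta> using \<alpha>1 by (rule spectral_moment_mono) simp
      ultimately show "E\<Theta> {0..} < \<infinity>" using fin by (auto intro: le_less_trans)
    next
      assume "E\<Theta> {0..} < \<infinity>"
      then have "ennreal (2 powr \<alpha>) * E\<Theta> {0..} < \<infinity>" by (simp add: ennreal_mult_less_top)
      then have "\<theta> * EQ < \<infinity>"
        using cluster_moment_le_tail_moment[OF \<alpha>1] unfolding EQ E\<Theta> by (rule le_less_trans[rotated])
      then show "EQ < \<infinity>" using fin main by simp
    qed
  qed
  have "\<theta> * EQ = E\<Theta> UNIV \<and> (\<alpha> \<le> 1 \<longrightarrow> EQ < \<infinity> \<and> E\<Theta> UNIV < \<infinity>) \<and>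
      (\<alpha> > 1 \<longrightarrow> (EQ < \<infinity> \<longleftrightarrow> E\<Theta> UNIV < \<infinity>)) \<and> (EQ < \<infinity> \<longleftrightarrow> E\<Theta> {0..} < \<infinity>)"
    using main fin low[of UNIV] pos by blast
  then show ?thesis unfolding Let_def \<theta>_def EQ_def E\<Theta>_def .
qed

end
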